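(* Let $p,q$ be odd primes with $p\mid q-1$, let $G=\mathbb Z/q\mathbb Z\rtimes\mathbb Z/p\mathbb Z$ be the nonabelian group of order $pq$, and for $u\in\{0,\dots,p-1\}$ let $\mathcal Z(\mathrm{Vec}_G^{\omega^u})$ be the modular category described in the context. The $T$-matrix and the $B$-tensor together form a complete set of invariants for these $p$ modular categories. More precisely: let $u,u'\in\{0,\dots,p-1\}$ and suppose there is a map $\kappa$ from the set of (isomorphism classes of) simple objects of $\mathcal Z(\mathrm{Vec}_G^{\omega^u})$ to the set of (isomorphism classes of) simple objects of $\mathcal Z(\mathrm{Vec}_G^{\omega^{u'}})$ such that $T_{\kappa(V)}=T_V$ and $B_{\kappa(U),\kappa(V),\kappa(W)}=B_{U,V,W}$ for all simple objects $U,V,W$ of $\mathcal Z(\mathrm{Vec}_G^{\omega^u})$. Then $u=u'$.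
   Context: **The group and cocycle.** $G=\langle a,b\mid a^q=b^p=1,\ bab^{-1}=a^n\rangle$ where $n\in\mathbb Z/q\mathbb Z$ satisfies $n\not\equiv1$ and $n^p\equiv 1 \bmod q$ (the group does not depend on the choice of $n$). On $\langle b\rangle\cong\mathbb Z/p\mathbb Z$ define the normalized 3-cocycle $\omega(b^i,b^j,b^k)=\exp\left(\frac{2\pi \mathrm i}{p^2}[i]([j]+[k]-[j+k])\right)$, where $[i]\in\{0,\dots,p-1\}$, $[i]\equiv i \bmod p$. Its inflation along $G\to G/\langle a\rangle\cong\langle b\rangle$ is a 3-cocycle on $G$, also denoted $\omega$, and $\omega^u$ is its $u$-th power. **The category.** For a finite group $G$ and a normalized 3-cocycle $\omega\colon G^3\to\mathbb C^\times$, $\mathrm{Vec}_G^\omega$ is the category of finite-dimensional $G$-graded vector spaces with associativity isomorphism $\Phi\colon U\otimes(V\otimes W)\to(U\otimes V)\otimes W$, $u\otimes(v\otimes w)\mapsto\omega(|u|,|v|,|w|)(u\otimes v)\otimes w$ on homogeneous elements ($|u|$ is the degree of $u$). Write $g\triangleright h=ghg^{-1}$. $\mathcal Z(\mathrm{Vec}_G^\omega)$ is the (right) Drinfeld center: objects are graded spaces $W$ with linear maps $g\triangleright\colon W\to W$ ($g\in G$) satisfying $|g\triangleright w|=g\triangleright|w|$, $e\triangleright w=w$, $g\triangleright(h\triangleright w)=\alpha_{|w|}(g,h)\,(gh)\triangleright w$, where $\alpha_g(x,y)=\omega(x,y,g)\,\omega(x,y\triangleright g,y)^{-1}\,\omega((xy)\triangleright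 g,x,y)$; the braiding is $\sigma_{V,W}(v\otimes w)=|v|\triangleright w\otimes v$. It is a modular category with the spherical structure for which pivotal traces are ordinary traces of linear maps. Simple objects are parametrized by pairs $(g,\chi)$, with $g$ running over representatives of conjugacy classes and $\chi$ an irreducible $\alpha_g$-projective character of $C_G(g)$: the simple $V$ has support the conjugacy class of $g$, and $\chi$ is the character of $C_G(g)$ acting on the homogeneous component $V_g$. **$T$-matrix.** $T_V$ is the scalar by which the twist acts on the simple object $V$; for $V$ corresponding to $(g,\chi)$, $T_V=\chi(g)/\chi(1)$. **$B$-tensor.** For simple objects $U,V,W$ of a modular category, $B_{U,V,W}=\mathrm{ptr}\left(R((\sigma_2^{-1}\sigma_1)^3)\right)$, the pivotal trace of the automorphism of $(U\otimes V)\otimes W$ given by the pure braid $(\sigma_2^{-1}\sigma_1)^3\in\mathbb B_3$ (with $\sigma_1$ acting first), where $R$ sends $\sigma_1$ to the braiding of the first two tensor factors and $\sigma_2$ to the braiding of the last two (conjugated by associativity isomorphisms), and $R(\beta\beta')=R(\beta)R(\beta')$. *)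

theory Defs
  imports
    Complex_Main
    "HOL-Algebra.Group"
    "HOL-Number_Theory.Cong"
    "Jordan_Normal_Form.Gauss_Jordan_Elimination"
    "Jordan_Normal_Form.Spectral_Radius"
begin

section \<open>The group of order \<open>pq\<close> and its cocycle\<close>

text \<open>The group with generators \<open>a\<close>, \<open>b\<close> and relations \<open>a ^ q = b ^ p = 1\<close>, \<open>b a b\<inverse> = a ^ n\<close>,
  for \<open>n ^ p \<equiv> 1\<close> modulo \<open>q\<close>. The pair \<open>(i, j)\<close> stands for \<open>a ^ i b ^ j\<close>; see
  \<open>pq_group_relations\<close> below.\<close>

definition pq_group :: "nat \<Rightarrow> nat \<Rightarrow> nat \<Rightarrow> (nat \<times> nat) monoid" where
  "pq_group p q n =
     \<lparr>carrier = {0..<q} \<times> {0..<p},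
      mult = (\<lambda>(i, j) (k, l). ((i + n ^ j * k) mod q, (j + l) mod p)),
      one = (0, 0)\<rparr>"

definition cyc_cocycle :: "nat \<Rightarrow> nat \<Rightarrow> nat \<Rightarrow> nat \<Rightarrow> complex" where
  "cyc_cocycle p i j k =
     exp (2 * of_real pi * \<i> / (of_nat p)\<^sup>2
          * (of_nat (i mod p)
             * (of_nat (j mod p) + of_nat (k mod p) - of_nat ((j + k) mod p))))"

definition pq_cocycle :: "nat \<Rightarrow> nat \<Rightarrow> nat \<times> nat \<Rightarrow> nat \<times> nat \<Rightarrow> nat \<times> nat \<Rightarrow> complex" where
  "pq_cocycle p u x y z = cyc_cocycle p (snd x) (snd y) (snd z) ^ u"

definition normalized_3cocycle ::
    "('g, 'm) monoid_scheme \<Rightarrow> ('g \<Rightarrow> 'g \<Rightarrow> 'g \<Rightarrow> complex) \<Rightarrow> bool" where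
  "normalized_3cocycle G \<omega> \<longleftrightarrow>
     (\<forall>x\<in>carrier G. \<forall>y\<in>carrier G. \<forall>z\<in>carrier G. \<omega> x y z \<noteq> 0) \<and>
     (\<forall>w\<in>carrier G. \<forall>x\<in>carrier G. \<forall>y\<in>carrier G. \<forall>z\<in>carrier G.
        \<omega> x y z * \<omega> w (x \<otimes>\<^bsub>G\<^esub> y) z * \<omega> w x y
          = \<omega> (w \<otimes>\<^bsub>G\<^esub> x) y z * \<omega> w x (y \<otimes>\<^bsub>G\<^esub> z)) \<and>
     (\<forall>x\<in>carrier G. \<forall>y\<in>carrier G.
        \<omega> \<one>\<^bsub>G\<^esub> x y = 1 \<and> \<omega> x \<one>\<^bsub>G\<^esub> y = 1 \<and> \<omega> x y \<one>\<^bsub>G\<^esub> = 1)"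


section \<open>The Drinfeld center of \<open>Vec\<^sub>G\<^sup>\<omega>\<close>\<close>

definition conj_by :: "('g, 'm) monoid_scheme \<Rightarrow> 'g \<Rightarrow> 'g \<Rightarrow> 'g" where
  "conj_by G g h = g \<otimes>\<^bsub>G\<^esub> h \<otimes>\<^bsub>G\<^esub> inv\<^bsub>G\<^esub> g"

definition alpha ::
    "('g, 'm) monoid_scheme \<Rightarrow> ('g \<Rightarrow> 'g \<Rightarrow> 'g \<Rightarrow> complex) \<Rightarrow> 'g \<Rightarrow> 'g \<Rightarrow> 'g \<Rightarrow> complex" where
  "alpha G \<omega> g x y =
     \<omega> x y g * inverse (\<omega> x (conj_by G y g) y) * \<omega> (conj_by G (x \<otimes>\<^bsub>G\<^esub> y) g) x y"

text \<open>A finite-dimensional graded space is given in coordinates with respect to a basis of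
  homogeneous vectors: the underlying space is \<open>\<complex>\<^sup>d\<close>, the \<open>i\<close>-th standard basis vector has degree
  \<^term>\<open>degs V ! i\<close>, and \<open>g \<triangleright> v\<close> is \<^term>\<open>action V g *\<^sub>v v\<close>.\<close>

record 'g center_obj =
  degs :: "'g list"
  action :: "'g \<Rightarrow> complex mat"

abbreviation cdim :: "'g center_obj \<Rightarrow> nat" where
  "cdim V \<equiv> length (degs V)"

definition component :: "'g center_obj \<Rightarrow> 'g \<Rightarrow> complex vec set" where
  "component V h = {w \<in> carrier_vec (cdim V). \<forall>i<cdim V. w $ i \<noteq> 0 \<longrightarrow> degs V ! i = h}"

definition component_proj :: "'g center_obj \<Rightarrow> 'g \<Rightarrow> complex vec \<Rightarrow> complex vec" where
  "component_proj V h w = vec (cdim V) (\<lambda>i. if degs V ! i = h then w $ i else 0)"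

definition center_object ::
    "('g, 'm) monoid_scheme \<Rightarrow> ('g \<Rightarrow> 'g \<Rightarrow> 'g \<Rightarrow> complex) \<Rightarrow> 'g center_obj \<Rightarrow> bool" where
  "center_object G \<omega> V \<longleftrightarrow>
     set (degs V) \<subseteq> carrier G \<and>
     (\<forall>g\<in>carrier G. action V g \<in> carrier_mat (cdim V) (cdim V)) \<and>
     (\<forall>g\<in>carrier G. \<forall>k\<in>carrier G. \<forall>w\<in>component V k.
        action V g *\<^sub>v w \<in> component V (conj_by G g k)) \<and>
     (\<forall>w\<in>carrier_vec (cdim V). action V \<one>\<^bsub>G\<^esub> *\<^sub>v w = w) \<and>
     (\<forall>g\<in>carrier G. \<forall>h\<in>carrier G. \<forall>k\<in>carrier G. \<forall>w\<in>component V k.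
        action V g *\<^sub>v (action V h *\<^sub>v w)
          = alpha G \<omega> k g h \<cdot>\<^sub>v (action V (g \<otimes>\<^bsub>G\<^esub> h) *\<^sub>v w))"

definition center_morphism ::
    "('g, 'm) monoid_scheme \<Rightarrow> 'g center_obj \<Rightarrow> 'g center_obj \<Rightarrow> complex mat \<Rightarrow> bool" where
  "center_morphism G V W P \<longleftrightarrow>
     P \<in> carrier_mat (cdim W) (cdim V) \<and>
     (\<forall>h\<in>carrier G. \<forall>v\<in>component V h. P *\<^sub>v v \<in> component W h) \<and>
     (\<forall>g\<in>carrier G. P * action V g = action W g * P)"

definition center_iso :: "('g, 'm) monoid_scheme \<Rightarrow> 'g center_obj \<Rightarrow> 'g center_obj \<Rightarrow> bool" where
  "center_iso G V W \<longleftrightarrow>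
     (\<exists>P Q. center_morphism G V W P \<and> center_morphism G W V Q \<and>
            Q * P = 1\<^sub>m (cdim V) \<and> P * Q = 1\<^sub>m (cdim W))"

definition subobject_space ::
    "('g, 'm) monoid_scheme \<Rightarrow> 'g center_obj \<Rightarrow> complex vec set \<Rightarrow> bool" where
  "subobject_space G V S \<longleftrightarrow>
     S \<subseteq> carrier_vec (cdim V) \<and> 0\<^sub>v (cdim V) \<in> S \<and>
     (\<forall>v\<in>S. \<forall>w\<in>S. v + w \<in> S) \<and> (\<forall>c. \<forall>v\<in>S. c \<cdot>\<^sub>v v \<in> S) \<and>
     (\<forall>h\<in>carrier G. \<forall>v\<in>S. component_proj V h v \<in> S) \<and>
     (\<forall>g\<in>carrier G. \<forall>v\<in>S. action V g *\<^sub>v v \<in> S)"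

definition simple_object ::
    "('g, 'm) monoid_scheme \<Rightarrow> ('g \<Rightarrow> 'g \<Rightarrow> 'g \<Rightarrow> complex) \<Rightarrow> 'g center_obj \<Rightarrow> bool" where
  "simple_object G \<omega> V \<longleftrightarrow>
     center_object G \<omega> V \<and> cdim V > 0 \<and>
     (\<forall>S. subobject_space G V S \<longrightarrow> S = {0\<^sub>v (cdim V)} \<or> S = carrier_vec (cdim V))"

definition simple_iso_rel ::
    "('g, 'm) monoid_scheme \<Rightarrow> ('g \<Rightarrow> 'g \<Rightarrow> 'g \<Rightarrow> complex) \<Rightarrow> ('g center_obj \<times> 'g center_obj) set" where
  "simple_iso_rel G \<omega> = {(V, W). simple_object G \<omega> V \<and> simple_object G \<omega> W \<and> center_iso G V W}"

definition simple_classes ::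
    "('g, 'm) monoid_scheme \<Rightarrow> ('g \<Rightarrow> 'g \<Rightarrow> 'g \<Rightarrow> complex) \<Rightarrow> 'g center_obj set set" where
  "simple_classes G \<omega> = Collect (simple_object G \<omega>) // simple_iso_rel G \<omega>"


section \<open>Tensor products, associativity and braiding\<close>

text \<open>If \<open>U\<close> has basis \<open>u\<^sub>0, \<dots>\<close> and \<open>V\<close> has basis \<open>v\<^sub>0, \<dots>\<close> with \<open>m\<close> elements, then \<open>u\<^sub>i \<otimes> v\<^sub>j\<close> is
  the basis vector of \<open>U \<otimes> V\<close> with number \<open>i m + j\<close>. With this numbering the underlying based
  spaces of \<open>U \<otimes> (V \<otimes> W)\<close> and \<open>(U \<otimes> V) \<otimes> W\<close> coincide, and the associativity isomorphism is a
  diagonal matrix.\<close>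

definition kron :: "complex mat \<Rightarrow> complex mat \<Rightarrow> complex mat" where
  "kron A B = mat (dim_row A * dim_row B) (dim_col A * dim_col B)
     (\<lambda>(r, c). A $$ (r div dim_row B, c div dim_col B) * B $$ (r mod dim_row B, c mod dim_col B))"

definition minv :: "complex mat \<Rightarrow> complex mat" where
  "minv A = the (mat_inverse A)"

definition mtrace :: "complex mat \<Rightarrow> complex" where
  "mtrace A = (\<Sum>i<dim_row A. A $$ (i, i))"

text \<open>\<open>U \<otimes> (V \<otimes> W) \<rightarrow> (U \<otimes> V) \<otimes> W\<close>\<close>

definition associator ::
    "('g \<Rightarrow> 'g \<Rightarrow> 'g \<Rightarrow> complex) \<Rightarrow> 'g center_obj \<Rightarrow> 'g center_obj \<Rightarrow> 'g center_obj \<Rightarrow> complex mat" where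
  "associator \<omega> U V W =
     mat (cdim U * cdim V * cdim W) (cdim U * cdim V * cdim W)
       (\<lambda>(r, c). if r = c
          then \<omega> (degs U ! (c div cdim W div cdim V)) (degs V ! (c div cdim W mod cdim V))
                 (degs W ! (c mod cdim W))
          else 0)"

text \<open>\<open>V \<otimes> W \<rightarrow> W \<otimes> V\<close>, \<open>v \<otimes> w \<mapsto> |v| \<triangleright> w \<otimes> v\<close>: the coefficient of \<open>w\<^sub>k \<otimes> v\<^sub>l\<close> in the image of
  \<open>v\<^sub>i \<otimes> w\<^sub>j\<close> vanishes unless \<open>l = i\<close>.\<close>

definition braiding :: "'g center_obj \<Rightarrow> 'g center_obj \<Rightarrow> complex mat" where
  "braiding V W =
     mat (cdim W * cdim V) (cdim V * cdim W)
       (\<lambda>(r, c). if r mod cdim V = c div cdim W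
          then action W (degs V ! (c div cdim W)) $$ (r div cdim V, c mod cdim W)
          else 0)"


section \<open>Twist and \<open>T\<close>-matrix\<close>

text \<open>The twist is \<open>v \<mapsto> |v| \<triangleright> v\<close>. This is the partial trace of the braiding of \<open>V\<close> with itself
  over the second tensor factor, see \<open>twist_partial_trace\<close> below.\<close>

definition twist :: "'g center_obj \<Rightarrow> complex mat" where
  "twist V = mat (cdim V) (cdim V) (\<lambda>(i, j). action V (degs V ! j) $$ (i, j))"

definition T_scalar :: "'g center_obj \<Rightarrow> complex" where
  "T_scalar V = (THE t. twist V = t \<cdot>\<^sub>m 1\<^sub>m (cdim V))"

text \<open>The character \<open>\<chi>\<close> of the action of \<open>x \<in> C\<^sub>G(g)\<close> on the component \<open>V\<^sub>g\<close>.\<close>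

definition component_char :: "'g center_obj \<Rightarrow> 'g \<Rightarrow> 'g \<Rightarrow> complex" where
  "component_char V g x = (\<Sum>i | i < cdim V \<and> degs V ! i = g. action V x $$ (i, i))"


section \<open>The \<open>B\<close>-tensor\<close>

text \<open>The generators act on the parenthesization \<open>(U \<otimes> V) \<otimes> W\<close> by
  \<open>(U \<otimes> V) \<otimes> W \<rightarrow> (V \<otimes> U) \<otimes> W\<close> and \<open>(U \<otimes> V) \<otimes> W \<rightarrow> (U \<otimes> W) \<otimes> V\<close>.\<close>

definition braid_sigma1 ::
    "'g center_obj \<Rightarrow> 'g center_obj \<Rightarrow> 'g center_obj \<Rightarrow> complex mat" where
  "braid_sigma1 U V W = kron (braiding U V) (1\<^sub>m (cdim W))"

definition braid_sigma2 ::
    "('g \<Rightarrow> 'g \<Rightarrow> 'g \<Rightarrow> complex) \<Rightarrow> 'g center_obj \<Rightarrow> 'g center_obj \<Rightarrow> 'g center_obj \<Rightarrow> complex mat" where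
  "braid_sigma2 \<omega> U V W =
     associator \<omega> U W V * kron (1\<^sub>m (cdim U)) (braiding V W) * minv (associator \<omega> U V W)"

text \<open>\<open>\<sigma>\<^sub>2\<inverse> \<sigma>\<^sub>1\<close> as a map \<open>(U \<otimes> V) \<otimes> W \<rightarrow> (V \<otimes> U) \<otimes> W \<rightarrow> (V \<otimes> W) \<otimes> U\<close>; here \<open>\<sigma>\<^sub>2\<close> is the one that
  starts at \<open>(V \<otimes> W) \<otimes> U\<close>.\<close>

definition braid_step ::
    "('g \<Rightarrow> 'g \<Rightarrow> 'g \<Rightarrow> complex) \<Rightarrow> 'g center_obj \<Rightarrow> 'g center_obj \<Rightarrow> 'g center_obj \<Rightarrow> complex mat" where
  "braid_step \<omega> U V W = minv (braid_sigma2 \<omega> V W U) * braid_sigma1 U V W"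

definition B_tensor ::
    "('g \<Rightarrow> 'g \<Rightarrow> 'g \<Rightarrow> complex) \<Rightarrow> 'g center_obj \<Rightarrow> 'g center_obj \<Rightarrow> 'g center_obj \<Rightarrow> complex" where
  "B_tensor \<omega> U V W = mtrace (braid_step \<omega> W U V * braid_step \<omega> V W U * braid_step \<omega> U V W)"


section \<open>Invariants of isomorphism classes\<close>

text \<open>Both invariants are constant on isomorphism classes of simple objects; the value on a class
  is that common value (lemmas \<open>T_class_eq\<close> and \<open>B_class_eq\<close>).\<close>

definition T_class :: "'g center_obj set \<Rightarrow> complex" where
  "T_class X = the_elem (T_scalar ` X)"

definition B_class ::
    "('g \<Rightarrow> 'g \<Rightarrow> 'g \<Rightarrow> complex) \<Rightarrow> 'g center_obj set \<Rightarrow> 'g center_obj set \<Rightarrow> 'g center_obj set \<Rightarrow> complex" where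
  "B_class \<omega> X Y Z = the_elem ((\<lambda>(U, V, W). B_tensor \<omega> U V W) ` (X \<times> Y \<times> Z))"


section \<open>Matrix facts\<close>

lemma mult_entry:
  assumes "A \<in> carrier_mat n m" "B \<in> carrier_mat m k" "i < n" "j < k"
  shows "(A * B) $$ (i, j) = (\<Sum>l<m. A $$ (i, l) * (B $$ (l, j) :: complex))"
  using assms by (auto simp: scalar_prod_def lessThan_atLeast0 intro!: sum.cong)

lemma div_mod_less:
  assumes "(x::nat) < a * b" shows "x div b < a" "x mod b < b"
proof -
  from assms have "b > 0" by (cases b) auto
  then show "x div b < a" "x mod b < b" using assms by (auto simp: less_mult_imp_div_less)
qed

lemma pair_index_less: "(i::nat) < a \<Longrightarrow> j < b \<Longrightarrow> i * b + j < a * b"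
proof -
  assume "i < a" "j < b"
  then have "i * b + j < (i + 1) * b" by simp
  also have "\<dots> \<le> a * b" using \<open>i < a\<close> by (intro mult_right_mono) auto
  finally show ?thesis .
qed

lemma pair_index_div: "(j::nat) < b \<Longrightarrow> (i * b + j) div b = i"
  by simp

lemma sum_pair_index:
  fixes f :: "nat \<Rightarrow> nat \<Rightarrow> complex"
  shows "(\<Sum>x<a * b. f (x div b) (x mod b)) = (\<Sum>i<a. \<Sum>j<b. f i j)"
proof -
  have "(\<Sum>x<a * b. f (x div b) (x mod b)) = (\<Sum>(i, j)\<in>{..<a} \<times> {..<b}. f i j)"
    by (rule sum.reindex_bij_witness[of _ "\<lambda>(i, j). i * b + j" "\<lambda>x. (x div b, x mod b)"])
       (auto simp: div_mod_less pair_index_less)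
  then show ?thesis by (simp add: sum.cartesian_product)
qed

lemma kron_carrier: "A \<in> carrier_mat a b \<Longrightarrow> B \<in> carrier_mat c d \<Longrightarrow> kron A B \<in> carrier_mat (a * c) (b * d)"
  by (auto simp: kron_def)

lemma kron_entry:
  assumes "A \<in> carrier_mat a b" "B \<in> carrier_mat c d" "x < a * c" "y < b * d"
  shows "kron A B $$ (x, y) = A $$ (x div c, y div d) * B $$ (x mod c, y mod d)"
  using assms by (auto simp: kron_def)

lemma kron_mult:
  assumes A: "A \<in> carrier_mat a b" and C: "C \<in> carrier_mat b c"
    and B: "B \<in> carrier_mat a' b'" and D: "D \<in> carrier_mat b' c'"
  shows "kron (A * C) (B * D) = kron A B * kron C D"
proof (rule eq_matI)
  note k = kron_carrier[OF A B] kron_carrier[OF C D]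
  fix x y assume "x < dim_row (kron A B * kron C D)" "y < dim_col (kron A B * kron C D)"
  then have x: "x < a * a'" and y: "y < c * c'" using k by auto
  have "(kron A B * kron C D) $$ (x, y)
    = (\<Sum>z<b * b'. A $$ (x div a', z div b') * B $$ (x mod a', z mod b')
                  * (C $$ (z div b', y div c') * D $$ (z mod b', y mod c')))"
    unfolding mult_entry[OF k x y]
    by (intro sum.cong) (auto simp: kron_entry[OF A B x] kron_entry[OF C D _ y])
  also have "\<dots> = (\<Sum>i<b. \<Sum>j<b'. A $$ (x div a', i) * B $$ (x mod a', j)
                  * (C $$ (i, y div c') * D $$ (j, y mod c')))"
    by (rule sum_pair_index)
  also have "\<dots> = (\<Sum>i<b. A $$ (x div a', i) * C $$ (i, y div c'))
                 * (\<Sum>j<b'. B $$ (x mod a', j) * D $$ (j, y mod c'))"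
    by (simp add: sum_product mult_ac)
  also have "\<dots> = (A * C) $$ (x div a', y div c') * (B * D) $$ (x mod a', y mod c')"
    using div_mod_less[OF x] div_mod_less[OF y] by (simp add: mult_entry[OF A C] mult_entry[OF B D])
  also have "\<dots> = kron (A * C) (B * D) $$ (x, y)"
    using kron_entry[of "A*C" a c "B*D" a' c'] A B C D x y by simp
  finally show "kron (A * C) (B * D) $$ (x, y) = (kron A B * kron C D) $$ (x, y)" by simp
qed (use assms in \<open>auto simp: kron_def\<close>)

lemma kron_one: "kron (1\<^sub>m a) (1\<^sub>m b) = 1\<^sub>m (a * b)"
proof (rule eq_matI)
  fix x y assume "x < dim_row (1\<^sub>m (a * b) :: complex mat)" "y < dim_col (1\<^sub>m (a * b) :: complex mat)"
  then have x: "x < a * b" and y: "y < a * b" by auto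
  have "x = y" if "x div b = y div b" "x mod b = y mod b"
    using that by (metis div_mult_mod_eq)
  then show "kron (1\<^sub>m a) (1\<^sub>m b) $$ (x, y) = (1\<^sub>m (a * b) :: complex mat) $$ (x, y)"
    using x y div_mod_less[OF x] div_mod_less[OF y]
    by (auto simp: kron_entry[OF one_carrier_mat one_carrier_mat])
qed (auto simp: kron_def)

lemma kron_assoc:
  assumes A: "A \<in> carrier_mat a b" and B: "B \<in> carrier_mat a' b'" and C: "C \<in> carrier_mat a'' b''"
  shows "kron A (kron B C) = kron (kron A B) C"
proof (rule eq_matI)
  fix x y assume "x < dim_row (kron (kron A B) C)" "y < dim_col (kron (kron A B) C)"
  then have x: "x < a * a' * a''" and y: "y < b * b' * b''"
    using kron_carrier[OF kron_carrier[OF A B] C] by auto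
  have x': "x < a * (a' * a'')" and y': "y < b * (b' * b'')" using x y by (simp_all add: mult.assoc)
  have e: "x div (a' * a'') = x div a'' div a'" "y div (b' * b'') = y div b'' div b'"
    "x mod (a' * a'') div a'' = x div a'' mod a'" "y mod (b' * b'') div b'' = y div b'' mod b'"
    "x mod (a' * a'') mod a'' = x mod a''" "y mod (b' * b'') mod b'' = y mod b''"
    using div_mod_less[OF x] div_mod_less[OF y]
    by (simp_all add: div_mult2_eq mod_mult2_eq mult.commute[of a' a''] mult.commute[of b' b''])
  show "kron A (kron B C) $$ (x, y) = kron (kron A B) C $$ (x, y)"
    using kron_entry[OF A kron_carrier[OF B C] x' y'] kron_entry[OF kron_carrier[OF A B] C x y]
      kron_entry[OF B C] kron_entry[OF A B] div_mod_less[OF x] div_mod_less[OF y]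
      div_mod_less[OF x'] div_mod_less[OF y'] by (simp add: e)
qed (auto simp: kron_def)

lemma minv_props:
  assumes A: "A \<in> carrier_mat n n" and B: "B \<in> carrier_mat n n" and AB: "A * B = 1\<^sub>m n"
  shows "minv A = B" "B * A = 1\<^sub>m n"
proof -
  show BA: "B * A = 1\<^sub>m n" by (rule mat_mult_left_right_inverse[OF A B AB])
  have "A \<in> Units (ring_mat TYPE(complex) n ())"
    using A B AB BA by (auto simp: Units_def ring_mat_def)
  then obtain B' where B': "mat_inverse A = Some B'"
    using mat_inverse(1)[OF A, where b = "()"] by (cases "mat_inverse A") auto
  from mat_inverse(2)[OF A B'] have "A * B' = 1\<^sub>m n" "B' * A = 1\<^sub>m n" "B' \<in> carrier_mat n n" by auto
  have "B' = B' * (A * B)" using AB \<open>B' \<in> _\<close> by simp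
  also have "\<dots> = B' * A * B" using A B \<open>B' \<in> _\<close> by simp
  finally have "B' = B" using \<open>B' * A = 1\<^sub>m n\<close> B by simp
  with B' show "minv A = B" by (simp add: minv_def)
qed

lemma mtrace_comm:
  assumes A: "A \<in> carrier_mat n m" and B: "B \<in> carrier_mat m n"
  shows "mtrace (A * B) = mtrace (B * A)"
proof -
  have "mtrace (A * B) = (\<Sum>i<n. \<Sum>j<m. A $$ (i, j) * B $$ (j, i))"
    unfolding mtrace_def using A by (simp add: mult_entry[OF A B])
  also have "\<dots> = (\<Sum>j<m. \<Sum>i<n. B $$ (j, i) * A $$ (i, j))"
    by (subst sum.swap) (simp add: mult.commute)
  also have "\<dots> = mtrace (B * A)"
    unfolding mtrace_def using B by (simp add: mult_entry[OF B A])
  finally show ?thesis .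
qed

lemma mat_vec_entry:
  assumes "A \<in> carrier_mat n m" "v \<in> carrier_vec m" "i < n"
  shows "(A *\<^sub>v v) $ i = (\<Sum>j<m. A $$ (i, j) * (v $ j :: complex))"
  using assms by (auto simp: scalar_prod_def lessThan_atLeast0 intro!: sum.cong)

lemma mat_unit_vec: "A \<in> carrier_mat n m \<Longrightarrow> j < m \<Longrightarrow> A *\<^sub>v unit_vec m j = (col A j :: complex vec)"
  by (rule eq_vecI) (auto simp: mat_vec_entry if_distrib[of "(*) _"] cong: if_cong)


section \<open>Isomorphism is an equivalence relation\<close>

lemma unit_vec_component: "j < cdim V \<Longrightarrow> unit_vec (cdim V) j \<in> component V (degs V ! j)"
  by (auto simp: component_def unit_vec_def)

lemma center_objectD:
  assumes "center_object G \<omega> V"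
  shows "i < cdim V \<Longrightarrow> degs V ! i \<in> carrier G"
    "g \<in> carrier G \<Longrightarrow> action V g \<in> carrier_mat (cdim V) (cdim V)"
    "g \<in> carrier G \<Longrightarrow> i < cdim V \<Longrightarrow> j < cdim V \<Longrightarrow> action V g $$ (i, j) \<noteq> 0 \<Longrightarrow>
       degs V ! i = conj_by G g (degs V ! j)"
    "w \<in> carrier_vec (cdim V) \<Longrightarrow> action V \<one>\<^bsub>G\<^esub> *\<^sub>v w = w"
    "g \<in> carrier G \<Longrightarrow> h \<in> carrier G \<Longrightarrow> k \<in> carrier G \<Longrightarrow> w \<in> component V k \<Longrightarrow>
       action V g *\<^sub>v (action V h *\<^sub>v w) = alpha G \<omega> k g h \<cdot>\<^sub>v (action V (g \<otimes>\<^bsub>G\<^esub> h) *\<^sub>v w)"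
proof -
  show d: "i < cdim V \<Longrightarrow> degs V ! i \<in> carrier G" for i
    using assms by (auto simp: center_object_def)
  show c: "g \<in> carrier G \<Longrightarrow> action V g \<in> carrier_mat (cdim V) (cdim V)" for g
    using assms by (auto simp: center_object_def)
  show "w \<in> carrier_vec (cdim V) \<Longrightarrow> action V \<one>\<^bsub>G\<^esub> *\<^sub>v w = w" 
   "g \<in> carrier G \<Longrightarrow> h \<in> carrier G \<Longrightarrow> k \<in> carrier G \<Longrightarrow> w \<in> component V k \<Longrightarrow>
       action V g *\<^sub>v (action V h *\<^sub>v w) = alpha G \<omega> k g h \<cdot>\<^sub>v (action V (g \<otimes>\<^bsub>G\<^esub> h) *\<^sub>v w)"
    using assms by (auto simp: center_object_def)
  assume g: "g \<in> carrier G" and i: "i < cdim V" and j: "j < cdim V" and nz: "action V g $$ (i, j) \<noteq> 0"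
  have "action V g *\<^sub>v unit_vec (cdim V) j \<in> component V (conj_by G g (degs V ! j))"
    using assms g d[OF j] unit_vec_component[OF j] by (auto simp: center_object_def)
  then show "degs V ! i = conj_by G g (degs V ! j)"
    using nz i j c[OF g] by (auto simp: component_def mat_unit_vec)
qed

lemma center_morphismD:
  assumes "center_morphism G V W P" "set (degs V) \<subseteq> carrier G"
  shows "P \<in> carrier_mat (cdim W) (cdim V)"
    "i < cdim W \<Longrightarrow> j < cdim V \<Longrightarrow> P $$ (i, j) \<noteq> 0 \<Longrightarrow> degs W ! i = degs V ! j"
    "g \<in> carrier G \<Longrightarrow> P * action V g = action W g * P"
proof -
  show c: "P \<in> carrier_mat (cdim W) (cdim V)" using assms by (auto simp: center_morphism_def)
  show "g \<in> carrier G \<Longrightarrow> P * action V g = action W g * P" using assms by (auto simp: center_morphism_def)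
  assume i: "i < cdim W" and j: "j < cdim V" and nz: "P $$ (i, j) \<noteq> 0"
  have "degs V ! j \<in> carrier G" using assms(2) j by auto
  then have "P *\<^sub>v unit_vec (cdim V) j \<in> component W (degs V ! j)"
    using assms unit_vec_component[OF j] by (auto simp: center_morphism_def)
  then show "degs W ! i = degs V ! j"
    using nz i j c by (auto simp: component_def mat_unit_vec)
qed

lemma center_iso_refl:
  assumes "center_object G \<omega> V" shows "center_iso G V V"
proof -
  have "center_morphism G V V (1\<^sub>m (cdim V))"
    unfolding center_morphism_def
    by (auto simp: component_def left_mult_one_mat[OF center_objectD(2)[OF assms]]
        right_mult_one_mat[OF center_objectD(2)[OF assms]])
  then show ?thesis unfolding center_iso_def by (intro exI[of _ "1\<^sub>m (cdim V)"]) auto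
qed

lemma center_iso_sym: "center_iso G V W \<Longrightarrow> center_iso G W V"
  unfolding center_iso_def by blast

lemma center_morphism_comp:
  assumes "center_object G \<omega> U" "center_object G \<omega> V" "center_object G \<omega> W"
    "center_morphism G U V P" "center_morphism G V W Q"
  shows "center_morphism G U W (Q * P)"
proof -
  have P: "P \<in> carrier_mat (cdim V) (cdim U)" and Q: "Q \<in> carrier_mat (cdim W) (cdim V)"
    using assms by (auto simp: center_morphism_def)
  have c: "Q * P *\<^sub>v v = Q *\<^sub>v (P *\<^sub>v v)" if "v \<in> component U h" for v h
    using that P Q by (auto simp: component_def)
  have "Q * P * action U g = action W g * (Q * P)" if g: "g \<in> carrier G" for g
  proof -
    note a = assms(1-3)[THEN center_objectD(2), OF g]
    have "Q * P * action U g = Q * (P * action U g)" using P Q a by auto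
    also have "\<dots> = Q * (action V g * P)" using assms(4) g by (auto simp: center_morphism_def)
    also have "\<dots> = Q * action V g * P" using P Q a by auto
    also have "\<dots> = action W g * Q * P" using assms(5) g by (auto simp: center_morphism_def)
    also have "\<dots> = action W g * (Q * P)" using P Q a by auto
    finally show ?thesis .
  qed
  then show ?thesis
    unfolding center_morphism_def using assms(4,5) P Q c by (auto simp: center_morphism_def)
qed

lemma mult_mat_4:
  assumes "A \<in> carrier_mat a b" "B \<in> carrier_mat b c" "C \<in> carrier_mat c d" "D \<in> carrier_mat d e"
  shows "(A * B) * (C * D) = A * ((B * C) * (D :: complex mat))"
  using assoc_mult_mat[of A a b B c "C * D" e] assoc_mult_mat[of B b c C d D e] assms by simp

lemma center_iso_trans:
  assumes "center_object G \<omega> U" "center_object G \<omega> V" "center_object G \<omega> W"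
    "center_iso G U V" "center_iso G V W"
  shows "center_iso G U W"
proof -
  obtain P Q where 1: "center_morphism G U V P" "center_morphism G V U Q"
      "Q * P = 1\<^sub>m (cdim U)" "P * Q = 1\<^sub>m (cdim V)" using assms(4) by (auto simp: center_iso_def)
  obtain P' Q' where 2: "center_morphism G V W P'" "center_morphism G W V Q'"
      "Q' * P' = 1\<^sub>m (cdim V)" "P' * Q' = 1\<^sub>m (cdim W)" using assms(5) by (auto simp: center_iso_def)
  have c: "P \<in> carrier_mat (cdim V) (cdim U)" "Q \<in> carrier_mat (cdim U) (cdim V)"
     "P' \<in> carrier_mat (cdim W) (cdim V)" "Q' \<in> carrier_mat (cdim V) (cdim W)"
    using 1 2 by (auto simp: center_morphism_def)
  have "(Q * Q') * (P' * P) = Q * ((Q' * P') * P)" by (rule mult_mat_4[OF c(2,4,3,1)])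
  also have "\<dots> = 1\<^sub>m (cdim U)" using 1 2 c by simp
  finally have a: "(Q * Q') * (P' * P) = 1\<^sub>m (cdim U)" .
  have "(P' * P) * (Q * Q') = P' * ((P * Q) * Q')" by (rule mult_mat_4[OF c(3,1,2,4)])
  also have "\<dots> = 1\<^sub>m (cdim W)" using 1 2 c by simp
  finally have b: "(P' * P) * (Q * Q') = 1\<^sub>m (cdim W)" .
  show ?thesis unfolding center_iso_def
    using center_morphism_comp[OF assms(1-3) 1(1) 2(1)] center_morphism_comp[OF assms(3,2,1) 2(2) 1(2)] a b
    by blast
qed

lemma equiv_simple_iso_rel: "equiv (Collect (simple_object G \<omega>)) (simple_iso_rel G \<omega>)"
proof (rule equivI)
  have s: "simple_object G \<omega> V \<Longrightarrow> center_object G \<omega> V" for V by (simp add: simple_object_def)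
  show "simple_iso_rel G \<omega> \<subseteq> Collect (simple_object G \<omega>) \<times> Collect (simple_object G \<omega>)"
    by (auto simp: simple_iso_rel_def)
  show "refl_on (Collect (simple_object G \<omega>)) (simple_iso_rel G \<omega>)"
    by (auto simp: refl_on_def simple_iso_rel_def intro: center_iso_refl s)
  show "sym (simple_iso_rel G \<omega>)"
    by (auto simp: sym_def simple_iso_rel_def intro: center_iso_sym)
  show "trans (simple_iso_rel G \<omega>)"
    unfolding trans_def simple_iso_rel_def using center_iso_trans s by blast
qed

lemma twist_partial_trace:
  assumes "k < cdim V" "i < cdim V"
  shows "(\<Sum>l<cdim V. braiding V V $$ (k * cdim V + l, i * cdim V + l)) = twist V $$ (k, i)"
proof -
  have "(\<Sum>l<cdim V. braiding V V $$ (k * cdim V + l, i * cdim V + l))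
    = (\<Sum>l<cdim V. if l = i then action V (degs V ! i) $$ (k, i) else 0)"
  proof (intro sum.cong refl)
    fix l assume "l \<in> {..<cdim V}"
    then have l: "l < cdim V" by simp
    have "(k * cdim V + l) div cdim V = k" "(i * cdim V + l) div cdim V = i"
      by (rule pair_index_div[OF l])+
    then show "braiding V V $$ (k * cdim V + l, i * cdim V + l)
      = (if l = i then action V (degs V ! i) $$ (k, i) else 0)"
      using l assms by (cases "l = i") (simp_all add: braiding_def pair_index_less)
  qed
  then show ?thesis using assms by (simp add: twist_def)
qed


section \<open>Invertibility and naturality of the braiding\<close>

lemma conj_by_closed: "group G \<Longrightarrow> g \<in> carrier G \<Longrightarrow> h \<in> carrier G \<Longrightarrow> conj_by G g h \<in> carrier G"
  by (simp add: conj_by_def group.is_monoid monoid.m_closed)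

lemma conj_by_mult:
  assumes "group G" "g \<in> carrier G" "h \<in> carrier G" "k \<in> carrier G"
  shows "conj_by G (g \<otimes>\<^bsub>G\<^esub> h) k = conj_by G g (conj_by G h k)"
proof -
  interpret group G by fact
  show ?thesis using assms by (simp add: conj_by_def inv_mult_group m_assoc)
qed

lemma alpha_nonzero:
  assumes "group G" "normalized_3cocycle G \<omega>" "g \<in> carrier G" "x \<in> carrier G" "y \<in> carrier G"
  shows "alpha G \<omega> g x y \<noteq> 0"
proof -
  interpret group G by fact
  show ?thesis using assms by (simp add: alpha_def normalized_3cocycle_def conj_by_closed)
qed

lemma action_invertible:
  assumes G: "group G" and \<omega>: "normalized_3cocycle G \<omega>" and V: "center_object G \<omega> V" and g: "g \<in> carrier G"
  obtains N where "N \<in> carrier_mat (cdim V) (cdim V)" "action V g * N = 1\<^sub>m (cdim V)"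
    "N * action V g = 1\<^sub>m (cdim V)"
proof -
  interpret group G by fact
  let ?n = "cdim V"
  let ?a = "\<lambda>j. alpha G \<omega> (degs V ! j) (inv\<^bsub>G\<^esub> g) g"
  define N where "N = mat ?n ?n (\<lambda>(i, j). inverse (?a i) * action V (inv\<^bsub>G\<^esub> g) $$ (i, j))"
  have N: "N \<in> carrier_mat ?n ?n" by (simp add: N_def)
  note A = center_objectD(2)[OF V g] and A' = center_objectD(2)[OF V inv_closed[OF g]]
  have one: "action V \<one>\<^bsub>G\<^esub> *\<^sub>v unit_vec ?n j = unit_vec ?n j" for j
    by (rule center_objectD(4)[OF V]) simp
  have prod: "(action V (inv\<^bsub>G\<^esub> g) * action V g) $$ (i, j) = (if i = j then ?a j else 0)"
    if i: "i < ?n" and j: "j < ?n" for i j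
  proof -
    have "(action V (inv\<^bsub>G\<^esub> g) * action V g) $$ (i, j)
      = ((action V (inv\<^bsub>G\<^esub> g) * action V g) *\<^sub>v unit_vec ?n j) $ i"
      using A A' i j by (simp add: mat_unit_vec[of _ ?n ?n])
    also have "\<dots> = (action V (inv\<^bsub>G\<^esub> g) *\<^sub>v (action V g *\<^sub>v unit_vec ?n j)) $ i"
      using A A' by simp
    also have "\<dots> = (?a j \<cdot>\<^sub>v unit_vec ?n j) $ i"
      using center_objectD(5)[OF V inv_closed[OF g] g center_objectD(1)[OF V j] unit_vec_component[OF j]]
        g one by simp
    finally show ?thesis using i j by auto
  qed
  have "N * action V g = 1\<^sub>m ?n"
  proof (rule eq_matI)
    fix i j assume "i < dim_row (1\<^sub>m ?n :: complex mat)" "j < dim_col (1\<^sub>m ?n :: complex mat)"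
    then have ij: "i < ?n" "j < ?n" by auto
    have "(N * action V g) $$ (i, j)
      = inverse (?a i) * (action V (inv\<^bsub>G\<^esub> g) * action V g) $$ (i, j)"
      unfolding mult_entry[OF N A ij] mult_entry[OF A' A ij] using ij
      by (simp add: N_def sum_distrib_left mult.assoc)
    also have "\<dots> = (1\<^sub>m ?n :: complex mat) $$ (i, j)"
      using alpha_nonzero[OF G \<omega> center_objectD(1)[OF V ij(1)] inv_closed[OF g] g] ij
      by (auto simp: prod[OF ij])
    finally show "(N * action V g) $$ (i, j) = (1\<^sub>m ?n :: complex mat) $$ (i, j)" .
  qed (use N A in auto)
  with mat_mult_left_right_inverse[OF N A] N show ?thesis by (intro that[of N]) auto
qed

lemma braiding_carrier: "braiding V W \<in> carrier_mat (cdim W * cdim V) (cdim V * cdim W)"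
  by (simp add: braiding_def)

lemma braiding_entry:
  "x < cdim W * cdim V \<Longrightarrow> y < cdim V * cdim W \<Longrightarrow>
   braiding V W $$ (x, y) = (if x mod cdim V = y div cdim W
      then action W (degs V ! (y div cdim W)) $$ (x div cdim V, y mod cdim W) else 0)"
  by (simp add: braiding_def)

lemma braiding_invertible:
  assumes G: "group G" and \<omega>: "normalized_3cocycle G \<omega>" and V: "center_object G \<omega> V" and W: "center_object G \<omega> W"
  obtains N where "N \<in> carrier_mat (cdim V * cdim W) (cdim W * cdim V)"
    "braiding V W * N = 1\<^sub>m (cdim W * cdim V)" "N * braiding V W = 1\<^sub>m (cdim V * cdim W)"
proof -
  let ?v = "cdim V" and ?w = "cdim W"
  have "\<exists>M. M \<in> carrier_mat ?w ?w \<and> M * action W (degs V ! i) = 1\<^sub>m ?w" if "i < ?v" for i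
    by (rule action_invertible[OF G \<omega> W center_objectD(1)[OF V that]]) blast
  then obtain M where M: "\<And>i. i < ?v \<Longrightarrow> M i \<in> carrier_mat ?w ?w"
      "\<And>i. i < ?v \<Longrightarrow> M i * action W (degs V ! i) = 1\<^sub>m ?w" by metis
  define N where "N = mat (?v * ?w) (?w * ?v)
    (\<lambda>(x, y). if y mod ?v = x div ?w then M (x div ?w) $$ (x mod ?w, y div ?v) else 0)"
  have N: "N \<in> carrier_mat (?v * ?w) (?w * ?v)" by (simp add: N_def)
  note b = braiding_carrier[of V W]
  have NB: "N * braiding V W = 1\<^sub>m (?v * ?w)"
  proof (rule eq_matI)
    fix x y assume "x < dim_row (1\<^sub>m (?v * ?w) :: complex mat)" "y < dim_col (1\<^sub>m (?v * ?w) :: complex mat)"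
    then have x: "x < ?v * ?w" and y: "y < ?v * ?w" by auto
    note x' = div_mod_less[OF x] and y' = div_mod_less[OF y]
    have "(N * braiding V W) $$ (x, y) = (\<Sum>z<?w * ?v.
        (if z mod ?v = x div ?w then M (x div ?w) $$ (x mod ?w, z div ?v) else 0) *
        (if z mod ?v = y div ?w then action W (degs V ! (y div ?w)) $$ (z div ?v, y mod ?w) else 0))"
      unfolding mult_entry[OF N b x y]
      by (intro sum.cong) (auto simp: N_def x y braiding_entry)
    also have "\<dots> = (\<Sum>k<?w. \<Sum>l<?v.
        (if l = x div ?w then M (x div ?w) $$ (x mod ?w, k) else 0) *
        (if l = y div ?w then action W (degs V ! (y div ?w)) $$ (k, y mod ?w) else 0))"
      by (rule sum_pair_index)
    also have "\<dots> = (\<Sum>k<?w. if x div ?w = y div ?w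
        then M (x div ?w) $$ (x mod ?w, k) * action W (degs V ! (x div ?w)) $$ (k, y mod ?w) else 0)"
    proof (intro sum.cong refl)
      fix k assume "k \<in> {..<?w}"
      have "(\<Sum>l<?v. (if l = x div ?w then M (x div ?w) $$ (x mod ?w, k) else 0) *
        (if l = y div ?w then action W (degs V ! (y div ?w)) $$ (k, y mod ?w) else 0)) =
        (\<Sum>l<?v. if l = x div ?w then (if x div ?w = y div ?w
        then M (x div ?w) $$ (x mod ?w, k) * action W (degs V ! (x div ?w)) $$ (k, y mod ?w) else 0) else 0)"
        by (intro sum.cong) auto
      also have "\<dots> = (if x div ?w = y div ?w
        then M (x div ?w) $$ (x mod ?w, k) * action W (degs V ! (x div ?w)) $$ (k, y mod ?w) else 0)"
        by (subst sum.delta) (use x' in auto)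
      finally show "(\<Sum>l<?v. (if l = x div ?w then M (x div ?w) $$ (x mod ?w, k) else 0) *
        (if l = y div ?w then action W (degs V ! (y div ?w)) $$ (k, y mod ?w) else 0)) = \<dots>" .
    qed
    also have "\<dots> = (if x div ?w = y div ?w
        then (M (x div ?w) * action W (degs V ! (x div ?w))) $$ (x mod ?w, y mod ?w) else 0)"
      unfolding mult_entry[OF M(1)[OF x'(1)] center_objectD(2)[OF W center_objectD(1)[OF V x'(1)]] x'(2) y'(2)]
      by simp
    also have "\<dots> = (if x = y then 1 else 0)"
    proof -
      have "x = y" if "x div ?w = y div ?w" "x mod ?w = y mod ?w"
        using that by (metis div_mult_mod_eq)
      then show ?thesis using x' y' by (auto simp: M(2))
    qed
    finally show "(N * braiding V W) $$ (x, y) = (1\<^sub>m (?v * ?w) :: complex mat) $$ (x, y)"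
      using x y by simp
  qed (use N b in auto)
  have b': "braiding V W \<in> carrier_mat (?v * ?w) (?v * ?w)" and N': "N \<in> carrier_mat (?v * ?w) (?v * ?w)"
    using b N by (simp_all add: mult.commute)
  have "braiding V W * N = 1\<^sub>m (?w * ?v)"
    using mat_mult_left_right_inverse[OF N' b' NB] by (simp add: mult.commute)
  with NB N that show ?thesis by blast
qed

lemma braiding_natural:
  assumes V: "center_object G \<omega> V" and W: "center_object G \<omega> W"
    and V': "center_object G \<omega> V'" and W': "center_object G \<omega> W'"
    and P: "center_morphism G V V' P" and Q: "center_morphism G W W' Q"
  shows "braiding V' W' * kron P Q = kron Q P * braiding V W"
proof -
  let ?v = "cdim V" and ?w = "cdim W" and ?v' = "cdim V'" and ?w' = "cdim W'"
  have sub: "set (degs V) \<subseteq> carrier G" "set (degs W) \<subseteq> carrier G" using V W by (auto simp: center_object_def)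
  note Pc = center_morphismD[OF P sub(1)] and Qc = center_morphismD[OF Q sub(2)]
  note kc = kron_carrier[OF Pc(1) Qc(1)] and kc' = kron_carrier[OF Qc(1) Pc(1)]
  note b = braiding_carrier[of V W] and b' = braiding_carrier[of V' W']
  show ?thesis
  proof (rule eq_matI)
    fix x y assume "x < dim_row (kron Q P * braiding V W)" "y < dim_col (kron Q P * braiding V W)"
    then have x: "x < ?w' * ?v'" and y: "y < ?v * ?w" using kc' b by auto
    let ?k = "x div ?v'" and ?l = "x mod ?v'" and ?i = "y div ?w" and ?j = "y mod ?w"
    have k: "?k < ?w'" and l: "?l < ?v'" and i: "?i < ?v" and j: "?j < ?w"
      using div_mod_less[OF x] div_mod_less[OF y] by auto
    have gl: "degs V' ! ?l \<in> carrier G" and gi: "degs V ! ?i \<in> carrier G"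
      using center_objectD(1)[OF V' l] center_objectD(1)[OF V i] by auto
    have "(braiding V' W' * kron P Q) $$ (x, y) = (\<Sum>z<?v' * ?w'.
        (if ?l = z div ?w' then action W' (degs V' ! (z div ?w')) $$ (?k, z mod ?w') else 0) *
        (P $$ (z div ?w', ?i) * Q $$ (z mod ?w', ?j)))"
      unfolding mult_entry[OF b' kc x y]
      by (intro sum.cong) (auto simp: braiding_entry x kron_entry[OF Pc(1) Qc(1) _ y])
    also have "\<dots> = (\<Sum>i'<?v'. \<Sum>j'<?w'.
        (if ?l = i' then action W' (degs V' ! i') $$ (?k, j') else 0) * (P $$ (i', ?i) * Q $$ (j', ?j)))"
      by (rule sum_pair_index)
    also have "\<dots> = (\<Sum>i'<?v'. if i' = ?l then
        P $$ (?l, ?i) * (\<Sum>j'<?w'. action W' (degs V' ! ?l) $$ (?k, j') * Q $$ (j', ?j)) else 0)"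
      by (intro sum.cong) (auto simp: sum_distrib_left mult_ac)
    also have "\<dots> = P $$ (?l, ?i) * (\<Sum>j'<?w'. action W' (degs V' ! ?l) $$ (?k, j') * Q $$ (j', ?j))"
      by (subst sum.delta) (use l in auto)
    also have "\<dots> = P $$ (?l, ?i) * (action W' (degs V' ! ?l) * Q) $$ (?k, ?j)"
      by (simp add: mult_entry[OF center_objectD(2)[OF W' gl] Qc(1) k j])
    finally have L: "(braiding V' W' * kron P Q) $$ (x, y)
      = P $$ (?l, ?i) * (action W' (degs V' ! ?l) * Q) $$ (?k, ?j)" .
    have "(kron Q P * braiding V W) $$ (x, y) = (\<Sum>z<?w * ?v.
        (Q $$ (?k, z div ?v) * P $$ (?l, z mod ?v)) *
        (if z mod ?v = ?i then action W (degs V ! ?i) $$ (z div ?v, ?j) else 0))"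
      unfolding mult_entry[OF kc' b x y]
      by (intro sum.cong) (auto simp: braiding_entry y kron_entry[OF Qc(1) Pc(1) x])
    also have "\<dots> = (\<Sum>k'<?w. \<Sum>l'<?v.
        (Q $$ (?k, k') * P $$ (?l, l')) * (if l' = ?i then action W (degs V ! ?i) $$ (k', ?j) else 0))"
      by (rule sum_pair_index)
    also have "\<dots> = (\<Sum>k'<?w. P $$ (?l, ?i) * (Q $$ (?k, k') * action W (degs V ! ?i) $$ (k', ?j)))"
      using i by (intro sum.cong refl) (simp add: if_distrib[of "(*) _"] cong: if_cong)
    also have "\<dots> = P $$ (?l, ?i) * (Q * action W (degs V ! ?i)) $$ (?k, ?j)"
      by (simp add: mult_entry[OF Qc(1) center_objectD(2)[OF W gi] k j] sum_distrib_left)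
    finally have R: "(kron Q P * braiding V W) $$ (x, y)
      = P $$ (?l, ?i) * (Q * action W (degs V ! ?i)) $$ (?k, ?j)" .
    show "(braiding V' W' * kron P Q) $$ (x, y) = (kron Q P * braiding V W) $$ (x, y)"
    proof (cases "P $$ (?l, ?i) = 0")
      case False
      from Pc(2)[OF l i this] Qc(3)[OF gi] show ?thesis unfolding L R by simp
    qed (simp add: L R)
  qed (use kc kc' b b' in auto)
qed


section \<open>Invariance of the \<open>B\<close>-tensor under isomorphism\<close>

definition is_inv_mat :: "nat \<Rightarrow> nat \<Rightarrow> complex mat \<Rightarrow> bool" where
  "is_inv_mat n m A \<longleftrightarrow> A \<in> carrier_mat n m \<and> n = m \<and>
     (\<exists>N\<in>carrier_mat m n. A * N = 1\<^sub>m n \<and> N * A = 1\<^sub>m m)"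

lemma is_inv_mat_minv:
  assumes "is_inv_mat n m A"
  shows "A \<in> carrier_mat n m" "minv A \<in> carrier_mat m n" "A * minv A = 1\<^sub>m n" "minv A * A = 1\<^sub>m m"
    "is_inv_mat m n (minv A)"
proof -
  obtain N where A: "A \<in> carrier_mat n m" "n = m" and N: "N \<in> carrier_mat m n" "A * N = 1\<^sub>m n" "N * A = 1\<^sub>m m"
    using assms by (auto simp: is_inv_mat_def)
  have "minv A = N" using minv_props(1)[of A n N] A N by auto
  then show "A \<in> carrier_mat n m" "minv A \<in> carrier_mat m n" "A * minv A = 1\<^sub>m n" "minv A * A = 1\<^sub>m m"
    "is_inv_mat m n (minv A)"
    using A N by (auto simp: is_inv_mat_def)
qed

lemma is_inv_mat_mult:
  assumes A: "is_inv_mat n m A" and B: "is_inv_mat m k B"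
  shows "is_inv_mat n k (A * B)"
proof -
  note a = is_inv_mat_minv[OF A] and b = is_inv_mat_minv[OF B]
  have "(A * B) * (minv B * minv A) = 1\<^sub>m n" "(minv B * minv A) * (A * B) = 1\<^sub>m k"
    using mult_mat_4[OF a(1) b(1,2) a(2)] mult_mat_4[OF b(2) a(2,1) b(1)] a b by simp_all
  moreover have "minv B * minv A \<in> carrier_mat k n" "A * B \<in> carrier_mat n k" using a b by auto
  moreover have "n = k" using A B by (simp add: is_inv_mat_def)
  ultimately show ?thesis unfolding is_inv_mat_def by blast
qed

lemma is_inv_mat_kron:
  assumes A: "is_inv_mat n m A" and B: "is_inv_mat n' m' B"
  shows "is_inv_mat (n * n') (m * m') (kron A B)"
proof -
  note a = is_inv_mat_minv[OF A] and b = is_inv_mat_minv[OF B]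
  have "kron A B * kron (minv A) (minv B) = 1\<^sub>m (n * n')" "kron (minv A) (minv B) * kron A B = 1\<^sub>m (m * m')"
    using kron_mult[OF a(1,2) b(1,2)] kron_mult[OF a(2,1) b(2,1)] a b by (simp_all add: kron_one)
  moreover have "n = m" "n' = m'" using A B by (simp_all add: is_inv_mat_def)
  ultimately show ?thesis unfolding is_inv_mat_def
    using kron_carrier[OF a(1) b(1)] kron_carrier[OF a(2) b(2)] by blast
qed

lemma is_inv_mat_one: "is_inv_mat n n (1\<^sub>m n)"
  by (auto simp: is_inv_mat_def intro!: bexI[of _ "1\<^sub>m n"])

lemma minv_natural:
  assumes A: "is_inv_mat n m A" and A': "is_inv_mat n' m' A'"
    and X: "X \<in> carrier_mat m' m" and Y: "Y \<in> carrier_mat n' n" and eq: "A' * X = Y * A"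
  shows "minv A' * Y = X * minv A"
proof -
  note a = is_inv_mat_minv[OF A] and a' = is_inv_mat_minv[OF A']
  have "minv A' * Y = minv A' * (Y * (A * minv A))" using a Y by simp
  also have "\<dots> = minv A' * ((Y * A) * minv A)" using assoc_mult_mat[OF Y a(1,2)] by simp
  also have "\<dots> = minv A' * (A' * (X * minv A))"
    using assoc_mult_mat[OF a'(1) X a(2)] by (simp add: eq[symmetric])
  also have "\<dots> = (minv A' * A') * (X * minv A)"
    using assoc_mult_mat[OF a'(2,1), of "X * minv A" n] X a by simp
  also have "\<dots> = X * minv A" using a' X a by simp
  finally show ?thesis .
qed

lemma natural_comp:
  assumes "A' * X = Y * (A :: complex mat)" "B' * Y = Z * B"
    "A \<in> carrier_mat n m" "A' \<in> carrier_mat n' m'" "X \<in> carrier_mat m' m" "Y \<in> carrier_mat n' n"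
    "B \<in> carrier_mat k n" "B' \<in> carrier_mat k' n'" "Z \<in> carrier_mat k' k"
  shows "(B' * A') * X = Z * (B * A)"
proof -
  have "(B' * A') * X = B' * (Y * A)" using assoc_mult_mat[OF assms(8,4,5)] assms(1) by simp
  also have "\<dots> = (Z * B) * A" using assoc_mult_mat[OF assms(8,6,3)] assms(2) by simp
  also have "\<dots> = Z * (B * A)" using assoc_mult_mat[OF assms(9,7,3)] by simp
  finally show ?thesis .
qed

lemma associator_carrier:
  "associator \<omega> U V W \<in> carrier_mat (cdim U * cdim V * cdim W) (cdim U * cdim V * cdim W)"
  by (simp add: associator_def)

lemma associator_mult:
  assumes "K \<in> carrier_mat (cdim U * cdim V * cdim W) m" "x < cdim U * cdim V * cdim W" "y < m"
  shows "(associator \<omega> U V W * K) $$ (x, y) = associator \<omega> U V W $$ (x, x) * K $$ (x, y)"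
proof -
  have "(associator \<omega> U V W * K) $$ (x, y)
    = (\<Sum>z<cdim U * cdim V * cdim W. if z = x then associator \<omega> U V W $$ (x, x) * K $$ (x, y) else 0)"
    unfolding mult_entry[OF associator_carrier assms]
    using assms by (intro sum.cong) (auto simp: associator_def)
  then show ?thesis using assms by (subst (asm) sum.delta) auto
qed

lemma mult_associator:
  assumes "K \<in> carrier_mat m (cdim U * cdim V * cdim W)" "x < m" "y < cdim U * cdim V * cdim W"
  shows "(K * associator \<omega> U V W) $$ (x, y) = K $$ (x, y) * associator \<omega> U V W $$ (y, y)"
proof -
  have "(K * associator \<omega> U V W) $$ (x, y)
    = (\<Sum>z<cdim U * cdim V * cdim W. if z = y then K $$ (x, y) * associator \<omega> U V W $$ (y, y) else 0)"
    unfolding mult_entry[OF assms(1) associator_carrier assms(2,3)]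
    using assms by (intro sum.cong) (auto simp: associator_def)
  then show ?thesis using assms by (subst (asm) sum.delta) auto
qed

lemma associator_invertible:
  assumes \<omega>: "normalized_3cocycle G \<omega>" and U: "center_object G \<omega> U" and V: "center_object G \<omega> V"
    and W: "center_object G \<omega> W"
  shows "is_inv_mat (cdim U * cdim V * cdim W) (cdim U * cdim V * cdim W) (associator \<omega> U V W)"
proof -
  let ?n = "cdim U * cdim V * cdim W"
  define N where "N = associator (\<lambda>x y z. inverse (\<omega> x y z)) U V W"
  have N: "N \<in> carrier_mat ?n ?n" unfolding N_def by (rule associator_carrier)
  have "associator \<omega> U V W * N = 1\<^sub>m ?n"
  proof (rule eq_matI)
    fix x y assume "x < dim_row (1\<^sub>m ?n :: complex mat)" "y < dim_col (1\<^sub>m ?n :: complex mat)"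
    then have x: "x < ?n" and y: "y < ?n" by auto
    have "degs U ! (x div cdim W div cdim V) \<in> carrier G" "degs V ! (x div cdim W mod cdim V) \<in> carrier G"
      "degs W ! (x mod cdim W) \<in> carrier G"
      using div_mod_less[OF x] div_mod_less[of "x div cdim W"] by (auto intro: center_objectD(1) U V W)
    then have "\<omega> (degs U ! (x div cdim W div cdim V)) (degs V ! (x div cdim W mod cdim V)) (degs W ! (x mod cdim W)) \<noteq> 0"
      using \<omega> by (auto simp: normalized_3cocycle_def)
    then show "(associator \<omega> U V W * N) $$ (x, y) = (1\<^sub>m ?n :: complex mat) $$ (x, y)"
      unfolding associator_mult[OF N x y] using x y by (cases "x = y") (simp_all add: N_def associator_def)
  qed (use N in \<open>auto simp: associator_def\<close>)
  with mat_mult_left_right_inverse[OF associator_carrier N] N show ?thesis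
    unfolding is_inv_mat_def using associator_carrier by blast
qed

lemma is_inv_braiding:
  assumes "group G" "normalized_3cocycle G \<omega>" "center_object G \<omega> U" "center_object G \<omega> V"
  shows "is_inv_mat (cdim V * cdim U) (cdim U * cdim V) (braiding U V)"
  using braiding_invertible[OF assms] unfolding is_inv_mat_def
  by (metis braiding_carrier mult.commute)

lemma is_inv_sigma1:
  assumes "group G" "normalized_3cocycle G \<omega>" "center_object G \<omega> U" "center_object G \<omega> V"
  shows "is_inv_mat (cdim V * cdim U * cdim W) (cdim U * cdim V * cdim W) (braid_sigma1 U V W)"
  unfolding braid_sigma1_def by (intro is_inv_mat_kron is_inv_braiding[OF assms] is_inv_mat_one)

lemma is_inv_sigma2:
  assumes G: "group G" and \<omega>: "normalized_3cocycle G \<omega>"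
    and U: "center_object G \<omega> U" and V: "center_object G \<omega> V" and W: "center_object G \<omega> W"
  shows "is_inv_mat (cdim U * cdim W * cdim V) (cdim U * cdim V * cdim W) (braid_sigma2 \<omega> U V W)"
proof -
  have k: "is_inv_mat (cdim U * cdim W * cdim V) (cdim U * cdim V * cdim W)
     (kron (1\<^sub>m (cdim U)) (braiding V W))"
    using is_inv_mat_kron[OF is_inv_mat_one[of "cdim U"] is_inv_braiding[OF G \<omega> V W]]
    by (simp add: mult.assoc)
  show ?thesis unfolding braid_sigma2_def
    by (rule is_inv_mat_mult[OF is_inv_mat_mult[OF associator_invertible[OF \<omega> U W V] k]
        is_inv_mat_minv(5)[OF associator_invertible[OF \<omega> U V W]]])
qed

lemma is_inv_step:
  assumes G: "group G" and \<omega>: "normalized_3cocycle G \<omega>"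
    and U: "center_object G \<omega> U" and V: "center_object G \<omega> V" and W: "center_object G \<omega> W"
  shows "is_inv_mat (cdim V * cdim W * cdim U) (cdim U * cdim V * cdim W) (braid_step \<omega> U V W)"
  unfolding braid_step_def
  by (rule is_inv_mat_mult[OF is_inv_mat_minv(5)[OF is_inv_sigma2[OF G \<omega> V W U]] is_inv_sigma1[OF G \<omega> U V]])

context
  fixes G :: "('g, 'm) monoid_scheme" and \<omega> and U V W U' V' W' :: "'g center_obj" and P Q S
  assumes G: "group G" and \<omega>: "normalized_3cocycle G \<omega>"
    and U: "center_object G \<omega> U" and V: "center_object G \<omega> V" and W: "center_object G \<omega> W"
    and U': "center_object G \<omega> U'" and V': "center_object G \<omega> V'" and W': "center_object G \<omega> W'"
    and P: "center_morphism G U U' P" and Q: "center_morphism G V V' Q" and S: "center_morphism G W W' S"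
begin

lemma morphism_carriers:
  "P \<in> carrier_mat (cdim U') (cdim U)" "Q \<in> carrier_mat (cdim V') (cdim V)" "S \<in> carrier_mat (cdim W') (cdim W)"
  using P Q S by (auto simp: center_morphism_def)

lemma kron3_carrier:
  "kron (kron P Q) S \<in> carrier_mat (cdim U' * cdim V' * cdim W') (cdim U * cdim V * cdim W)"
  by (intro kron_carrier morphism_carriers)

lemma associator_natural:
  "associator \<omega> U' V' W' * kron (kron P Q) S = kron (kron P Q) S * associator \<omega> U V W"
proof (rule eq_matI)
  note k = kron3_carrier
  note c = morphism_carriers
  note pq = kron_carrier[OF c(1,2)]
  have sub: "set (degs U) \<subseteq> carrier G" "set (degs V) \<subseteq> carrier G" "set (degs W) \<subseteq> carrier G"
    using U V W by (auto simp: center_object_def)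
  fix x y assume "x < dim_row (kron (kron P Q) S * associator \<omega> U V W)"
    "y < dim_col (kron (kron P Q) S * associator \<omega> U V W)"
  then have x: "x < cdim U' * cdim V' * cdim W'" and y: "y < cdim U * cdim V * cdim W"
    using k associator_carrier[of \<omega> U V W] by auto
  note x1 = div_mod_less[OF x] and y1 = div_mod_less[OF y]
  note x2 = div_mod_less[OF x1(1)] and y2 = div_mod_less[OF y1(1)]
  have e: "kron (kron P Q) S $$ (x, y) =
     P $$ (x div cdim W' div cdim V', y div cdim W div cdim V) *
     Q $$ (x div cdim W' mod cdim V', y div cdim W mod cdim V) * S $$ (x mod cdim W', y mod cdim W)"
    unfolding kron_entry[OF pq c(3) x y] kron_entry[OF c(1,2) x1(1) y1(1)] ..
  show "(associator \<omega> U' V' W' * kron (kron P Q) S) $$ (x, y) = (kron (kron P Q) S * associator \<omega> U V W) $$ (x, y)"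
  proof (cases "kron (kron P Q) S $$ (x, y) = 0")
    case False
    then have nz: "P $$ (x div cdim W' div cdim V', y div cdim W div cdim V) \<noteq> 0"
      "Q $$ (x div cdim W' mod cdim V', y div cdim W mod cdim V) \<noteq> 0"
      "S $$ (x mod cdim W', y mod cdim W) \<noteq> 0" unfolding e by auto
    have "associator \<omega> U' V' W' $$ (x, x) = associator \<omega> U V W $$ (y, y)"
      using x y center_morphismD(2)[OF P sub(1) x2(1) y2(1) nz(1)]
        center_morphismD(2)[OF Q sub(2) x2(2) y2(2) nz(2)] center_morphismD(2)[OF S sub(3) x1(2) y1(2) nz(3)]
      by (simp add: associator_def)
    then show ?thesis
      unfolding associator_mult[OF k x y] mult_associator[OF k x y] by simp
  qed (simp add: associator_mult[OF k x y] mult_associator[OF k x y])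
qed (use kron3_carrier associator_carrier[of \<omega> U V W] associator_carrier[of \<omega> U' V' W'] in auto)

lemma sigma1_natural:
  "braid_sigma1 U' V' W' * kron (kron P Q) S = kron (kron Q P) S * braid_sigma1 U V W"
proof -
  note c = morphism_carriers
  have "braid_sigma1 U' V' W' * kron (kron P Q) S = kron (braiding U' V' * kron P Q) (1\<^sub>m (cdim W') * S)"
    unfolding braid_sigma1_def
    by (rule kron_mult[symmetric, OF braiding_carrier kron_carrier[OF c(1,2)] one_carrier_mat c(3)])
  also have "\<dots> = kron (kron Q P * braiding U V) (S * 1\<^sub>m (cdim W))"
    using c by (simp add: braiding_natural[OF U V U' V' P Q])
  also have "\<dots> = kron (kron Q P) S * braid_sigma1 U V W"
    unfolding braid_sigma1_def
    by (rule kron_mult[OF kron_carrier[OF c(2,1)] braiding_carrier c(3) one_carrier_mat])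
  finally show ?thesis .
qed

end

context
  fixes G :: "('g, 'm) monoid_scheme" and \<omega> and U V W U' V' W' :: "'g center_obj" and P Q S
  assumes G: "group G" and \<omega>: "normalized_3cocycle G \<omega>"
    and U: "center_object G \<omega> U" and V: "center_object G \<omega> V" and W: "center_object G \<omega> W"
    and U': "center_object G \<omega> U'" and V': "center_object G \<omega> V'" and W': "center_object G \<omega> W'"
    and P: "center_morphism G U U' P" and Q: "center_morphism G V V' Q" and S: "center_morphism G W W' S"
begin

lemma id_braiding_natural:
  "kron (1\<^sub>m (cdim U')) (braiding V' W') * kron (kron P Q) S
   = kron (kron P S) Q * kron (1\<^sub>m (cdim U)) (braiding V W)"
proof -
  note c = morphism_carriers[OF G \<omega> U V W U' V' W' P Q S]
  have "kron (1\<^sub>m (cdim U')) (braiding V' W') * kron P (kron Q S) = kron (1\<^sub>m (cdim U') * P) (braiding V' W' * kron Q S)"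
    by (rule kron_mult[symmetric, OF one_carrier_mat c(1) braiding_carrier kron_carrier[OF c(2,3)]])
  also have "\<dots> = kron (P * 1\<^sub>m (cdim U)) (kron S Q * braiding V W)"
    using c by (simp add: braiding_natural[OF V W V' W' Q S])
  also have "\<dots> = kron P (kron S Q) * kron (1\<^sub>m (cdim U)) (braiding V W)"
    by (rule kron_mult[OF c(1) one_carrier_mat kron_carrier[OF c(3,2)] braiding_carrier])
  finally show ?thesis by (simp add: kron_assoc[OF c(1,2,3)] kron_assoc[OF c(1,3,2)])
qed

end

context
  fixes G :: "('g, 'm) monoid_scheme" and \<omega> and U V W U' V' W' :: "'g center_obj" and P Q S
  assumes G: "group G" and \<omega>: "normalized_3cocycle G \<omega>"
    and U: "center_object G \<omega> U" and V: "center_object G \<omega> V" and W: "center_object G \<omega> W"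
    and U': "center_object G \<omega> U'" and V': "center_object G \<omega> V'" and W': "center_object G \<omega> W'"
    and P: "center_morphism G U U' P" and Q: "center_morphism G V V' Q" and S: "center_morphism G W W' S"
begin


lemma sigma2_natural:
  "braid_sigma2 \<omega> U' V' W' * kron (kron P Q) S = kron (kron P S) Q * braid_sigma2 \<omega> U V W"
proof -
  note k = kron3_carrier[OF G \<omega> U V W U' V' W' P Q S] kron3_carrier[OF G \<omega> U W V U' W' V' P S Q]
  have 1: "minv (associator \<omega> U' V' W') * kron (kron P Q) S = kron (kron P Q) S * minv (associator \<omega> U V W)"
    by (rule minv_natural[OF associator_invertible[OF \<omega> U V W] associator_invertible[OF \<omega> U' V' W'] k(1,1)
          associator_natural[OF G \<omega> U V W U' V' W' P Q S]])
  note a = is_inv_mat_minv(2)[OF associator_invertible[OF \<omega> U V W]]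
    is_inv_mat_minv(2)[OF associator_invertible[OF \<omega> U' V' W']]
  have b: "kron (1\<^sub>m (cdim U)) (braiding V W) \<in> carrier_mat (cdim U * cdim W * cdim V) (cdim U * cdim V * cdim W)"
    "kron (1\<^sub>m (cdim U')) (braiding V' W') \<in> carrier_mat (cdim U' * cdim W' * cdim V') (cdim U' * cdim V' * cdim W')"
    using kron_carrier[OF one_carrier_mat[of "cdim U"] braiding_carrier[of V W]]
      kron_carrier[OF one_carrier_mat[of "cdim U'"] braiding_carrier[of V' W']] by (simp_all add: mult.assoc)
  note 2 = id_braiding_natural[OF G \<omega> U V W U' V' W' P Q S]
  note 3 = associator_natural[OF G \<omega> U W V U' W' V' P S Q]
  note 4 = natural_comp[OF 2 3 b k associator_carrier associator_carrier k(2)]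
  show ?thesis unfolding braid_sigma2_def
    by (rule natural_comp[OF 1 4 a k(1,1) mult_carrier_mat[OF associator_carrier b(1)]
          mult_carrier_mat[OF associator_carrier b(2)] k(2)])
qed

end

context
  fixes G :: "('g, 'm) monoid_scheme" and \<omega> and U V W U' V' W' :: "'g center_obj" and P Q S
  assumes G: "group G" and \<omega>: "normalized_3cocycle G \<omega>"
    and U: "center_object G \<omega> U" and V: "center_object G \<omega> V" and W: "center_object G \<omega> W"
    and U': "center_object G \<omega> U'" and V': "center_object G \<omega> V'" and W': "center_object G \<omega> W'"
    and P: "center_morphism G U U' P" and Q: "center_morphism G V V' Q" and S: "center_morphism G W W' S"
begin


lemma step_natural:
  "braid_step \<omega> U' V' W' * kron (kron P Q) S = kron (kron Q S) P * braid_step \<omega> U V W"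
proof -
  note k = kron3_carrier[OF G \<omega> U V W U' V' W' P Q S] kron3_carrier[OF G \<omega> V U W V' U' W' Q P S]
    kron3_carrier[OF G \<omega> V W U V' W' U' Q S P]
  note i = is_inv_sigma2[OF G \<omega> V W U] is_inv_sigma2[OF G \<omega> V' W' U']
  note 1 = sigma1_natural[OF G \<omega> U V W U' V' W' P Q S]
  have 2: "minv (braid_sigma2 \<omega> V' W' U') * kron (kron Q P) S
    = kron (kron Q S) P * minv (braid_sigma2 \<omega> V W U)"
    by (rule minv_natural[OF i k(3,2) sigma2_natural[OF G \<omega> V W U V' W' U' Q S P]])
  show ?thesis unfolding braid_step_def
    by (rule natural_comp[OF 1 2 is_inv_mat_minv(1)[OF is_inv_sigma1[OF G \<omega> U V]]
        is_inv_mat_minv(1)[OF is_inv_sigma1[OF G \<omega> U' V']] k(1,2) is_inv_mat_minv(2)[OF i(1)]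
        is_inv_mat_minv(2)[OF i(2)] k(3)])
qed

end

lemma center_iso_inv_mat:
  assumes "center_iso G V W"
  obtains P where "center_morphism G V W P" "is_inv_mat (cdim W) (cdim V) P"
proof -
  obtain P Q where PQ: "center_morphism G V W P" "center_morphism G W V Q"
      "Q * P = 1\<^sub>m (cdim V)" "P * Q = 1\<^sub>m (cdim W)" using assms by (auto simp: center_iso_def)
  have c: "P \<in> carrier_mat (cdim W) (cdim V)" "Q \<in> carrier_mat (cdim V) (cdim W)"
    using PQ by (auto simp: center_morphism_def)
  have "mtrace (P * Q) = mtrace (Q * P)" by (rule mtrace_comm[OF c])
  then have "cdim V = cdim W" unfolding PQ by (simp add: mtrace_def)
  then show ?thesis using that[OF PQ(1)] PQ c by (auto simp: is_inv_mat_def)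
qed

lemma B_tensor_iso:
  assumes G: "group G" and \<omega>: "normalized_3cocycle G \<omega>"
    and U: "center_object G \<omega> U" and V: "center_object G \<omega> V" and W: "center_object G \<omega> W"
    and U': "center_object G \<omega> U'" and V': "center_object G \<omega> V'" and W': "center_object G \<omega> W'"
    and "center_iso G U U'" "center_iso G V V'" "center_iso G W W'"
  shows "B_tensor \<omega> U' V' W' = B_tensor \<omega> U V W"
proof -
  obtain P where P: "center_morphism G U U' P" and Pi: "is_inv_mat (cdim U') (cdim U) P"
    using center_iso_inv_mat[OF assms(9)] .
  obtain Q where Q: "center_morphism G V V' Q" and Qi: "is_inv_mat (cdim V') (cdim V) Q"
    using center_iso_inv_mat[OF assms(10)] .
  obtain S where S: "center_morphism G W W' S" and Si: "is_inv_mat (cdim W') (cdim W) S"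
    using center_iso_inv_mat[OF assms(11)] .
  note k = kron3_carrier[OF G \<omega> U V W U' V' W' P Q S] kron3_carrier[OF G \<omega> V W U V' W' U' Q S P]
    kron3_carrier[OF G \<omega> W U V W' U' V' S P Q]
  note n = step_natural[OF G \<omega> U V W U' V' W' P Q S] step_natural[OF G \<omega> V W U V' W' U' Q S P]
    step_natural[OF G \<omega> W U V W' U' V' S P Q]
  note c = is_inv_mat_minv(1)[OF is_inv_step[OF G \<omega> U V W]] is_inv_mat_minv(1)[OF is_inv_step[OF G \<omega> V W U]]
    is_inv_mat_minv(1)[OF is_inv_step[OF G \<omega> W U V]]
  note c' = is_inv_mat_minv(1)[OF is_inv_step[OF G \<omega> U' V' W']] is_inv_mat_minv(1)[OF is_inv_step[OF G \<omega> V' W' U']]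
    is_inv_mat_minv(1)[OF is_inv_step[OF G \<omega> W' U' V']]
  let ?K = "kron (kron P Q) S"
  let ?M = "braid_step \<omega> W U V * braid_step \<omega> V W U * braid_step \<omega> U V W"
  let ?M' = "braid_step \<omega> W' U' V' * braid_step \<omega> V' W' U' * braid_step \<omega> U' V' W'"
  let ?d = "cdim U * cdim V * cdim W" and ?d' = "cdim U' * cdim V' * cdim W'"
  have 1: "(braid_step \<omega> W' U' V' * braid_step \<omega> V' W' U') * kron (kron Q S) P
    = ?K * (braid_step \<omega> W U V * braid_step \<omega> V W U)"
    by (rule natural_comp[OF n(2,3) c(2) c'(2) k(2,3) c(3) c'(3) k(1)])
  have 2: "?M' * ?K = ?K * ?M"
    by (rule natural_comp[OF n(1) 1 c(1) c'(1) k(1,2) mult_carrier_mat[OF c(3,2)] mult_carrier_mat[OF c'(3,2)] k(1)])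
  have M: "?M \<in> carrier_mat ?d ?d" and M': "?M' \<in> carrier_mat ?d' ?d'"
    by (rule mult_carrier_mat[OF mult_carrier_mat[OF c(3,2)] c(1)])
       (rule mult_carrier_mat[OF mult_carrier_mat[OF c'(3,2)] c'(1)])
  note K = is_inv_mat_minv[OF is_inv_mat_kron[OF is_inv_mat_kron[OF Pi Qi] Si]]
  have "?M' = ?M' * (?K * minv ?K)" unfolding K(3) by (rule right_mult_one_mat[OF M', symmetric])
  also have "\<dots> = ?M' * ?K * minv ?K" by (rule assoc_mult_mat[OF M' K(1,2), symmetric])
  also have "\<dots> = ?K * (?M * minv ?K)" unfolding 2 by (rule assoc_mult_mat[OF K(1) M K(2)])
  finally have "mtrace ?M' = mtrace (?K * (?M * minv ?K))" by simp
  also have "\<dots> = mtrace ((?M * minv ?K) * ?K)" by (rule mtrace_comm[OF K(1) mult_carrier_mat[OF M K(2)]])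
  also have "(?M * minv ?K) * ?K = ?M" unfolding assoc_mult_mat[OF M K(2,1)] K(4) by (rule right_mult_one_mat[OF M])
  finally show ?thesis unfolding B_tensor_def .
qed


section \<open>The twist acts on simple objects by a scalar\<close>

lemma twist_carrier: "twist V \<in> carrier_mat (cdim V) (cdim V)"
  by (simp add: twist_def)

lemma twist_natural:
  assumes V: "center_object G \<omega> V" and V': "center_object G \<omega> V'" and P: "center_morphism G V V' P"
  shows "twist V' * P = P * twist V"
proof (rule eq_matI)
  have sub: "set (degs V) \<subseteq> carrier G" using V by (auto simp: center_object_def)
  note Pc = center_morphismD[OF P sub]
  fix i k assume "i < dim_row (P * twist V)" "k < dim_col (P * twist V)"
  then have i: "i < cdim V'" and k: "k < cdim V" using Pc(1) by (auto simp: twist_def)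
  have g: "degs V ! k \<in> carrier G" using center_objectD(1)[OF V k] .
  have "(twist V' * P) $$ (i, k) = (\<Sum>j<cdim V'. action V' (degs V' ! j) $$ (i, j) * P $$ (j, k))"
    unfolding mult_entry[OF twist_carrier Pc(1) i k] using i by (simp add: twist_def)
  also have "\<dots> = (\<Sum>j<cdim V'. action V' (degs V ! k) $$ (i, j) * P $$ (j, k))"
    by (intro sum.cong refl) (metis Pc(2) k lessThan_iff mult_zero_right)
  also have "\<dots> = (P * action V (degs V ! k)) $$ (i, k)"
    unfolding Pc(3)[OF g] mult_entry[OF center_objectD(2)[OF V' g] Pc(1) i k] ..
  also have "\<dots> = (P * twist V) $$ (i, k)"
    unfolding mult_entry[OF Pc(1) center_objectD(2)[OF V g] i k] mult_entry[OF Pc(1) twist_carrier i k]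
    using k by (simp add: twist_def)
  finally show "(twist V' * P) $$ (i, k) = (P * twist V) $$ (i, k)" .
qed (use P in \<open>auto simp: twist_def center_morphism_def\<close>)

lemma T_scalar_iso:
  assumes V: "center_object G \<omega> V" and V': "center_object G \<omega> V'" and iso: "center_iso G V V'"
  shows "T_scalar V' = T_scalar V"
proof -
  have dir: "twist W' = t \<cdot>\<^sub>m 1\<^sub>m (cdim W')"
    if W: "center_object G \<omega> W" and W': "center_object G \<omega> W'" and iso: "center_iso G W W'"
      and t: "twist W = t \<cdot>\<^sub>m 1\<^sub>m (cdim W)" for W W' and t :: complex
  proof -
    obtain P where P: "center_morphism G W W' P" and Pi: "is_inv_mat (cdim W') (cdim W) P"
      using center_iso_inv_mat[OF iso] .
    note p = is_inv_mat_minv[OF Pi]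
    have "twist W' = twist W' * P * minv P"
      using p twist_carrier[of W'] assoc_mult_mat[OF twist_carrier[of W'] p(1,2)] by simp
    also have "\<dots> = P * (t \<cdot>\<^sub>m 1\<^sub>m (cdim W)) * minv P"
      unfolding twist_natural[OF W W' P] t ..
    also have "P * (t \<cdot>\<^sub>m 1\<^sub>m (cdim W)) = t \<cdot>\<^sub>m P"
      using mult_smult_distrib[OF p(1) one_carrier_mat[of "cdim W"]] p(1) by simp
    also have "t \<cdot>\<^sub>m P * minv P = t \<cdot>\<^sub>m 1\<^sub>m (cdim W')"
      using mult_smult_assoc_mat[OF p(1,2)] p(3) by simp
    finally show ?thesis .
  qed
  have "twist V' = t \<cdot>\<^sub>m 1\<^sub>m (cdim V') \<longleftrightarrow> twist V = t \<cdot>\<^sub>m 1\<^sub>m (cdim V)" for t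
    using dir[OF V V' iso] dir[OF V' V center_iso_sym[OF iso]] by blast
  then show ?thesis by (simp add: T_scalar_def)
qed

lemma action_mult_entry:
  assumes V: "center_object G \<omega> V" and g: "g \<in> carrier G" and h: "h \<in> carrier G"
    and gh: "g \<otimes>\<^bsub>G\<^esub> h \<in> carrier G" and i: "i < cdim V" and j: "j < cdim V"
  shows "(action V g * action V h) $$ (i, j)
    = alpha G \<omega> (degs V ! j) g h * action V (g \<otimes>\<^bsub>G\<^esub> h) $$ (i, j)"
proof -
  let ?n = "cdim V"
  note A = center_objectD(2)[OF V g] center_objectD(2)[OF V h] center_objectD(2)[OF V gh]
  have "(action V g * action V h) $$ (i, j) = ((action V g * action V h) *\<^sub>v unit_vec ?n j) $ i"
    using A i j by (simp add: mat_unit_vec[of _ ?n ?n])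
  also have "\<dots> = (action V g *\<^sub>v (action V h *\<^sub>v unit_vec ?n j)) $ i" using A by simp
  also have "\<dots> = (alpha G \<omega> (degs V ! j) g h \<cdot>\<^sub>v (action V (g \<otimes>\<^bsub>G\<^esub> h) *\<^sub>v unit_vec ?n j)) $ i"
    using center_objectD(5)[OF V g h center_objectD(1)[OF V j] unit_vec_component[OF j]] by simp
  also have "\<dots> = alpha G \<omega> (degs V ! j) g h * action V (g \<otimes>\<^bsub>G\<^esub> h) $$ (i, j)"
    using A i j by (simp add: mat_unit_vec[of _ ?n ?n])
  finally show ?thesis .
qed

lemma twist_commute:
  assumes G: "group G" and \<omega>: "normalized_3cocycle G \<omega>" and V: "center_object G \<omega> V" and g: "g \<in> carrier G"
  shows "twist V * action V g = action V g * twist V"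
proof (rule eq_matI)
  interpret group G by fact
  note A = center_objectD(2)[OF V g]
  fix i k assume "i < dim_row (action V g * twist V)" "k < dim_col (action V g * twist V)"
  then have i: "i < cdim V" and k: "k < cdim V" using A by (auto simp: twist_def)
  let ?k = "degs V ! k"
  have kc: "?k \<in> carrier G" using center_objectD(1)[OF V k] .
  have c: "conj_by G g ?k \<in> carrier G" by (rule conj_by_closed[OF G g kc])
  have m: "conj_by G g ?k \<otimes>\<^bsub>G\<^esub> g = g \<otimes>\<^bsub>G\<^esub> ?k" using g kc by (simp add: conj_by_def m_assoc)
  have kk: "conj_by G ?k ?k = ?k" using kc by (simp add: conj_by_def m_assoc)
  have gkk: "conj_by G (g \<otimes>\<^bsub>G\<^esub> ?k) ?k = conj_by G g ?k" using conj_by_mult[OF G g kc kc] kk by simp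
  have nz: "\<omega> x y z \<noteq> 0" if "x \<in> carrier G" "y \<in> carrier G" "z \<in> carrier G" for x y z
    using \<omega> that by (auto simp: normalized_3cocycle_def)
  have al: "alpha G \<omega> ?k (conj_by G g ?k) g = alpha G \<omega> ?k g ?k"
    using nz[OF c c g] nz[OF g kc kc] by (simp add: alpha_def m kk gkk)
  have "(twist V * action V g) $$ (i, k) = (\<Sum>j<cdim V. action V (degs V ! j) $$ (i, j) * action V g $$ (j, k))"
    unfolding mult_entry[OF twist_carrier A i k] using i by (simp add: twist_def)
  also have "\<dots> = (\<Sum>j<cdim V. action V (conj_by G g ?k) $$ (i, j) * action V g $$ (j, k))"
    by (intro sum.cong refl) (metis center_objectD(3)[OF V g] k lessThan_iff mult_zero_right)
  also have "\<dots> = (action V (conj_by G g ?k) * action V g) $$ (i, k)"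
    unfolding mult_entry[OF center_objectD(2)[OF V c] A i k] ..
  also have "\<dots> = (action V g * action V ?k) $$ (i, k)"
    using action_mult_entry[OF V c g _ i k] action_mult_entry[OF V g kc _ i k] g kc c by (simp add: m al)
  also have "\<dots> = (action V g * twist V) $$ (i, k)"
    unfolding mult_entry[OF A center_objectD(2)[OF V kc] i k] mult_entry[OF A twist_carrier i k]
    using k by (simp add: twist_def)
  finally show "(twist V * action V g) $$ (i, k) = (action V g * twist V) $$ (i, k)" .
qed (use center_objectD(2)[OF V g] in \<open>auto simp: twist_def\<close>)

lemma twist_scalar:
  assumes G: "group G" and \<omega>: "normalized_3cocycle G \<omega>" and V: "simple_object G \<omega> V"
  shows "twist V = T_scalar V \<cdot>\<^sub>m 1\<^sub>m (cdim V)"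
proof -
  interpret group G by fact
  let ?n = "cdim V"
  have Vc: "center_object G \<omega> V" and n: "?n > 0"
    and max: "\<And>S. subobject_space G V S \<Longrightarrow> S = {0\<^sub>v ?n} \<or> S = carrier_vec ?n"
    using V by (auto simp: simple_object_def)
  note tc = twist_carrier[of V]
  from spectrum_non_empty[OF tc n] obtain t where "eigenvalue (twist V) t"
    by (auto simp: spectrum_def)
  then obtain v where v: "v \<in> carrier_vec ?n" "v \<noteq> 0\<^sub>v ?n" "twist V *\<^sub>v v = t \<cdot>\<^sub>v v"
    using tc by (auto simp: eigenvalue_def eigenvector_def)
  define S where "S = {w \<in> carrier_vec ?n. twist V *\<^sub>v w = t \<cdot>\<^sub>v w}"
  have "subobject_space G V S"
    unfolding subobject_space_def
  proof (intro conjI ballI allI)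
    show "S \<subseteq> carrier_vec ?n" by (auto simp: S_def)
    show "0\<^sub>v ?n \<in> S" using tc by (auto simp: S_def)
    show "x + y \<in> S" if "x \<in> S" "y \<in> S" for x y
      using that mult_add_distrib_mat_vec[OF tc, of x y] smult_add_distrib_vec[of x ?n y t] by (auto simp: S_def)
    show "c \<cdot>\<^sub>v x \<in> S" if "x \<in> S" for x c
      using that mult_mat_vec[OF tc, of x c] by (auto simp: S_def smult_smult_assoc mult.commute)
    show "action V g *\<^sub>v x \<in> S" if g: "g \<in> carrier G" and x: "x \<in> S" for g x
    proof -
      note A = center_objectD(2)[OF Vc g]
      have xc: "x \<in> carrier_vec ?n" and tx: "twist V *\<^sub>v x = t \<cdot>\<^sub>v x" using x by (auto simp: S_def)
      have "twist V *\<^sub>v (action V g *\<^sub>v x) = (twist V * action V g) *\<^sub>v x"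
        using assoc_mult_mat_vec[OF tc A xc] by simp
      also have "\<dots> = action V g *\<^sub>v (twist V *\<^sub>v x)"
        unfolding twist_commute[OF G \<omega> Vc g] using assoc_mult_mat_vec[OF A tc xc] by simp
      also have "\<dots> = t \<cdot>\<^sub>v (action V g *\<^sub>v x)" unfolding tx by (rule mult_mat_vec[OF A xc])
      finally show ?thesis using A xc by (auto simp: S_def)
    qed
    show "component_proj V h x \<in> S" if h: "h \<in> carrier G" and x: "x \<in> S" for h x
    proof -
      have xc: "x \<in> carrier_vec ?n" and tx: "twist V *\<^sub>v x = t \<cdot>\<^sub>v x" using x by (auto simp: S_def)
      have pc: "component_proj V h x \<in> carrier_vec ?n" by (simp add: component_proj_def)
      have deg: "degs V ! i = degs V ! j" if "i < ?n" "j < ?n" "twist V $$ (i, j) \<noteq> 0" for i j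
      proof -
        have "degs V ! i = conj_by G (degs V ! j) (degs V ! j)"
          using that center_objectD(3)[OF Vc center_objectD(1)[OF Vc that(2)] that(1,2)] by (simp add: twist_def)
        then show ?thesis using center_objectD(1)[OF Vc that(2)] by (simp add: conj_by_def m_assoc)
      qed
      have "twist V *\<^sub>v component_proj V h x = t \<cdot>\<^sub>v component_proj V h x"
      proof (rule eq_vecI)
        fix i assume "i < dim_vec (t \<cdot>\<^sub>v component_proj V h x)"
        then have i: "i < ?n" by (simp add: component_proj_def)
        have "(twist V *\<^sub>v component_proj V h x) $ i
          = (\<Sum>j<?n. if degs V ! i = h then twist V $$ (i, j) * x $ j else 0)"
          unfolding mat_vec_entry[OF tc pc i]
          by (intro sum.cong refl) (use deg[OF i] in \<open>force simp: component_proj_def\<close>)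
        also have "\<dots> = (if degs V ! i = h then (twist V *\<^sub>v x) $ i else 0)"
          by (simp add: mat_vec_entry[OF tc xc i])
        also have "\<dots> = (t \<cdot>\<^sub>v component_proj V h x) $ i"
          unfolding tx using i xc by (simp add: component_proj_def)
        finally show "(twist V *\<^sub>v component_proj V h x) $ i = (t \<cdot>\<^sub>v component_proj V h x) $ i" .
      qed (simp add: component_proj_def twist_def)
      then show ?thesis using pc by (auto simp: S_def)
    qed
  qed
  moreover have "S \<noteq> {0\<^sub>v ?n}" using v by (auto simp: S_def)
  ultimately have S: "S = carrier_vec ?n" using max by blast
  have tw: "twist V = t \<cdot>\<^sub>m 1\<^sub>m ?n"
  proof (rule eq_matI)
    fix i j assume "i < dim_row (t \<cdot>\<^sub>m 1\<^sub>m ?n)" "j < dim_col (t \<cdot>\<^sub>m 1\<^sub>m ?n)"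
    then have ij: "i < ?n" "j < ?n" by auto
    have "unit_vec ?n j \<in> S" unfolding S by simp
    then have "twist V *\<^sub>v unit_vec ?n j = t \<cdot>\<^sub>v unit_vec ?n j" by (simp add: S_def)
    then have "col (twist V) j $ i = (t \<cdot>\<^sub>v unit_vec ?n j) $ i" using mat_unit_vec[OF tc ij(2)] by simp
    then show "twist V $$ (i, j) = (t \<cdot>\<^sub>m 1\<^sub>m ?n) $$ (i, j)" using ij tc by auto
  qed (auto simp: twist_def)
  have "T_scalar V = t" unfolding T_scalar_def
  proof (rule the_equality)
    show "twist V = t \<cdot>\<^sub>m 1\<^sub>m ?n" by (rule tw)
    fix s assume "twist V = s \<cdot>\<^sub>m 1\<^sub>m ?n"
    then have "(s \<cdot>\<^sub>m 1\<^sub>m ?n) $$ (0, 0) = (t \<cdot>\<^sub>m 1\<^sub>m ?n) $$ (0, 0)" using tw by simp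
    then show "s = t" using n by simp
  qed
  with tw show ?thesis by simp
qed

lemma T_scalar_char:
  assumes G: "group G" and \<omega>: "normalized_3cocycle G \<omega>" and V: "simple_object G \<omega> V"
    and g: "g \<in> set (degs V)"
  shows "T_scalar V = component_char V g g / component_char V g \<one>\<^bsub>G\<^esub>"
proof -
  interpret group G by fact
  have Vc: "center_object G \<omega> V" using V by (simp add: simple_object_def)
  let ?I = "{i. i < cdim V \<and> degs V ! i = g}"
  have ne: "?I \<noteq> {}" "finite ?I" using g by (auto simp: in_set_conv_nth)
  have "action V g $$ (i, i) = T_scalar V" if "i \<in> ?I" for i
  proof -
    have "action V g $$ (i, i) = twist V $$ (i, i)" using that by (auto simp: twist_def)
    then show ?thesis using twist_scalar[OF G \<omega> V] that by auto
  qed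
  then have 1: "component_char V g g = of_nat (card ?I) * T_scalar V" by (simp add: component_char_def)
  have "action V \<one>\<^bsub>G\<^esub> $$ (i, i) = 1" if "i \<in> ?I" for i
  proof -
    have i: "i < cdim V" using that by simp
    have "col (action V \<one>\<^bsub>G\<^esub>) i = unit_vec (cdim V) i"
      using center_objectD(4)[OF Vc, of "unit_vec (cdim V) i"] mat_unit_vec[OF center_objectD(2)[OF Vc one_closed] i]
      by simp
    then have "col (action V \<one>\<^bsub>G\<^esub>) i $ i = 1" using i by simp
    then show ?thesis using i center_objectD(2)[OF Vc one_closed] by simp
  qed
  then have 2: "component_char V g \<one>\<^bsub>G\<^esub> = of_nat (card ?I)" by (simp add: component_char_def)
  show ?thesis unfolding 1 2 using ne by (simp add: card_eq_0_iff)
qed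

lemma simple_classes_D:
  assumes "X \<in> simple_classes G \<omega>"
  shows "\<exists>V. V \<in> X" "V \<in> X \<Longrightarrow> simple_object G \<omega> V" "V \<in> X \<Longrightarrow> W \<in> X \<Longrightarrow> center_iso G V W"
proof -
  note e = equiv_simple_iso_rel[of G \<omega>]
  note X = assms[unfolded simple_classes_def]
  show "\<exists>V. V \<in> X" using in_quotient_imp_non_empty[OF e X] by blast
  show "V \<in> X \<Longrightarrow> simple_object G \<omega> V" using in_quotient_imp_subset[OF e X] by blast
  show "V \<in> X \<Longrightarrow> W \<in> X \<Longrightarrow> center_iso G V W"
    using in_quotient_imp_in_rel[OF e X, of V W] by (auto simp: simple_iso_rel_def)
qed

lemma T_class_eq:
  assumes "X \<in> simple_classes G \<omega>" "V \<in> X"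
  shows "T_class X = T_scalar V"
proof -
  note X = simple_classes_D[OF assms(1)]
  have "T_scalar W = T_scalar V" if "W \<in> X" for W
    using T_scalar_iso[of G \<omega> V W] X that assms(2) by (auto simp: simple_object_def)
  then have "T_scalar ` X = (\<lambda>_. T_scalar V) ` X" by (intro image_cong) auto
  also have "\<dots> = {T_scalar V}" by (rule image_constant[OF assms(2)])
  finally have "T_scalar ` X = {T_scalar V}" .
  then show ?thesis by (simp add: T_class_def)
qed

lemma B_class_eq:
  assumes "group G" "normalized_3cocycle G \<omega>"
    and "X \<in> simple_classes G \<omega>" "Y \<in> simple_classes G \<omega>" "Z \<in> simple_classes G \<omega>"
    and "U \<in> X" "V \<in> Y" "W \<in> Z"
  shows "B_class \<omega> X Y Z = B_tensor \<omega> U V W"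
proof -
  have c: "center_object G \<omega> V" if "V \<in> X" "X \<in> simple_classes G \<omega>" for V X
    using simple_classes_D(2)[OF that(2,1)] by (simp add: simple_object_def)
  have "B_tensor \<omega> U' V' W' = B_tensor \<omega> U V W" if "U' \<in> X" "V' \<in> Y" "W' \<in> Z" for U' V' W'
    by (rule B_tensor_iso[OF assms(1,2) c[OF assms(6,3)] c[OF assms(7,4)] c[OF assms(8,5)]
          c[OF that(1) assms(3)] c[OF that(2) assms(4)] c[OF that(3) assms(5)]
          simple_classes_D(3)[OF assms(3,6) that(1)] simple_classes_D(3)[OF assms(4,7) that(2)]
          simple_classes_D(3)[OF assms(5,8) that(3)]])
  then have "(\<lambda>(U, V, W). B_tensor \<omega> U V W) ` (X \<times> Y \<times> Z)
    = (\<lambda>_. B_tensor \<omega> U V W) ` (X \<times> Y \<times> Z)" by (intro image_cong) auto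
  also have "\<dots> = {B_tensor \<omega> U V W}"
    using image_constant[of "(U, V, W)" "X \<times> Y \<times> Z"] assms(6-8) by simp
  finally have "(\<lambda>(U, V, W). B_tensor \<omega> U V W) ` (X \<times> Y \<times> Z) = {B_tensor \<omega> U V W}" .
  then show ?thesis by (simp add: B_class_def)
qed


section \<open>The group of order \<open>pq\<close> is a group with a cocycle\<close>

lemma group_pq_group:
  assumes p: "p > 0" and q: "q > 0" and n: "[n ^ p = 1] (mod q)"
  shows "group (pq_group p q n)"
proof -
  have np: "[n ^ (j mod p) = n ^ j] (mod q)" for j
  proof -
    have "n ^ j = (n ^ p) ^ (j div p) * n ^ (j mod p)"
      by (metis mult_div_mod_eq power_add power_mult)
    moreover have "[(n ^ p) ^ (j div p) * n ^ (j mod p) = 1 ^ (j div p) * n ^ (j mod p)] (mod q)"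
      by (intro cong_mult cong_pow n cong_refl)
    ultimately show ?thesis by (simp add: cong_sym)
  qed
  show ?thesis
  proof (rule groupI)
    fix x y z assume "x \<in> carrier (pq_group p q n)" "y \<in> carrier (pq_group p q n)" "z \<in> carrier (pq_group p q n)"
    obtain a b c d e f where xyz: "x = (a, b)" "y = (c, d)" "z = (e, f)" by (cases x, cases y, cases z) blast
    have "[(a + n ^ b * c) mod q + n ^ ((b + d) mod p) * e = (a + n ^ b * c) + n ^ (b + d) * e] (mod q)"
      by (intro cong_add cong_mult np) auto
    moreover have "[a + n ^ b * ((c + n ^ d * e) mod q) = a + n ^ b * (c + n ^ d * e)] (mod q)"
      by (intro cong_add cong_mult) auto
    moreover have "(a + n ^ b * c) + n ^ (b + d) * e = a + n ^ b * (c + n ^ d * e)"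
      by (simp add: algebra_simps power_add)
    ultimately have "[(a + n ^ b * c) mod q + n ^ ((b + d) mod p) * e = a + n ^ b * ((c + n ^ d * e) mod q)] (mod q)"
      by (metis cong_sym cong_trans)
    then show "x \<otimes>\<^bsub>pq_group p q n\<^esub> y \<otimes>\<^bsub>pq_group p q n\<^esub> z = x \<otimes>\<^bsub>pq_group p q n\<^esub> (y \<otimes>\<^bsub>pq_group p q n\<^esub> z)"
      by (simp add: pq_group_def xyz cong_def mod_add_left_eq mod_add_right_eq add.assoc)
  next
    fix x assume x: "x \<in> carrier (pq_group p q n)"
    then obtain a b where ab: "x = (a, b)" "a < q" "b < p" by (auto simp: pq_group_def)
    let ?y = "((n ^ (p - b) * (q - a)) mod q, (p - b) mod p)"
    have "[(n ^ (p - b) * (q - a)) mod q + n ^ ((p - b) mod p) * a = n ^ (p - b) * (q - a) + n ^ (p - b) * a] (mod q)"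
      by (intro cong_add cong_mult np) auto
    moreover have "n ^ (p - b) * (q - a) + n ^ (p - b) * a = n ^ (p - b) * q"
      using ab by (simp flip: distrib_left)
    ultimately have "((n ^ (p - b) * (q - a)) mod q + n ^ ((p - b) mod p) * a) mod q = 0"
      by (simp add: cong_def)
    moreover have "((p - b) mod p + b) mod p = 0" using ab by (simp add: mod_add_left_eq)
    ultimately have "?y \<otimes>\<^bsub>pq_group p q n\<^esub> x = \<one>\<^bsub>pq_group p q n\<^esub>" by (simp add: pq_group_def ab)
    moreover have "?y \<in> carrier (pq_group p q n)" using p q by (simp add: pq_group_def)
    ultimately show "\<exists>y\<in>carrier (pq_group p q n). y \<otimes>\<^bsub>pq_group p q n\<^esub> x = \<one>\<^bsub>pq_group p q n\<^esub>" by blast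
  qed (use p q in \<open>auto simp: pq_group_def\<close>)
qed

lemma cyc_cocycle_power:
  assumes p: "p > 0" and ijk: "i < p" "j < p" "k < p"
  shows "cyc_cocycle p i j k = exp (2 * of_real pi * \<i> / of_nat p) ^ (i * ((j + k) div p))"
proof -
  have "of_nat (p * ((j + k) div p) + (j + k) mod p) = (of_nat (j + k) :: complex)"
    by (simp only: mult_div_mod_eq)
  then have "of_nat j + of_nat k - of_nat ((j + k) mod p) = (of_nat p * of_nat ((j + k) div p) :: complex)"
    by (simp only: of_nat_add of_nat_mult) (simp add: algebra_simps)
  then have "cyc_cocycle p i j k
    = exp (2 * of_real pi * \<i> / (of_nat p)\<^sup>2 * (of_nat i * (of_nat p * of_nat ((j + k) div p))))"
    using ijk by (simp add: cyc_cocycle_def)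
  also have "2 * of_real pi * \<i> / (of_nat p)\<^sup>2 * (of_nat i * (of_nat p * of_nat ((j + k) div p)))
    = of_nat (i * ((j + k) div p)) * (2 * of_real pi * \<i> / of_nat p :: complex)"
    using p by (simp add: field_simps power2_eq_square)
  finally show ?thesis by (simp only: exp_of_nat_mult)
qed

lemma normalized_3cocycle_pq:
  assumes p: "p > 0"
  shows "normalized_3cocycle (pq_group p q n) (pq_cocycle p u)"
proof -
  let ?z = "exp (2 * of_real pi * \<i> / of_nat p) :: complex"
  let ?c = "\<lambda>x y. (x + y) div p"
  have zp: "?z ^ p = 1"
    using p by (simp flip: exp_of_nat_mult)
  have z: "?z ^ a = ?z ^ b" if "[a = b] (mod p)" for a b
  proof -
    have "?z ^ a = ?z ^ (a mod p)" for a
      by (metis mult_div_mod_eq power_add power_mult zp power_one mult_1)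
    then show ?thesis using that by (metis cong_def)
  qed
  have cyc: "cyc_cocycle p x y v * cyc_cocycle p w ((x + y) mod p) v * cyc_cocycle p w x y
      = cyc_cocycle p ((w + x) mod p) y v * cyc_cocycle p w x ((y + v) mod p)"
    if l: "w < p" "x < p" "y < p" "v < p" for w x y v
  proof -
    have 2: "((x + y) mod p + v) div p + (x + y) div p = (x + y + v) div p" for x y v
      using div_mult_self1[of p "(x + y) mod p + v" "(x + y) div p"] p
      by (simp add: add_ac flip: mod_mult_div_eq)
    have 3: "?c ((x + y) mod p) v + ?c x y = ?c y v + ?c x ((y + v) mod p)"
      using 2[of x y v] 2[of y v x] by (simp add: add_ac)
    have "w * ?c ((x + y) mod p) v + w * ?c x y = w * ?c y v + w * ?c x ((y + v) mod p)"
      using 3 by (metis distrib_left)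
    then have "[x * ?c y v + w * ?c ((x + y) mod p) v + w * ?c x y = (w + x) * ?c y v + w * ?c x ((y + v) mod p)] (mod p)"
      by (simp only: distrib_right add.assoc add.left_commute[of "w * ?c y v"] cong_refl)
    also have "[(w + x) * ?c y v + w * ?c x ((y + v) mod p)
      = (w + x) mod p * ?c y v + w * ?c x ((y + v) mod p)] (mod p)"
      by (intro cong_add cong_mult) auto
    finally show ?thesis
      using l p by (simp add: cyc_cocycle_power[OF p] flip: power_add) (rule z)
  qed
  show ?thesis
    unfolding normalized_3cocycle_def
  proof (intro conjI ballI)
    fix w x y v assume "w \<in> carrier (pq_group p q n)" "x \<in> carrier (pq_group p q n)"
      "y \<in> carrier (pq_group p q n)" "v \<in> carrier (pq_group p q n)"
    then have l: "snd w < p" "snd x < p" "snd y < p" "snd v < p" by (auto simp: pq_group_def)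
    have m: "snd (s \<otimes>\<^bsub>pq_group p q n\<^esub> t) = (snd s + snd t) mod p" for s t
      by (simp add: pq_group_def split_beta)
    show "pq_cocycle p u x y v * pq_cocycle p u w (x \<otimes>\<^bsub>pq_group p q n\<^esub> y) v * pq_cocycle p u w x y =
      pq_cocycle p u (w \<otimes>\<^bsub>pq_group p q n\<^esub> x) y v * pq_cocycle p u w x (y \<otimes>\<^bsub>pq_group p q n\<^esub> v)"
      unfolding pq_cocycle_def m power_mult_distrib[symmetric] cyc[OF l] ..
  qed (auto simp: pq_group_def pq_cocycle_def cyc_cocycle_def)
qed

lemma pq_group_relations:
  assumes p: "p > 1" and q: "q > 1"
  shows "card (carrier (pq_group p q n)) = p * q"
    and "(1, 0) [^]\<^bsub>pq_group p q n\<^esub> q = \<one>\<^bsub>pq_group p q n\<^esub>"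
    and "(0, 1) [^]\<^bsub>pq_group p q n\<^esub> p = \<one>\<^bsub>pq_group p q n\<^esub>"
    and "(0, 1) \<otimes>\<^bsub>pq_group p q n\<^esub> (1, 0) = (1, 0) [^]\<^bsub>pq_group p q n\<^esub> n \<otimes>\<^bsub>pq_group p q n\<^esub> (0, 1)"
    and "i < q \<Longrightarrow> j < p \<Longrightarrow>
      (i, j) = (1, 0) [^]\<^bsub>pq_group p q n\<^esub> i \<otimes>\<^bsub>pq_group p q n\<^esub> (0, 1) [^]\<^bsub>pq_group p q n\<^esub> j"
proof -
  have a: "(1, 0) [^]\<^bsub>pq_group p q n\<^esub> k = (k mod q, 0)" for k :: nat
    using p q by (induction k) (simp_all add: pq_group_def nat_pow_def mod_Suc_eq)
  have b: "(0, 1) [^]\<^bsub>pq_group p q n\<^esub> k = (0, k mod p)" for k :: nat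
    using p q by (induction k) (simp_all add: pq_group_def nat_pow_def mod_Suc_eq)
  show "card (carrier (pq_group p q n)) = p * q" by (simp add: pq_group_def)
  show "(1, 0) [^]\<^bsub>pq_group p q n\<^esub> q = \<one>\<^bsub>pq_group p q n\<^esub>"
    "(0, 1) [^]\<^bsub>pq_group p q n\<^esub> p = \<one>\<^bsub>pq_group p q n\<^esub>" unfolding a b by (simp_all add: pq_group_def)
  show "(0, 1) \<otimes>\<^bsub>pq_group p q n\<^esub> (1, 0) = (1, 0) [^]\<^bsub>pq_group p q n\<^esub> n \<otimes>\<^bsub>pq_group p q n\<^esub> (0, 1)"
    unfolding a using p q by (simp add: pq_group_def)
  show "i < q \<Longrightarrow> j < p \<Longrightarrow>
      (i, j) = (1, 0) [^]\<^bsub>pq_group p q n\<^esub> i \<otimes>\<^bsub>pq_group p q n\<^esub> (0, 1) [^]\<^bsub>pq_group p q n\<^esub> j"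
    unfolding a b by (simp add: pq_group_def)
qed

end

theory Submission
  imports Defs "HOL-Number_Theory.Pocklington"
begin

text \<open>
  The conjugacy classes of \<open>G\<close> are the identity, the classes of powers \<open>a\<^sup>s \<noteq> 1\<close> and the classes of powers
  \<open>b\<^sup>k \<noteq> 1\<close>, which are the cosets \<open>\<langle>a\<rangle> b\<^sup>k\<close>. The twist of a simple object is \<open>1\<close> on the identity, a \<open>q\<close>-th
  root of unity on a class of the second kind, and a \<open>p\<^sup>2\<close>-th root of unity on a class of the third;
  more precisely \<open>T\<^sup>p = \<xi>\<^bsup>u k\<^sup>2\<^esup>\<close> on the class of \<open>b\<^sup>k\<close>, where \<open>\<xi> = exp (2 \<pi> \<i> / p)\<close>
  (\<open>T_power_b\<close>). Since \<open>p\<^sup>2\<close> and \<open>q\<close> are coprime, a twist different from \<open>1\<close> reveals the kind of the class.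
  So \<open>T\<close> determines \<open>u k\<^sup>2\<close> modulo \<open>p\<close>, and it remains to find \<open>k\<close> up to sign. This is what \<open>B\<close> does.

  Let \<open>U\<close> be simple with support \<open>{a\<^bsup>s n\<^sup>i\<^esup> | i < p}\<close> and twist \<open>\<tau> \<noteq> 1\<close>, and let \<open>W\<close> be simple with
  support \<open>\<langle>a\<rangle> b\<^sup>k\<close>. In \<open>B\<^bsub>U,U,W\<^esub>\<close> all associators are trivial, for \<open>\<omega>\<close> is inflated from \<open>G / \<langle>a\<rangle>\<close>
  and normalized. The braid fixes the degrees \<open>(x, y, z)\<close>, and the trace is the sum over them of the
  eigenvalues of the commutators \<open>[y, z]\<close> on \<open>U\<^sub>x\<close> and \<open>[x, z\<inverse>]\<close> on \<open>U\<^sub>y\<close>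
  (\<open>B_tensor_commutators\<close>). On the component of degree \<open>x\<close> the element \<open>x\<close> acts by the twist, hence
  \<open>x\<^sup>m\<close> acts by \<open>\<tau>\<^sup>m\<close>; thus \<open>B\<close> depends on \<open>U\<close> through \<open>\<tau>\<close> alone (\<open>B_tensor_aab\<close>):
  \<open>B\<^bsub>U,U,W\<^esub> = q \<Sum>\<^bsub>i,j\<^esub> \<tau>\<^bsup>n\<^bsup>j-i\<^esup>(1 - n\<^sup>k) + n\<^bsup>i-j\<^esup>(1 - n\<^bsup>-k\<^esup>)\<^esup>\<close>.

  Every \<open>\<tau> = \<zeta>\<^sup>r\<close> with \<open>0 < r < q\<close> occurs, so by Fourier inversion on \<open>\<int>/q\<close> the multiset of exponents is
  determined. The sum of their squares is \<open>2 p\<^sup>2 (2 - n\<^sup>k - n\<^bsup>-k\<^esup>)\<close> modulo \<open>q\<close>, because the pure squares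
  run over a nontrivial subgroup and cancel. Hence \<open>n\<^sup>k + n\<^bsup>-k\<^esup>\<close> is known, which gives \<open>n\<^sup>k\<close> up to inversion
  and \<open>k\<close> up to sign. Applied to an object supported on the class of \<open>b\<close> this yields
  \<open>u = u' k\<^sup>2\<close> with \<open>k\<^sup>2 = 1\<close> modulo \<open>p\<close>.\<close>

section \<open>Simple objects of the center\<close>

lemma simple_center_object: "simple_object G \<omega> V \<Longrightarrow> center_object G \<omega> V"
  by (simp add: simple_object_def)

lemma action_one_entry:
  assumes V: "center_object G \<omega> V" and G: "group G" and i: "i < cdim V" and j: "j < cdim V"
  shows "action V \<one>\<^bsub>G\<^esub> $$ (i, j) = (if i = j then 1 else 0)"
proof -
  have one: "\<one>\<^bsub>G\<^esub> \<in> carrier G" using G by (simp add: group.is_monoid monoid.one_closed)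
  have "col (action V \<one>\<^bsub>G\<^esub>) j = unit_vec (cdim V) j"
    using center_objectD(4)[OF V, of "unit_vec (cdim V) j"]
      mat_unit_vec[OF center_objectD(2)[OF V one] j] by simp
  then have "col (action V \<one>\<^bsub>G\<^esub>) j $ i = unit_vec (cdim V) j $ i" by simp
  then show ?thesis using i j center_objectD(2)[OF V one] by auto
qed

text \<open>The \<open>i\<close>-th coordinate only sees the component that \<open>g h\<close> moves to the degree of \<open>i\<close>, so the
  scalar \<open>\<alpha>\<close>, which depends on the degree, can be pulled out for a vector that need not be homogeneous.\<close>

lemma action_mult_vec_entry:
  assumes V: "center_object G \<omega> V" and G: "group G" and g: "g \<in> carrier G" and h: "h \<in> carrier G"
    and w: "w \<in> carrier_vec (cdim V)" and i: "i < cdim V" and k: "k \<in> carrier G"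
    and ik: "degs V ! i = conj_by G (g \<otimes>\<^bsub>G\<^esub> h) k"
  shows "(action V g *\<^sub>v (action V h *\<^sub>v w)) $ i
    = alpha G \<omega> k g h * (action V (g \<otimes>\<^bsub>G\<^esub> h) *\<^sub>v w) $ i"
proof -
  interpret group G by fact
  note A = center_objectD(2)[OF V g] center_objectD(2)[OF V h]
  have gh: "g \<otimes>\<^bsub>G\<^esub> h \<in> carrier G" using g h by simp
  note A' = center_objectD(2)[OF V gh]
  have inj: "l = k" if "l \<in> carrier G" "conj_by G (g \<otimes>\<^bsub>G\<^esub> h) l = conj_by G (g \<otimes>\<^bsub>G\<^esub> h) k" for l
    using that gh k by (simp add: conj_by_def)
  have "(action V g *\<^sub>v (action V h *\<^sub>v w)) $ i = ((action V g * action V h) *\<^sub>v w) $ i"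
    using A w by simp
  also have "\<dots> = (\<Sum>j<cdim V. (action V g * action V h) $$ (i, j) * w $ j)"
    by (rule mat_vec_entry[OF mult_carrier_mat[OF A] w i])
  also have "\<dots> = (\<Sum>j<cdim V. alpha G \<omega> k g h * (action V (g \<otimes>\<^bsub>G\<^esub> h) $$ (i, j) * w $ j))"
  proof (intro sum.cong refl)
    fix j assume "j \<in> {..<cdim V}"
    then have j: "j < cdim V" by simp
    show "(action V g * action V h) $$ (i, j) * w $ j
      = alpha G \<omega> k g h * (action V (g \<otimes>\<^bsub>G\<^esub> h) $$ (i, j) * w $ j)"
    proof (cases "action V (g \<otimes>\<^bsub>G\<^esub> h) $$ (i, j) = 0")
      case True
      then show ?thesis by (simp add: action_mult_entry[OF V g h gh i j])
    next
      case False
      then have "degs V ! j = k"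
        using center_objectD(3)[OF V gh i j False] ik inj[OF center_objectD(1)[OF V j]] by simp
      then show ?thesis by (simp add: action_mult_entry[OF V g h gh i j])
    qed
  qed
  also have "\<dots> = alpha G \<omega> k g h * (action V (g \<otimes>\<^bsub>G\<^esub> h) *\<^sub>v w) $ i"
    by (simp add: mat_vec_entry[OF A' w i] sum_distrib_left)
  finally show ?thesis .
qed

text \<open>The vectors all of whose translates have vanishing \<open>i\<close>-th coordinate form a subobject that
  misses the \<open>i\<close>-th basis vector, hence is zero. Applied to the \<open>j\<close>-th basis vector this says that
  the group moves any coordinate to any other one; both the support of a simple object and the
  multiplicities of its degrees are read off from this.\<close>

lemma simple_object_transitive:
  assumes G: "group G" and V: "simple_object G \<omega> V" and i: "i < cdim V" and j: "j < cdim V"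
  obtains x where "x \<in> carrier G" "action V x $$ (i, j) \<noteq> 0"
proof (rule ccontr)
  interpret group G by fact
  let ?n = "cdim V"
  note Vc = simple_center_object[OF V]
  note A = center_objectD(2)[OF Vc]
  note witness = that
  assume "\<not> thesis"
  then have zero: "action V x $$ (i, j) = 0" if "x \<in> carrier G" for x using witness that by blast
  define S where "S = {w \<in> carrier_vec ?n. \<forall>x\<in>carrier G. (action V x *\<^sub>v w) $ i = 0}"
  have "subobject_space G V S"
    unfolding subobject_space_def
  proof (intro conjI ballI allI)
    show "S \<subseteq> carrier_vec ?n" by (auto simp: S_def)
    show "0\<^sub>v ?n \<in> S" using i by (auto simp: S_def mat_vec_entry[OF A])
    show "v + w \<in> S" if "v \<in> S" "w \<in> S" for v w
    proof -
      have vw: "v \<in> carrier_vec ?n" "w \<in> carrier_vec ?n" using that by (auto simp: S_def)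
      have "(action V x *\<^sub>v (v + w)) $ i = 0" if x: "x \<in> carrier G" for x
      proof -
        have "dim_vec (action V x *\<^sub>v w) = ?n" using A[OF x] by simp
        then show ?thesis
          using \<open>v \<in> S\<close> \<open>w \<in> S\<close> x i unfolding mult_add_distrib_mat_vec[OF A[OF x] vw]
          by (simp add: S_def del: index_mult_mat_vec)
      qed
      then show ?thesis using vw by (simp add: S_def)
    qed
    show "c \<cdot>\<^sub>v v \<in> S" if "v \<in> S" for v c
    proof -
      have vc: "v \<in> carrier_vec ?n" using that by (simp add: S_def)
      have "(action V x *\<^sub>v (c \<cdot>\<^sub>v v)) $ i = 0" if x: "x \<in> carrier G" for x
      proof -
        have "dim_vec (action V x *\<^sub>v v) = ?n" using A[OF x] by simp
        then show ?thesis
          using \<open>v \<in> S\<close> x i unfolding mult_mat_vec[OF A[OF x] vc]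
          by (simp add: S_def del: index_mult_mat_vec)
      qed
      then show ?thesis using vc by (simp add: S_def)
    qed
    show "component_proj V h v \<in> S" if h: "h \<in> carrier G" and v: "v \<in> S" for h v
    proof -
      have vc: "v \<in> carrier_vec ?n" using v by (simp add: S_def)
      have pc: "component_proj V h v \<in> carrier_vec ?n" by (simp add: component_proj_def)
      have "(action V x *\<^sub>v component_proj V h v) $ i = 0" if x: "x \<in> carrier G" for x
      proof (cases "conj_by G x h = degs V ! i")
        case True
        have "(action V x *\<^sub>v component_proj V h v) $ i = (action V x *\<^sub>v v) $ i"
          unfolding mat_vec_entry[OF A[OF x] pc i] mat_vec_entry[OF A[OF x] vc i]
        proof (intro sum.cong refl)
          fix l assume "l \<in> {..<?n}"
          then have l: "l < ?n" by simp
          have "degs V ! l = h" if "action V x $$ (i, l) \<noteq> 0"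
            using center_objectD(3)[OF Vc x i l that] True x h center_objectD(1)[OF Vc l]
            by (simp add: conj_by_def)
          then show "action V x $$ (i, l) * component_proj V h v $ l = action V x $$ (i, l) * v $ l"
            using l by (auto simp: component_proj_def)
        qed
        then show ?thesis using v x by (simp add: S_def)
      next
        case False
        have "action V x $$ (i, l) * component_proj V h v $ l = 0" if l: "l < ?n" for l
          using center_objectD(3)[OF Vc x i l] False l
          by (cases "action V x $$ (i, l) = 0") (auto simp: component_proj_def)
        then show ?thesis unfolding mat_vec_entry[OF A[OF x] pc i] by (intro sum.neutral) auto
      qed
      then show ?thesis using pc by (simp add: S_def)
    qed
    show "action V g *\<^sub>v v \<in> S" if g: "g \<in> carrier G" and v: "v \<in> S" for g v
    proof -
      have vc: "v \<in> carrier_vec ?n" using v by (simp add: S_def)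
      have "(action V x *\<^sub>v (action V g *\<^sub>v v)) $ i = 0" if x: "x \<in> carrier G" for x
      proof -
        let ?k = "conj_by G (inv\<^bsub>G\<^esub> (x \<otimes>\<^bsub>G\<^esub> g)) (degs V ! i)"
        have xg: "x \<otimes>\<^bsub>G\<^esub> g \<in> carrier G" using x g by simp
        note di = center_objectD(1)[OF Vc i]
        have k: "?k \<in> carrier G" using conj_by_closed[OF G _ di] xg by simp
        have "conj_by G (x \<otimes>\<^bsub>G\<^esub> g) ?k = degs V ! i"
          using conj_by_mult[OF G xg inv_closed[OF xg] di, symmetric] xg di
          by (simp add: r_inv[OF xg]) (simp add: conj_by_def)
        then show ?thesis
          using action_mult_vec_entry[OF Vc G x g vc i k] v xg by (simp add: S_def)
      qed
      then show ?thesis using A[OF g] vc by (simp add: S_def)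
    qed
  qed
  then have S: "S = {0\<^sub>v ?n} \<or> S = carrier_vec ?n" using V by (simp add: simple_object_def)
  have "action V x *\<^sub>v unit_vec ?n j = col (action V x) j" if "x \<in> carrier G" for x
    by (rule mat_unit_vec[OF A[OF that] j])
  then have "unit_vec ?n j \<in> S" using zero A i j by (fastforce simp: S_def)
  moreover have "unit_vec ?n j \<noteq> (0\<^sub>v ?n :: complex vec)"
    using j by (metis index_unit_vec(1) index_zero_vec(1) zero_neq_one)
  ultimately have "S = carrier_vec ?n" using S by auto
  then have "unit_vec ?n i \<in> S" by simp
  then have "(action V \<one>\<^bsub>G\<^esub> *\<^sub>v unit_vec ?n i) $ i = 0" by (simp add: S_def)
  then show False using center_objectD(4)[OF Vc, of "unit_vec ?n i"] i by simp
qed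

lemma simple_degs_conjugate:
  assumes G: "group G" and V: "simple_object G \<omega> V" and "g \<in> set (degs V)" "h \<in> set (degs V)"
  obtains x where "x \<in> carrier G" "h = conj_by G x g"
proof -
  obtain i j where ij: "i < cdim V" "j < cdim V" "degs V ! i = g" "degs V ! j = h"
    using assms(3,4) by (auto simp: in_set_conv_nth)
  obtain x where "x \<in> carrier G" "action V x $$ (j, i) \<noteq> 0"
    using simple_object_transitive[OF G V ij(2,1)] .
  with center_objectD(3)[OF simple_center_object[OF V] this(1) ij(2,1) this(2)] ij that
  show ?thesis by auto
qed

lemma degs_conj_closed:
  assumes G: "group G" and \<omega>: "normalized_3cocycle G \<omega>" and V: "center_object G \<omega> V"
    and g: "g \<in> set (degs V)" and x: "x \<in> carrier G"
  shows "conj_by G x g \<in> set (degs V)"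
proof -
  let ?n = "cdim V"
  obtain j where j: "j < ?n" "degs V ! j = g" using g by (auto simp: in_set_conv_nth)
  note A = center_objectD(2)[OF V x]
  obtain N where N: "N \<in> carrier_mat ?n ?n" "N * action V x = 1\<^sub>m ?n"
    using action_invertible[OF G \<omega> V x] by metis
  have "(\<Sum>i<?n. N $$ (j, i) * action V x $$ (i, j)) = 1"
    using mult_entry[OF N(1) A j(1) j(1)] N(2) j(1) by simp
  then have "(\<Sum>i<?n. N $$ (j, i) * action V x $$ (i, j)) \<noteq> 0" by simp
  then obtain i where "i < ?n" "action V x $$ (i, j) \<noteq> 0"
    by (auto elim: sum.not_neutral_contains_not_neutral)
  then have "degs V ! i = conj_by G x g" using center_objectD(3)[OF V x] j by blast
  then show ?thesis using \<open>i < ?n\<close> nth_mem by metis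
qed

text \<open>On the component of degree \<open>g\<close> the element \<open>g\<close> acts by the twist, a scalar, so each power of
  \<open>g\<close> does too; the product collects the failure of the action to be multiplicative.\<close>

lemma action_pow_entry:
  assumes G: "group G" and \<omega>: "normalized_3cocycle G \<omega>" and V: "simple_object G \<omega> V"
    and i: "i < cdim V" and i': "i' < cdim V" and g: "degs V ! i = g"
  shows "action V (g [^]\<^bsub>G\<^esub> (m::nat)) $$ (i', i)
    = (if i' = i then T_scalar V ^ m / (\<Prod>r<m. alpha G \<omega> g g (g [^]\<^bsub>G\<^esub> r)) else 0)"
  using i'
proof (induction m arbitrary: i')
  interpret group G by fact
  note Vc = simple_center_object[OF V]
  {
    case 0
    then show ?case using action_one_entry[OF Vc G 0 i] by simp
  next
    case (Suc m)
    let ?n = "cdim V" and ?p = "\<lambda>m. \<Prod>r<m. alpha G \<omega> g g (g [^]\<^bsub>G\<^esub> r)"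
    have gc: "g \<in> carrier G" using center_objectD(1)[OF Vc i] g by simp
    note gm = nat_pow_closed[OF gc, of m]
    note A = center_objectD(2)[OF Vc gc] and Am = center_objectD(2)[OF Vc gm]
    have gS: "g \<otimes>\<^bsub>G\<^esub> g [^]\<^bsub>G\<^esub> m = g [^]\<^bsub>G\<^esub> Suc m" using gc by (rule nat_pow_Suc2[symmetric])
    have tw: "action V g $$ (i', i) = (if i' = i then T_scalar V else 0)"
    proof -
      have "action V g $$ (i', i) = twist V $$ (i', i)" using i Suc.prems g by (simp add: twist_def)
      then show ?thesis using twist_scalar[OF G \<omega> V] i Suc.prems by auto
    qed
    have "alpha G \<omega> g g (g [^]\<^bsub>G\<^esub> m) * action V (g [^]\<^bsub>G\<^esub> Suc m) $$ (i', i)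
      = (action V g * action V (g [^]\<^bsub>G\<^esub> m)) $$ (i', i)"
      using action_mult_entry[OF Vc gc gm _ Suc.prems i] gc g by (simp only: gS nat_pow_closed)
    also have "\<dots> = (\<Sum>l<?n. action V g $$ (i', l) * action V (g [^]\<^bsub>G\<^esub> m) $$ (l, i))"
      by (rule mult_entry[OF A Am Suc.prems i])
    also have "\<dots> = (\<Sum>l<?n. if l = i then action V g $$ (i', i) * (T_scalar V ^ m / ?p m) else 0)"
      by (intro sum.cong) (auto simp: Suc.IH)
    also have "\<dots> = (if i' = i then T_scalar V ^ Suc m / ?p m else 0)" using i by (simp add: tw)
    finally have "alpha G \<omega> g g (g [^]\<^bsub>G\<^esub> m) * action V (g [^]\<^bsub>G\<^esub> Suc m) $$ (i', i)
      = (if i' = i then T_scalar V ^ Suc m / ?p m else 0)" .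
    then have "action V (g [^]\<^bsub>G\<^esub> Suc m) $$ (i', i)
      = (if i' = i then T_scalar V ^ Suc m / ?p m else 0) / alpha G \<omega> g g (g [^]\<^bsub>G\<^esub> m)"
      using alpha_nonzero[OF G \<omega> gc gc gm] by (intro eq_divide_imp) (simp_all only: mult.commute not_False_eq_True)
    then show ?case by (simp add: mult.commute)
  }
qed

lemma conj_by_pow:
  assumes G: "group G" and y: "y \<in> carrier G" and g: "g \<in> carrier G"
  shows "conj_by G y g [^]\<^bsub>G\<^esub> (m::nat) = conj_by G y (g [^]\<^bsub>G\<^esub> m)"
proof -
  interpret group G by fact
  show ?thesis
  proof (induction m)
    case 0
    then show ?case using y by (simp add: conj_by_def)
  next
    case (Suc m)
    have "inv\<^bsub>G\<^esub> y \<otimes>\<^bsub>G\<^esub> (y \<otimes>\<^bsub>G\<^esub> z) = z" if "z \<in> carrier G" for z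
      using y that by (simp flip: m_assoc)
    then show ?case using Suc y g by (simp add: conj_by_def m_assoc)
  qed
qed

text \<open>If two coordinates had the same degree \<open>h\<close>, some element would move one to the other; it
  centralizes \<open>h\<close>, so it is a power of \<open>h\<close> and acts diagonally on the component. It suffices to know
  the centralizer of one degree \<open>g\<close>, since all degrees are conjugate.\<close>

lemma simple_degs_distinct:
  assumes G: "group G" and \<omega>: "normalized_3cocycle G \<omega>" and V: "simple_object G \<omega> V"
    and g: "g \<in> set (degs V)"
    and C: "\<And>x. x \<in> carrier G \<Longrightarrow> conj_by G x g = g \<Longrightarrow> \<exists>m::nat. x = g [^]\<^bsub>G\<^esub> m"
  shows "distinct (degs V)"
  unfolding distinct_conv_nth
proof (intro allI impI notI)
  interpret group G by fact
  note Vc = simple_center_object[OF V]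
  fix i j assume i: "i < cdim V" and j: "j < cdim V" and "i \<noteq> j" and ij: "degs V ! i = degs V ! j"
  let ?h = "degs V ! j"
  have hc: "?h \<in> carrier G" using center_objectD(1)[OF Vc j] .
  have gc: "g \<in> carrier G" using g center_objectD(1)[OF Vc] by (auto simp: in_set_conv_nth)
  obtain x where x: "x \<in> carrier G" "action V x $$ (i, j) \<noteq> 0"
    using simple_object_transitive[OF G V i j] .
  obtain y where y: "y \<in> carrier G" "g = conj_by G y ?h"
    using simple_degs_conjugate[OF G V nth_mem[OF j] g] .
  let ?x = "conj_by G y x"
  have xh: "conj_by G x ?h = ?h"
    using center_objectD(3)[OF Vc x(1) i j x(2)] ij by simp
  have "?x \<otimes>\<^bsub>G\<^esub> y = y \<otimes>\<^bsub>G\<^esub> x" using x(1) y(1) by (simp add: conj_by_def m_assoc)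
  then have "conj_by G ?x g = g"
    unfolding y(2) using conj_by_mult[OF G conj_by_closed[OF G y(1) x(1)] y(1) hc]
      conj_by_mult[OF G y(1) x(1) hc] xh by simp
  then obtain m :: nat where "?x = g [^]\<^bsub>G\<^esub> m" using C conj_by_closed[OF G y(1) x(1)] by blast
  then have "conj_by G y x = conj_by G y (?h [^]\<^bsub>G\<^esub> m)" using conj_by_pow[OF G y(1) hc] y(2) by simp
  then have "x = ?h [^]\<^bsub>G\<^esub> m" using x(1) y(1) nat_pow_closed[OF hc] by (simp add: conj_by_def)
  then show False using action_pow_entry[OF G \<omega> V j i refl] x(2) \<open>i \<noteq> j\<close> by simp
qed


section \<open>Monomial objects\<close>

text \<open>There is one basis vector for each degree in \<open>D\<close>; \<open>c g h\<close> is the scalar with which \<open>g\<close> carries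
  the vector of degree \<open>h\<close> to the one of degree \<open>g h g\<inverse>\<close>.\<close>

definition monomial_object ::
    "('g, 'm) monoid_scheme \<Rightarrow> 'g list \<Rightarrow> ('g \<Rightarrow> 'g \<Rightarrow> complex) \<Rightarrow> 'g center_obj" where
  "monomial_object G D c = \<lparr>degs = D, action = (\<lambda>g. mat (length D) (length D)
     (\<lambda>(i, j). if D ! i = conj_by G g (D ! j) then c g (D ! j) else 0))\<rparr>"

lemma degs_monomial_object [simp]: "degs (monomial_object G D c) = D"
  by (simp add: monomial_object_def)

lemma monomial_action_carrier: "action (monomial_object G D c) g \<in> carrier_mat (length D) (length D)"
  by (simp add: monomial_object_def)

lemma monomial_action_entry:
  "i < length D \<Longrightarrow> j < length D \<Longrightarrow> action (monomial_object G D c) g $$ (i, j)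
    = (if D ! i = conj_by G g (D ! j) then c g (D ! j) else 0)"
  by (simp add: monomial_object_def)

lemma monomial_action_vec:
  assumes "group G" "set D \<subseteq> carrier G" "distinct D" "g \<in> carrier G"
    and w: "w \<in> carrier_vec (length D)" and i: "i < length D" and j: "j < length D"
    and ij: "D ! i = conj_by G g (D ! j)"
  shows "(action (monomial_object G D c) g *\<^sub>v w) $ i = c g (D ! j) * w $ j"
proof -
  interpret group G by fact
  have "(action (monomial_object G D c) g *\<^sub>v w) $ i
    = (\<Sum>l<length D. if l = j then c g (D ! j) * w $ j else 0)"
    unfolding mat_vec_entry[OF monomial_action_carrier w i]
  proof (intro sum.cong refl)
    fix l assume "l \<in> {..<length D}"
    then have l: "l < length D" by simp
    have "l = j" if "D ! i = conj_by G g (D ! l)"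
    proof -
      have "D ! l \<in> carrier G" "D ! j \<in> carrier G" using assms(2) l j by auto
      then have "D ! l = D ! j" using ij that assms(4) by (simp add: conj_by_def)
      then show ?thesis using assms(3) l j nth_eq_iff_index_eq by blast
    qed
    then show "action (monomial_object G D c) g $$ (i, l) * w $ l = (if l = j then c g (D ! j) * w $ j else 0)"
      using ij i l by (auto simp: monomial_action_entry)
  qed
  then show ?thesis using j by simp
qed

lemma conj_by_inverse_index:
  assumes G: "group G" and D: "set D \<subseteq> carrier G"
    and closed: "\<And>x h. x \<in> carrier G \<Longrightarrow> h \<in> set D \<Longrightarrow> conj_by G x h \<in> set D"
    and g: "g \<in> carrier G" and i: "i < length D"
  obtains j where "j < length D" "D ! i = conj_by G g (D ! j)"
proof -
  interpret group G by fact
  have Di: "D ! i \<in> set D" "D ! i \<in> carrier G" using D i by auto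
  then have "conj_by G (inv\<^bsub>G\<^esub> g) (D ! i) \<in> set D" using closed g by simp
  then obtain j where j: "j < length D" "D ! j = conj_by G (inv\<^bsub>G\<^esub> g) (D ! i)"
    by (auto simp: in_set_conv_nth)
  have "conj_by G g (D ! j) = conj_by G \<one>\<^bsub>G\<^esub> (D ! i)"
    unfolding j(2) using conj_by_mult[OF G g inv_closed[OF g] Di(2)] g by simp
  also have "\<dots> = D ! i" using Di(2) by (simp add: conj_by_def)
  finally show ?thesis using that j(1) by metis
qed

lemma center_object_monomial:
  assumes G: "group G" and D: "set D \<subseteq> carrier G" and dist: "distinct D"
    and closed: "\<And>x h. x \<in> carrier G \<Longrightarrow> h \<in> set D \<Longrightarrow> conj_by G x h \<in> set D"
    and one: "\<And>h. h \<in> set D \<Longrightarrow> c \<one>\<^bsub>G\<^esub> h = 1"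
    and mult: "\<And>g h k. g \<in> carrier G \<Longrightarrow> h \<in> carrier G \<Longrightarrow> k \<in> set D \<Longrightarrow>
      c g (conj_by G h k) * c h k = alpha G \<omega> k g h * c (g \<otimes>\<^bsub>G\<^esub> h) k"
  shows "center_object G \<omega> (monomial_object G D c)"
  unfolding center_object_def
proof (intro conjI ballI)
  interpret group G by fact
  let ?V = "monomial_object G D c"
  note act = monomial_action_vec[OF G D dist]
  note index = conj_by_inverse_index[OF G D closed]
  have Dc: "D ! i \<in> carrier G" "D ! i \<in> set D" if "i < length D" for i using D that by auto
  have av: "action ?V g *\<^sub>v w \<in> carrier_vec (length D)" for g w
    by (rule carrier_vecI) (simp add: monomial_object_def)
  show "set (degs ?V) \<subseteq> carrier G" using D by simp
  show "action ?V g \<in> carrier_mat (cdim ?V) (cdim ?V)" for g by (simp add: monomial_action_carrier)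
  show "action ?V g *\<^sub>v w \<in> component ?V (conj_by G g k)"
    if g: "g \<in> carrier G" and k: "k \<in> carrier G" and w: "w \<in> component ?V k" for g k w
  proof -
    have wc: "w \<in> carrier_vec (length D)" using w by (simp add: component_def)
    have "D ! i = conj_by G g k" if i: "i < length D" and nz: "(action ?V g *\<^sub>v w) $ i \<noteq> 0" for i
    proof -
      obtain j where j: "j < length D" "D ! i = conj_by G g (D ! j)" using index[OF _ _ g i] by blast
      then have "w $ j \<noteq> 0" using nz act[OF g wc i j] by auto
      then have "D ! j = k" using w j(1) by (simp add: component_def)
      then show ?thesis using j(2) by simp
    qed
    then show ?thesis using av by (simp add: component_def)
  qed
  show "action ?V \<one>\<^bsub>G\<^esub> *\<^sub>v w = w" if w: "w \<in> carrier_vec (cdim ?V)" for w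
  proof (rule eq_vecI)
    fix i assume "i < dim_vec w"
    then have i: "i < length D" using w by simp
    have "D ! i = conj_by G \<one>\<^bsub>G\<^esub> (D ! i)" using Dc(1)[OF i] by (simp add: conj_by_def)
    then show "(action ?V \<one>\<^bsub>G\<^esub> *\<^sub>v w) $ i = w $ i"
      using act[OF one_closed _ i i] w one Dc(2)[OF i] by simp
  qed (use w in \<open>auto simp: monomial_object_def\<close>)
  show "action ?V g *\<^sub>v (action ?V h *\<^sub>v w) = alpha G \<omega> k g h \<cdot>\<^sub>v (action ?V (g \<otimes>\<^bsub>G\<^esub> h) *\<^sub>v w)"
    if g: "g \<in> carrier G" and h: "h \<in> carrier G" and k: "k \<in> carrier G" and w: "w \<in> component ?V k"
    for g h k w
  proof (rule eq_vecI)
    have wc: "w \<in> carrier_vec (length D)" using w by (simp add: component_def)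
    fix i assume "i < dim_vec (alpha G \<omega> k g h \<cdot>\<^sub>v (action ?V (g \<otimes>\<^bsub>G\<^esub> h) *\<^sub>v w))"
    then have i: "i < length D" by (simp add: monomial_object_def)
    obtain j where j: "j < length D" "D ! i = conj_by G g (D ! j)" using index[OF _ _ g i] by blast
    obtain l where l: "l < length D" "D ! j = conj_by G h (D ! l)" using index[OF _ _ h j(1)] by blast
    have il: "D ! i = conj_by G (g \<otimes>\<^bsub>G\<^esub> h) (D ! l)"
      unfolding j(2) l(2) by (rule conj_by_mult[OF G g h Dc(1)[OF l(1)], symmetric])
    have "(action ?V g *\<^sub>v (action ?V h *\<^sub>v w)) $ i = c g (D ! j) * (c h (D ! l) * w $ l)"
      using act[OF g av i j] act[OF h wc j(1) l] by simp
    also have "\<dots> = alpha G \<omega> (D ! l) g h * c (g \<otimes>\<^bsub>G\<^esub> h) (D ! l) * w $ l"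
      using mult[OF g h Dc(2)[OF l(1)]] l(2) by (simp flip: mult.assoc)
    also have "\<dots> = alpha G \<omega> k g h * c (g \<otimes>\<^bsub>G\<^esub> h) (D ! l) * w $ l"
      using w l(1) by (cases "w $ l = 0") (auto simp: component_def)
    also have "\<dots> = (alpha G \<omega> k g h \<cdot>\<^sub>v (action ?V (g \<otimes>\<^bsub>G\<^esub> h) *\<^sub>v w)) $ i"
      using act[OF m_closed[OF g h] wc i l(1) il] i by (simp add: monomial_object_def)
    finally show "(action ?V g *\<^sub>v (action ?V h *\<^sub>v w)) $ i
      = (alpha G \<omega> k g h \<cdot>\<^sub>v (action ?V (g \<otimes>\<^bsub>G\<^esub> h) *\<^sub>v w)) $ i" .
  qed (simp add: monomial_object_def)
qed

text \<open>A nonzero subobject contains a homogeneous vector, that is, a multiple of a basis vector, and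
  the action carries it to every other basis vector.\<close>

lemma simple_object_monomial:
  assumes G: "group G" and D: "set D \<subseteq> carrier G" "D \<noteq> []" and dist: "distinct D"
    and V: "center_object G \<omega> (monomial_object G D c)"
    and nz: "\<And>g h. g \<in> carrier G \<Longrightarrow> h \<in> set D \<Longrightarrow> c g h \<noteq> 0"
    and trans: "\<And>h k. h \<in> set D \<Longrightarrow> k \<in> set D \<Longrightarrow> \<exists>x\<in>carrier G. k = conj_by G x h"
  shows "simple_object G \<omega> (monomial_object G D c)"
proof -
  let ?V = "monomial_object G D c" and ?n = "length D"
  have "S = carrier_vec ?n" if S: "subobject_space G ?V S" and S0: "S \<noteq> {0\<^sub>v ?n}" for S
  proof -
    have Sc: "S \<subseteq> carrier_vec ?n" and Sz: "0\<^sub>v ?n \<in> S" and Sa: "\<And>v w. v \<in> S \<Longrightarrow> w \<in> S \<Longrightarrow> v + w \<in> S"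
      and Ss: "\<And>v a. v \<in> S \<Longrightarrow> a \<cdot>\<^sub>v v \<in> S"
      and Sp: "\<And>v h. h \<in> carrier G \<Longrightarrow> v \<in> S \<Longrightarrow> component_proj ?V h v \<in> S"
      and Sg: "\<And>v g. g \<in> carrier G \<Longrightarrow> v \<in> S \<Longrightarrow> action ?V g *\<^sub>v v \<in> S"
      using S by (auto simp: subobject_space_def)
    obtain v where v: "v \<in> S" "v \<noteq> 0\<^sub>v ?n" using S0 Sz by blast
    have vc: "v \<in> carrier_vec ?n" using v(1) Sc by blast
    have "\<exists>j<?n. v $ j \<noteq> 0"
    proof (rule ccontr)
      assume "\<not> ?thesis"
      then have "v = 0\<^sub>v ?n" using vc by (intro eq_vecI) auto
      then show False using v(2) by simp
    qed
    then obtain j where j: "j < ?n" "v $ j \<noteq> 0" by blast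
    have Dj: "D ! j \<in> set D" "D ! j \<in> carrier G" using j D by auto
    have "component_proj ?V (D ! j) v = v $ j \<cdot>\<^sub>v unit_vec ?n j"
      using j nth_eq_iff_index_eq[OF dist] by (intro eq_vecI) (auto simp: component_proj_def unit_vec_def)
    then have "v $ j \<cdot>\<^sub>v unit_vec ?n j \<in> S" using Sp[OF Dj(2) v(1)] by simp
    from Ss[OF this, of "inverse (v $ j)"] have ej: "unit_vec ?n j \<in> S"
      using j by (simp add: smult_smult_assoc)
    have ei: "unit_vec ?n i \<in> S" if i: "i < ?n" for i
    proof -
      obtain x where x: "x \<in> carrier G" "D ! i = conj_by G x (D ! j)"
        using trans[OF Dj(1), of "D ! i"] i by auto
      have "action ?V x *\<^sub>v unit_vec ?n j = c x (D ! j) \<cdot>\<^sub>v unit_vec ?n i"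
      proof (rule eq_vecI)
        fix l assume "l < dim_vec (c x (D ! j) \<cdot>\<^sub>v unit_vec ?n i)"
        then have l: "l < ?n" by simp
        have "(action ?V x *\<^sub>v unit_vec ?n j) $ l = action ?V x $$ (l, j)"
          using mat_unit_vec[OF monomial_action_carrier j(1), of G c x] l j monomial_action_carrier[of G D c x]
          by simp
        then show "(action ?V x *\<^sub>v unit_vec ?n j) $ l = (c x (D ! j) \<cdot>\<^sub>v unit_vec ?n i) $ l"
          using l i j x nth_eq_iff_index_eq[OF dist, of l i] by (simp add: monomial_action_entry)
      qed (simp add: monomial_object_def)
      then have "c x (D ! j) \<cdot>\<^sub>v unit_vec ?n i \<in> S" using Sg[OF x(1) ej] by simp
      from Ss[OF this, of "inverse (c x (D ! j))"] show ?thesis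
        using nz[OF x(1) Dj(1)] by (simp add: smult_smult_assoc)
    qed
    have "w \<in> S" if w: "w \<in> carrier_vec ?n" for w
    proof -
      have "vec ?n (\<lambda>i. if i < m then w $ i else 0) \<in> S" if "m \<le> ?n" for m
        using that
      proof (induction m)
        case 0
        have "vec ?n (\<lambda>i. 0) = (0\<^sub>v ?n :: complex vec)" by (intro eq_vecI) auto
        then show ?case using Sz by simp
      next
        case (Suc m)
        have "vec ?n (\<lambda>i. if i < Suc m then w $ i else 0)
          = vec ?n (\<lambda>i. if i < m then w $ i else 0) + w $ m \<cdot>\<^sub>v unit_vec ?n m"
          using Suc.prems by (intro eq_vecI) (auto simp: less_Suc_eq)
        then show ?case using Sa Ss[OF ei] Suc by simp
      qed
      moreover have "vec ?n (\<lambda>i. if i < ?n then w $ i else 0) = w" using w by (intro eq_vecI) auto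
      ultimately show ?thesis by (metis order_refl)
    qed
    with Sc show ?thesis by blast
  qed
  then show ?thesis using V D(2) by (auto simp: simple_object_def)
qed

lemma T_scalar_monomial:
  assumes G: "group G" and \<omega>: "normalized_3cocycle G \<omega>" and V: "simple_object G \<omega> (monomial_object G D c)"
    and h: "h \<in> set D"
  shows "T_scalar (monomial_object G D c) = c h h"
proof -
  interpret group G by fact
  let ?V = "monomial_object G D c"
  obtain i where i: "i < length D" "D ! i = h" using h by (auto simp: in_set_conv_nth)
  have hc: "h \<in> carrier G" using center_objectD(1)[OF simple_center_object[OF V]] i by auto
  have "T_scalar ?V = twist ?V $$ (i, i)" using twist_scalar[OF G \<omega> V] i by simp
  also have "\<dots> = c h h" using i hc by (simp add: twist_def monomial_action_entry conj_by_def m_assoc)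
  finally show ?thesis .
qed

section \<open>The braid on objects with trivial associators\<close>

lemma triple_less:
  assumes "i < a" "j < b" "k < c"
  shows "(i * b + j) * c + k < a * b * (c::nat)"
  by (intro pair_index_less assms)

lemma triple_index:
  assumes "x < a * b * (c::nat)"
  obtains i j k where "i < a" "j < b" "k < c" "x = (i * b + j) * c + k"
proof
  show "x div c div b < a" "x div c mod b < b" "x mod c < c"
    using div_mod_less[OF assms] div_mod_less[of "x div c" a b] by auto
  show "x = (x div c div b * b + x div c mod b) * c + x mod c" by simp
qed

lemma sum_triple:
  fixes f :: "nat \<Rightarrow> complex"
  shows "(\<Sum>x<a * b * c. f x) = (\<Sum>i<a. \<Sum>j<b. \<Sum>k<c. f ((i * b + j) * c + k))"
proof -
  have "(\<Sum>x<a * b * c. f x) = (\<Sum>x<a * b. \<Sum>k<c. f (x * c + k))"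
    using sum_pair_index[of "\<lambda>x k. f (x * c + k)" c "a * b"] by simp
  also have "\<dots> = (\<Sum>i<a. \<Sum>j<b. \<Sum>k<c. f ((i * b + j) * c + k))"
    using sum_pair_index[of "\<lambda>i j. \<Sum>k<c. f ((i * b + j) * c + k)" b a] by simp
  finally show ?thesis .
qed

lemma sum_if_const:
  "(\<Sum>x\<in>A. if P then f x else (0 :: 'a :: comm_monoid_add)) = (if P then \<Sum>x\<in>A. f x else 0)"
  by simp

lemma associator_trivial:
  assumes "\<And>x y z. x \<in> set (degs U) \<Longrightarrow> y \<in> set (degs V) \<Longrightarrow> z \<in> set (degs W) \<Longrightarrow> \<omega> x y z = 1"
  shows "associator \<omega> U V W = 1\<^sub>m (cdim U * cdim V * cdim W)"
proof (rule eq_matI)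
  fix r s assume "r < dim_row (1\<^sub>m (cdim U * cdim V * cdim W) :: complex mat)"
    "s < dim_col (1\<^sub>m (cdim U * cdim V * cdim W) :: complex mat)"
  then have rs: "r < cdim U * cdim V * cdim W" "s < cdim U * cdim V * cdim W" by auto
  show "associator \<omega> U V W $$ (r, s) = (1\<^sub>m (cdim U * cdim V * cdim W) :: complex mat) $$ (r, s)"
    using rs div_mod_less[OF rs(2)] div_mod_less[of "s div cdim W" "cdim U" "cdim V"]
    by (auto simp: associator_def assms)
qed (auto simp: associator_def)

lemma braid_sigma1_entry:
  assumes "i < cdim U" "j < cdim V" "k < cdim W" "i' < cdim U" "j' < cdim V" "k' < cdim W"
  shows "braid_sigma1 U V W $$ ((j' * cdim U + i') * cdim W + k', (i * cdim V + j) * cdim W + k)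
    = (if i' = i \<and> k' = k then action V (degs U ! i) $$ (j', j) else 0)"
proof -
  have "braid_sigma1 U V W $$ ((j' * cdim U + i') * cdim W + k', (i * cdim V + j) * cdim W + k)
    = braiding U V $$ (j' * cdim U + i', i * cdim V + j) * 1\<^sub>m (cdim W) $$ (k', k)"
    unfolding braid_sigma1_def using assms
    by (subst kron_entry[OF braiding_carrier one_carrier_mat]) (auto intro: triple_less simp: pair_index_div)
  then show ?thesis
    using assms by (simp add: braiding_entry pair_index_less pair_index_div)
qed

lemma id_braiding_entry:
  assumes "i < cdim U" "j < cdim V" "k < cdim W" "i' < cdim U" "j' < cdim V" "k' < cdim W"
  shows "kron (1\<^sub>m (cdim U)) (braiding V W)
      $$ ((i' * cdim W + k') * cdim V + j', (i * cdim V + j) * cdim W + k)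
    = (if i' = i \<and> j' = j then action W (degs V ! j) $$ (k', k) else 0)"
proof -
  have e: "(i' * cdim W + k') * cdim V + j' = i' * (cdim W * cdim V) + (k' * cdim V + j')"
    "(i * cdim V + j) * cdim W + k = i * (cdim V * cdim W) + (j * cdim W + k)"
    by (simp_all add: algebra_simps)
  have l: "k' * cdim V + j' < cdim W * cdim V" "j * cdim W + k < cdim V * cdim W"
    using assms by (simp_all add: pair_index_less)
  have "kron (1\<^sub>m (cdim U)) (braiding V W)
      $$ ((i' * cdim W + k') * cdim V + j', (i * cdim V + j) * cdim W + k)
    = 1\<^sub>m (cdim U) $$ (i', i) * braiding V W $$ (k' * cdim V + j', j * cdim W + k)"
    unfolding e using assms l
    by (subst kron_entry[OF one_carrier_mat braiding_carrier])
       (auto simp: pair_index_less pair_index_div[OF l(1)] pair_index_div[OF l(2)])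
  then show ?thesis using assms l by (simp add: braiding_entry pair_index_div)
qed

lemma braid_sigma2_strict:
  assumes "associator \<omega> U V W = 1\<^sub>m (cdim U * cdim V * cdim W)"
    and "associator \<omega> U W V = 1\<^sub>m (cdim U * cdim W * cdim V)"
  shows "braid_sigma2 \<omega> U V W = kron (1\<^sub>m (cdim U)) (braiding V W)"
proof -
  let ?n = "cdim U * cdim V * cdim W" and ?m = "cdim U * cdim W * cdim V"
  have k: "kron (1\<^sub>m (cdim U)) (braiding V W) \<in> carrier_mat ?m ?n"
    using kron_carrier[OF one_carrier_mat[of "cdim U"] braiding_carrier[of V W]] by (simp add: mult.assoc)
  have "minv (1\<^sub>m ?n) = 1\<^sub>m ?n" by (rule minv_props(1)[of _ ?n]) auto
  then show ?thesis unfolding braid_sigma2_def assms using k by simp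
qed

text \<open>The candidate for \<open>\<sigma>\<^sub>2\<inverse> \<sigma>\<^sub>1\<close>, which sends \<open>u \<otimes> v \<otimes> w\<close> to
  \<open>(|u| \<triangleright> v) \<otimes> w \<otimes> (|w| \<triangleright>)\<inverse> u\<close>, is recognized from \<open>\<sigma>\<^sub>2\<close> applied to it; so the inverse of
  the braiding need not be computed.\<close>

lemma braid_step_entry:
  assumes G: "group G" and \<omega>: "normalized_3cocycle G \<omega>"
    and U: "center_object G \<omega> U" and V: "center_object G \<omega> V" and W: "center_object G \<omega> W"
    and a1: "associator \<omega> V W U = 1\<^sub>m (cdim V * cdim W * cdim U)"
    and a2: "associator \<omega> V U W = 1\<^sub>m (cdim V * cdim U * cdim W)"
    and ijk: "i < cdim U" "j < cdim V" "k < cdim W" "i' < cdim U" "j' < cdim V" "k' < cdim W"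
  shows "braid_step \<omega> U V W $$ ((j' * cdim W + k') * cdim U + i', (i * cdim V + j) * cdim W + k)
    = (if k' = k then action V (degs U ! i) $$ (j', j) * minv (action U (degs W ! k)) $$ (i', i) else 0)"
proof -
  let ?a = "cdim U" and ?b = "cdim V" and ?c = "cdim W"
  define S where "S = mat (?b * ?c * ?a) (?a * ?b * ?c) (\<lambda>(r, s).
    if r div ?a mod ?c = s mod ?c
    then action V (degs U ! (s div ?c div ?b)) $$ (r div ?a div ?c, s div ?c mod ?b)
      * minv (action U (degs W ! (s mod ?c))) $$ (r mod ?a, s div ?c div ?b) else 0)"
  have S: "S \<in> carrier_mat (?b * ?c * ?a) (?a * ?b * ?c)" by (simp add: S_def)
  have S_entry: "S $$ ((j' * ?c + k') * ?a + i', (i * ?b + j) * ?c + k)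
    = (if k' = k then action V (degs U ! i) $$ (j', j) * minv (action U (degs W ! k)) $$ (i', i) else 0)"
    if "i < ?a" "j < ?b" "k < ?c" "i' < ?a" "j' < ?b" "k' < ?c" for i j k i' j' k'
    using that triple_less[of i ?a j ?b k ?c] triple_less[of j' ?b k' ?c i' ?a]
    by (simp add: S_def pair_index_div)
  let ?s1 = "braid_sigma1 U V W" and ?s2 = "braid_sigma2 \<omega> V W U"
  note s1 = is_inv_mat_minv(1)[OF is_inv_sigma1[OF G \<omega> U V, of W]]
  note s2 = is_inv_mat_minv[OF is_inv_sigma2[OF G \<omega> V W U]]
  have "?s2 * S = ?s1"
  proof (rule eq_matI)
    fix r s assume "r < dim_row ?s1" "s < dim_col ?s1"
    then have rl: "r < ?b * ?a * ?c" and sl: "s < ?a * ?b * ?c" using s1 by auto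
    obtain i j k where s: "i < ?a" "j < ?b" "k < ?c" "s = (i * ?b + j) * ?c + k"
      using triple_index[OF sl] .
    obtain j1 i1 k1 where r: "j1 < ?b" "i1 < ?a" "k1 < ?c" "r = (j1 * ?a + i1) * ?c + k1"
      using triple_index[OF rl] .
    have dW: "degs W ! k \<in> carrier G" using center_objectD(1)[OF W s(3)] .
    obtain N where "N \<in> carrier_mat ?a ?a" "action U (degs W ! k) * N = 1\<^sub>m ?a"
      using action_invertible[OF G \<omega> U dW] by metis
    note N = this minv_props(1)[OF center_objectD(2)[OF U dW] this]
    have "(?s2 * S) $$ (r, s) = (\<Sum>j2<?b. \<Sum>k2<?c. \<Sum>i2<?a.
        ?s2 $$ (r, (j2 * ?c + k2) * ?a + i2) * S $$ ((j2 * ?c + k2) * ?a + i2, s))"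
      unfolding mult_entry[OF s2(1) S rl sl] by (rule sum_triple)
    also have "\<dots> = (\<Sum>j2<?b. \<Sum>k2<?c. \<Sum>i2<?a. if j2 = j1 then if k2 = k1 then
        action U (degs W ! k1) $$ (i1, i2) * S $$ ((j1 * ?c + k1) * ?a + i2, s) else 0 else 0)"
      unfolding r(4) braid_sigma2_strict[OF a1 a2]
      using r(1-3) by (intro sum.cong refl) (auto simp: id_braiding_entry)
    also have "\<dots> = (\<Sum>i2<?a. action U (degs W ! k1) $$ (i1, i2) * S $$ ((j1 * ?c + k1) * ?a + i2, s))"
      using r(1,3) by (simp add: sum_if_const)
    also have "\<dots> = (\<Sum>i2<?a. if k1 = k then action V (degs U ! i) $$ (j1, j)
        * (action U (degs W ! k) $$ (i1, i2) * N $$ (i2, i)) else 0)"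
      unfolding s(4) using r s(1-3) N(3) by (intro sum.cong) (auto simp: S_entry)
    also have "\<dots> = (if k1 = k then action V (degs U ! i) $$ (j1, j)
        * (action U (degs W ! k) * N) $$ (i1, i) else 0)"
      using mult_entry[OF center_objectD(2)[OF U dW] N(1) r(2) s(1)] by (simp add: sum_distrib_left)
    also have "\<dots> = ?s1 $$ (r, s)"
      unfolding N(2) r(4) s(4) using r s by (simp add: braid_sigma1_entry)
    finally show "(?s2 * S) $$ (r, s) = ?s1 $$ (r, s)" .
  qed (use s1 s2 S in auto)
  then have "braid_step \<omega> U V W = minv ?s2 * (?s2 * S)" by (simp add: braid_step_def)
  also have "\<dots> = S" using assoc_mult_mat[OF s2(2,1) S] s2(4) S by simp
  finally show ?thesis using S_entry[OF ijk] by simp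
qed

text \<open>The operator is
  \<open>u \<otimes> v \<otimes> w \<mapsto> (z\<^sub>1 \<triangleright>) (z \<triangleright>)\<inverse> u \<otimes> (x\<^sub>1 \<triangleright>)\<inverse> (x \<triangleright>) v \<otimes> (y\<^sub>2 \<triangleright>)\<inverse> (y\<^sub>1 \<triangleright>) w\<close>, where \<open>x, y, z\<close> are the
  degrees of \<open>u, v, w\<close> and each strand meets the others in the degree that it has after the
  preceding crossings.\<close>

lemma B_tensor_strict:
  assumes G: "group G" and \<omega>: "normalized_3cocycle G \<omega>"
    and U: "center_object G \<omega> U" and V: "center_object G \<omega> V" and W: "center_object G \<omega> W"
    and strict: "\<And>x y z. x \<in> set (degs U) \<Longrightarrow> y \<in> set (degs V) \<Longrightarrow> z \<in> set (degs W) \<Longrightarrow>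
      \<omega> x y z = 1 \<and> \<omega> x z y = 1 \<and> \<omega> y x z = 1 \<and> \<omega> y z x = 1 \<and> \<omega> z x y = 1 \<and> \<omega> z y x = 1"
  shows "B_tensor \<omega> U V W = (\<Sum>i<cdim U. \<Sum>j<cdim V. \<Sum>k<cdim W. \<Sum>j1<cdim V. \<Sum>i1<cdim U. \<Sum>k2<cdim W.
    action V (degs U ! i) $$ (j1, j) * minv (action V (degs U ! i1)) $$ (j, j1)
    * (action W (degs V ! j1) $$ (k2, k) * minv (action W (degs V ! j)) $$ (k, k2))
    * (action U (degs W ! k2) $$ (i, i1) * minv (action U (degs W ! k)) $$ (i1, i)))"
proof -
  let ?a = "cdim U" and ?b = "cdim V" and ?c = "cdim W"
  have assoc: "associator \<omega> U V W = 1\<^sub>m (?a * ?b * ?c)" "associator \<omega> U W V = 1\<^sub>m (?a * ?c * ?b)"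
    "associator \<omega> V U W = 1\<^sub>m (?b * ?a * ?c)" "associator \<omega> V W U = 1\<^sub>m (?b * ?c * ?a)"
    "associator \<omega> W U V = 1\<^sub>m (?c * ?a * ?b)" "associator \<omega> W V U = 1\<^sub>m (?c * ?b * ?a)"
    by (rule associator_trivial, use strict in blast)+
  let ?s1 = "braid_step \<omega> U V W" and ?s2 = "braid_step \<omega> V W U" and ?s3 = "braid_step \<omega> W U V"
  note e1 = braid_step_entry[OF G \<omega> U V W assoc(4,3)]
  note e2 = braid_step_entry[OF G \<omega> V W U assoc(5,6)]
  note e3 = braid_step_entry[OF G \<omega> W U V assoc(1,2)]
  note c1 = is_inv_mat_minv(1)[OF is_inv_step[OF G \<omega> U V W]]
  note c2 = is_inv_mat_minv(1)[OF is_inv_step[OF G \<omega> V W U]]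
  note c3 = is_inv_mat_minv(1)[OF is_inv_step[OF G \<omega> W U V]]
  note c32 = mult_carrier_mat[OF c3 c2]
  have entry: "(?s3 * ?s2 * ?s1) $$ (x, x)
    = (\<Sum>j1<?b. \<Sum>i1<?a. \<Sum>k2<?c.
    action V (degs U ! i) $$ (j1, j) * minv (action V (degs U ! i1)) $$ (j, j1)
    * (action W (degs V ! j1) $$ (k2, k) * minv (action W (degs V ! j)) $$ (k, k2))
    * (action U (degs W ! k2) $$ (i, i1) * minv (action U (degs W ! k)) $$ (i1, i)))"
    if ijk: "i < ?a" "j < ?b" "k < ?c" and x: "x = (i * ?b + j) * ?c + k" for x i j k
  proof -
    have xl: "x < ?a * ?b * ?c" unfolding x by (rule triple_less[OF ijk])
    have s32: "(?s3 * ?s2) $$ (x, (j1 * ?c + k1) * ?a + i1)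
      = (\<Sum>k2<?c. action W (degs V ! j1) $$ (k2, k1) * minv (action V (degs U ! i1)) $$ (j, j1)
          * (action U (degs W ! k2) $$ (i, i1) * minv (action W (degs V ! j)) $$ (k, k2)))"
      if l: "j1 < ?b" "k1 < ?c" "i1 < ?a" for j1 k1 i1
    proof -
      have "(?s3 * ?s2) $$ (x, (j1 * ?c + k1) * ?a + i1) = (\<Sum>k2<?c. \<Sum>i2<?a. \<Sum>j2<?b.
          ?s3 $$ (x, (k2 * ?a + i2) * ?b + j2) * ?s2 $$ ((k2 * ?a + i2) * ?b + j2, (j1 * ?c + k1) * ?a + i1))"
        unfolding mult_entry[OF c3 c2 xl triple_less[OF l]] by (rule sum_triple)
      also have "\<dots> = (\<Sum>k2<?c. \<Sum>i2<?a. \<Sum>j2<?b. if i2 = i1 then if j2 = j then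
          action W (degs V ! j1) $$ (k2, k1) * minv (action V (degs U ! i1)) $$ (j, j1)
          * (action U (degs W ! k2) $$ (i, i1) * minv (action W (degs V ! j)) $$ (k, k2)) else 0 else 0)"
        unfolding x using ijk l by (intro sum.cong refl) (auto simp: e2 e3)
      finally show ?thesis using ijk l by (simp add: sum_if_const)
    qed
    have "(?s3 * ?s2 * ?s1) $$ (x, x) = (\<Sum>j1<?b. \<Sum>k1<?c. \<Sum>i1<?a.
        (?s3 * ?s2) $$ (x, (j1 * ?c + k1) * ?a + i1) * ?s1 $$ ((j1 * ?c + k1) * ?a + i1, x))"
      unfolding mult_entry[OF c32 c1 xl xl] by (rule sum_triple)
    also have "\<dots> = (\<Sum>j1<?b. \<Sum>k1<?c. if k1 = k then \<Sum>i1<?a. \<Sum>k2<?c.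
        action V (degs U ! i) $$ (j1, j) * minv (action V (degs U ! i1)) $$ (j, j1)
        * (action W (degs V ! j1) $$ (k2, k) * minv (action W (degs V ! j)) $$ (k, k2))
        * (action U (degs W ! k2) $$ (i, i1) * minv (action U (degs W ! k)) $$ (i1, i)) else 0)"
    proof (intro sum.cong refl)
      fix j1 k1 assume "j1 \<in> {..<?b}" "k1 \<in> {..<?c}"
      then have l: "j1 < ?b" "k1 < ?c" by auto
      show "(\<Sum>i1<?a. (?s3 * ?s2) $$ (x, (j1 * ?c + k1) * ?a + i1) * ?s1 $$ ((j1 * ?c + k1) * ?a + i1, x))
        = (if k1 = k then \<Sum>i1<?a. \<Sum>k2<?c.
        action V (degs U ! i) $$ (j1, j) * minv (action V (degs U ! i1)) $$ (j, j1)
        * (action W (degs V ! j1) $$ (k2, k) * minv (action W (degs V ! j)) $$ (k, k2))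
        * (action U (degs W ! k2) $$ (i, i1) * minv (action U (degs W ! k)) $$ (i1, i)) else 0)"
      proof (cases "k1 = k")
        case True
        have "(?s3 * ?s2) $$ (x, (j1 * ?c + k1) * ?a + i1) * ?s1 $$ ((j1 * ?c + k1) * ?a + i1, x)
          = (\<Sum>k2<?c. action V (degs U ! i) $$ (j1, j) * minv (action V (degs U ! i1)) $$ (j, j1)
        * (action W (degs V ! j1) $$ (k2, k) * minv (action W (degs V ! j)) $$ (k, k2))
        * (action U (degs W ! k2) $$ (i, i1) * minv (action U (degs W ! k)) $$ (i1, i)))"
          if "i1 < ?a" for i1
          unfolding s32[OF l that] unfolding x
          using e1[OF ijk that l] True by (simp add: sum_distrib_left sum_distrib_right mult_ac)
        then show ?thesis using True by simp
      next
        case False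
        then show ?thesis unfolding x using e1[OF ijk _ l] by (simp add: sum.neutral)
      qed
    qed
    finally show ?thesis using ijk by simp
  qed
  have "B_tensor \<omega> U V W = (\<Sum>x<?a * ?b * ?c. (?s3 * ?s2 * ?s1) $$ (x, x))"
    using carrier_matD(1)[OF c3] by (simp add: B_tensor_def mtrace_def)
  also have "\<dots> = (\<Sum>i<?a. \<Sum>j<?b. \<Sum>k<?c.
      (?s3 * ?s2 * ?s1) $$ ((i * ?b + j) * ?c + k, (i * ?b + j) * ?c + k))"
    by (rule sum_triple)
  finally show ?thesis using entry by simp
qed

lemma minv_diagonal:
  assumes A: "A \<in> carrier_mat n n" and d: "\<And>i j. i < n \<Longrightarrow> j < n \<Longrightarrow> A $$ (i, j) = (if i = j then d i else 0)"
    and nz: "\<And>i. i < n \<Longrightarrow> d i \<noteq> 0" and i: "i < n"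
  shows "minv A $$ (i, i) = inverse (d i)"
proof -
  define N where "N = mat n n (\<lambda>(i, j). if i = j then inverse (d i) else 0)"
  have N: "N \<in> carrier_mat n n" by (simp add: N_def)
  have "A * N = 1\<^sub>m n"
  proof (rule eq_matI)
    fix r s assume "r < dim_row (1\<^sub>m n :: complex mat)" "s < dim_col (1\<^sub>m n :: complex mat)"
    then have rs: "r < n" "s < n" by auto
    have "(A * N) $$ (r, s) = (\<Sum>l<n. if l = s then A $$ (r, s) * inverse (d s) else 0)"
      unfolding mult_entry[OF A N rs] using rs by (intro sum.cong) (auto simp: N_def)
    then show "(A * N) $$ (r, s) = (1\<^sub>m n :: complex mat) $$ (r, s)"
      using rs nz by (simp add: d)
  qed (use A N in auto)
  then have "minv A = N" by (rule minv_props(1)[OF A N])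
  then show ?thesis using i by (simp add: N_def)
qed

text \<open>If the degrees of \<open>U\<close> act diagonally on \<open>V\<close>, the second strand keeps its basis vector and its
  degree \<open>y\<close>. Then the third strand is acted on by \<open>y\<close> and afterwards by the inverse of that action. The
  first strand meets \<open>z\<close> and \<open>y z y\<inverse>\<close> and so is acted on by \<open>[y, z]\<close>, and the second strand meets \<open>x\<close>
  and \<open>z\<inverse> x z\<close>. These are the longitudes of the Borromean rings coloured by \<open>x, y, z\<close>.\<close>

lemma B_tensor_commutators:
  assumes G: "group G" and \<omega>: "normalized_3cocycle G \<omega>"
    and U: "center_object G \<omega> U" and V: "center_object G \<omega> V" and W: "center_object G \<omega> W"
    and strict: "\<And>x y z. x \<in> set (degs U) \<Longrightarrow> y \<in> set (degs V) \<Longrightarrow> z \<in> set (degs W) \<Longrightarrow>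
      \<omega> x y z = 1 \<and> \<omega> x z y = 1 \<and> \<omega> y x z = 1 \<and> \<omega> y z x = 1 \<and> \<omega> z x y = 1 \<and> \<omega> z y x = 1"
    and diag: "\<And>x i j. x \<in> set (degs U) \<Longrightarrow> i < cdim V \<Longrightarrow> j < cdim V \<Longrightarrow>
      action V x $$ (i, j) = (if i = j then \<chi> j x else 0)"
    and nz: "\<And>x j. x \<in> set (degs U) \<Longrightarrow> j < cdim V \<Longrightarrow> \<chi> j x \<noteq> 0"
    and comm: "\<And>x y z. x \<in> set (degs U) \<Longrightarrow> y \<in> set (degs V) \<Longrightarrow> z \<in> set (degs W) \<Longrightarrow>
      conj_by G (conj_by G y z) x = conj_by G z x"
    and flat: "\<And>x y z. x \<in> set (degs U) \<Longrightarrow> y \<in> set (degs V) \<Longrightarrow> z \<in> set (degs W) \<Longrightarrow>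
      alpha G \<omega> x (conj_by G y z \<otimes>\<^bsub>G\<^esub> inv\<^bsub>G\<^esub> z) z = 1"
  shows "B_tensor \<omega> U V W = (\<Sum>i<cdim U. \<Sum>j<cdim V. \<Sum>k<cdim W.
    \<chi> j (degs U ! i) / \<chi> j (conj_by G (inv\<^bsub>G\<^esub> (degs W ! k)) (degs U ! i))
    * action U (conj_by G (degs V ! j) (degs W ! k) \<otimes>\<^bsub>G\<^esub> inv\<^bsub>G\<^esub> (degs W ! k)) $$ (i, i))"
proof -
  interpret group G by fact
  let ?a = "cdim U" and ?b = "cdim V" and ?c = "cdim W"
  have summand: "(\<Sum>j1<?b. \<Sum>i1<?a. \<Sum>k2<?c.
    action V (degs U ! i) $$ (j1, j) * minv (action V (degs U ! i1)) $$ (j, j1)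
    * (action W (degs V ! j1) $$ (k2, k) * minv (action W (degs V ! j)) $$ (k, k2))
    * (action U (degs W ! k2) $$ (i, i1) * minv (action U (degs W ! k)) $$ (i1, i)))
    = \<chi> j (degs U ! i) / \<chi> j (conj_by G (inv\<^bsub>G\<^esub> (degs W ! k)) (degs U ! i))
    * action U (conj_by G (degs V ! j) (degs W ! k) \<otimes>\<^bsub>G\<^esub> inv\<^bsub>G\<^esub> (degs W ! k)) $$ (i, i)"
    if i: "i < ?a" and j: "j < ?b" and k: "k < ?c" for i j k
  proof -
    let ?x = "\<lambda>i. degs U ! i"
    define y where "y = degs V ! j"
    define z where "z = degs W ! k"
    define c where "c = conj_by G y z \<otimes>\<^bsub>G\<^esub> inv\<^bsub>G\<^esub> z"
    have mem: "?x i1 \<in> set (degs U)" if "i1 < ?a" for i1 using that by simp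
    have ymem: "y \<in> set (degs V)" and zmem: "z \<in> set (degs W)" using j k by (simp_all add: y_def z_def)
    have xc: "?x i1 \<in> carrier G" if "i1 < ?a" for i1 using center_objectD(1)[OF U that] .
    have yc: "y \<in> carrier G" and zc: "z \<in> carrier G"
      using center_objectD(1)[OF V j] center_objectD(1)[OF W k] by (simp_all add: y_def z_def)
    have yz: "conj_by G y z \<in> carrier G" by (rule conj_by_closed[OF G yc zc])
    have cc: "c \<in> carrier G" and cz: "c \<otimes>\<^bsub>G\<^esub> z = conj_by G y z" using yz zc by (simp_all add: c_def m_assoc)
    let ?w = "conj_by G (inv\<^bsub>G\<^esub> z) (?x i)"
    let ?e = "\<chi> j (?x i) * inverse (\<chi> j ?w)"
    let ?F = "\<lambda>i1. action U (conj_by G y z) $$ (i, i1) * minv (action U z) $$ (i1, i)"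
    obtain Ny where Ny: "Ny \<in> carrier_mat ?c ?c" "Ny * action W y = 1\<^sub>m ?c" "action W y * Ny = 1\<^sub>m ?c"
      using action_invertible[OF G \<omega> W yc] by metis
    have mNy: "minv (action W y) = Ny" by (rule minv_props(1)[OF center_objectD(2)[OF W yc] Ny(1,3)])
    obtain Nz where Nz: "Nz \<in> carrier_mat ?a ?a" "action U z * Nz = 1\<^sub>m ?a"
      using action_invertible[OF G \<omega> U zc] by metis
    have mNz: "minv (action U z) = Nz" by (rule minv_props(1)[OF center_objectD(2)[OF U zc] Nz])
    have mdiag: "minv (action V (?x i1)) $$ (j, j) = inverse (\<chi> j (?x i1))" if "i1 < ?a" for i1
      by (rule minv_diagonal[OF center_objectD(2)[OF V xc[OF that]] _ _ j])
         (use diag nz mem[OF that] in auto)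
    \<comment> \<open>The third strand closes up: in the sum over \<open>k2\<close> the action of \<open>y\<close> on \<open>W\<close> meets its inverse.\<close>
    have third: "(\<Sum>k2<?c. action W y $$ (k2, k) * minv (action W y) $$ (k, k2)
        * (action U (degs W ! k2) $$ (i, i1) * minv (action U z) $$ (i1, i))) = ?F i1" for i1
    proof -
      have "(\<Sum>k2<?c. action W y $$ (k2, k) * minv (action W y) $$ (k, k2)
          * (action U (degs W ! k2) $$ (i, i1) * minv (action U z) $$ (i1, i)))
        = (\<Sum>k2<?c. (Ny $$ (k, k2) * action W y $$ (k2, k)) * ?F i1)"
      proof (intro sum.cong refl)
        fix k2 assume "k2 \<in> {..<?c}"
        then have k2: "k2 < ?c" by simp
        have "degs W ! k2 = conj_by G y z" if "action W y $$ (k2, k) \<noteq> 0"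
          using center_objectD(3)[OF W yc k2 k that] by (simp add: z_def)
        then show "action W y $$ (k2, k) * minv (action W y) $$ (k, k2)
            * (action U (degs W ! k2) $$ (i, i1) * minv (action U z) $$ (i1, i))
          = (Ny $$ (k, k2) * action W y $$ (k2, k)) * ?F i1"
          unfolding mNy by (cases "action W y $$ (k2, k) = 0") auto
      qed
      also have "\<dots> = (Ny * action W y) $$ (k, k) * ?F i1"
        unfolding mult_entry[OF Ny(1) center_objectD(2)[OF W yc] k k] sum_distrib_right ..
      finally show ?thesis using Ny(2) k by simp
    qed
    have "(\<Sum>j1<?b. \<Sum>i1<?a. \<Sum>k2<?c.
        action V (?x i) $$ (j1, j) * minv (action V (?x i1)) $$ (j, j1)
        * (action W (degs V ! j1) $$ (k2, k) * minv (action W y) $$ (k, k2))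
        * (action U (degs W ! k2) $$ (i, i1) * minv (action U z) $$ (i1, i)))
      = (\<Sum>j1<?b. if j1 = j then \<Sum>i1<?a. \<Sum>k2<?c.
        \<chi> j (?x i) * inverse (\<chi> j (?x i1))
        * (action W y $$ (k2, k) * minv (action W y) $$ (k, k2)
        * (action U (degs W ! k2) $$ (i, i1) * minv (action U z) $$ (i1, i))) else 0)"
    proof (intro sum.cong refl)
      fix j1 assume "j1 \<in> {..<?b}"
      then have j1: "j1 < ?b" by simp
      show "(\<Sum>i1<?a. \<Sum>k2<?c. action V (?x i) $$ (j1, j) * minv (action V (?x i1)) $$ (j, j1)
        * (action W (degs V ! j1) $$ (k2, k) * minv (action W y) $$ (k, k2))
        * (action U (degs W ! k2) $$ (i, i1) * minv (action U z) $$ (i1, i)))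
      = (if j1 = j then \<Sum>i1<?a. \<Sum>k2<?c.
        \<chi> j (?x i) * inverse (\<chi> j (?x i1))
        * (action W y $$ (k2, k) * minv (action W y) $$ (k, k2)
        * (action U (degs W ! k2) $$ (i, i1) * minv (action U z) $$ (i1, i))) else 0)"
        by (auto simp: diag[OF mem[OF i] j1 j] mdiag mult.assoc simp flip: y_def intro!: sum.cong)
    qed
    also have "\<dots> = (\<Sum>i1<?a. \<chi> j (?x i) * inverse (\<chi> j (?x i1)) * ?F i1)"
      using j third by (simp flip: sum_distrib_left)
    also have "\<dots> = (\<Sum>i1<?a. ?e * ?F i1)"
    proof (intro sum.cong refl)
      fix i1 assume "i1 \<in> {..<?a}"
      then have i1: "i1 < ?a" by simp
      have "?x i1 = ?w" if "action U (conj_by G y z) $$ (i, i1) \<noteq> 0"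
      proof -
        have "?x i = conj_by G z (?x i1)"
          using center_objectD(3)[OF U yz i i1 that] comm[OF mem[OF i1] ymem zmem] by simp
        then have "?w = conj_by G (inv\<^bsub>G\<^esub> z \<otimes>\<^bsub>G\<^esub> z) (?x i1)"
          using conj_by_mult[OF G inv_closed[OF zc] zc xc[OF i1]] by simp
        then show ?thesis using zc xc[OF i1] by (simp add: conj_by_def)
      qed
      then show "\<chi> j (?x i) * inverse (\<chi> j (?x i1)) * ?F i1 = ?e * ?F i1"
        by (cases "action U (conj_by G y z) $$ (i, i1) = 0") auto
    qed
    also have "\<dots> = ?e * (\<Sum>i1<?a. action U (conj_by G y z) $$ (i, i1) * Nz $$ (i1, i))"
      unfolding mNz by (simp add: sum_distrib_left)
    also have "(\<Sum>i1<?a. action U (conj_by G y z) $$ (i, i1) * Nz $$ (i1, i)) = action U c $$ (i, i)"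
    proof -
      note Ac = center_objectD(2)[OF U cc] and Az = center_objectD(2)[OF U zc]
      have e: "action U (conj_by G y z) $$ (i, i1) = (action U c * action U z) $$ (i, i1)" if i1: "i1 < ?a" for i1
      proof -
        have "alpha G \<omega> (?x i1) c z = 1" using flat[OF mem[OF i1] ymem zmem] by (simp add: c_def)
        then show ?thesis using action_mult_entry[OF U cc zc _ i i1] cz yz by simp
      qed
      have "(\<Sum>i1<?a. action U (conj_by G y z) $$ (i, i1) * Nz $$ (i1, i))
        = (\<Sum>i1<?a. (action U c * action U z) $$ (i, i1) * Nz $$ (i1, i))"
        by (intro sum.cong refl) (simp add: e)
      also have "\<dots> = (action U c * action U z * Nz) $$ (i, i)"
        by (rule mult_entry[OF mult_carrier_mat[OF Ac Az] Nz(1) i i, symmetric])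
      also have "action U c * action U z * Nz = action U c"
        using assoc_mult_mat[OF Ac Az Nz(1)] Nz(2) Ac by simp
      finally show ?thesis .
    qed
    finally show ?thesis by (simp add: y_def z_def c_def divide_inverse)
  qed
  show ?thesis
    by (subst B_tensor_strict[OF G \<omega> U V W]) (use strict in blast, intro sum.cong refl, simp add: summand)
qed

section \<open>Residues determined by their exponential sums\<close>

lemma root_of_unity_pow:
  "(0::nat) < m \<Longrightarrow> exp (2 * of_real pi * \<i> / of_nat m :: complex) ^ m = 1"
  by (simp flip: exp_of_nat_mult)

lemma root_of_unity_pow_eq_iff:
  assumes m: "(0::nat) < m"
  shows "exp (2 * of_real pi * \<i> / of_nat m :: complex) ^ a = exp (2 * of_real pi * \<i> / of_nat m) ^ b
    \<longleftrightarrow> [a = b] (mod m)"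
proof -
  let ?z = "exp (2 * of_real pi * \<i> / of_nat m :: complex)"
  have red: "?z ^ a = ?z ^ (a mod m)" for a
  proof -
    have "?z ^ a = ?z ^ (m * (a div m) + a mod m)" by simp
    then show ?thesis unfolding power_add power_mult root_of_unity_pow[OF m] by simp
  qed
  have cis: "?z ^ a = cis (2 * pi * real a / real m)" for a
  proof -
    have "?z ^ a = exp (of_nat a * (2 * of_real pi * \<i> / of_nat m))" by (simp only: exp_of_nat_mult)
    then show ?thesis by (simp add: cis_conv_exp mult_ac)
  qed
  have "?z ^ a = ?z ^ b \<longleftrightarrow> ?z ^ (a mod m) = ?z ^ (b mod m)" using red by metis
  also have "\<dots> \<longleftrightarrow> a mod m = b mod m"
    using bij_betw_roots_unity[OF m] m unfolding cis bij_betw_def inj_on_def by auto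
  finally show ?thesis by (simp add: cong_def)
qed

lemma card_residue_eq_exponential_sums:
  fixes f :: "'a \<Rightarrow> nat"
  assumes I: "finite I" and q: "0 < q" and v: "v < q"
  defines "\<zeta> \<equiv> exp (2 * of_real pi * \<i> / of_nat q) :: complex"
  shows "of_nat q * of_nat (card {i \<in> I. f i mod q = v}) = (\<Sum>r<q. \<zeta> ^ (r * (q - v)) * (\<Sum>i\<in>I. \<zeta> ^ (r * f i)))"
proof -
  have orth: "(\<Sum>r<q. \<zeta> ^ (r * d)) = (if q dvd d then of_nat q else 0)" for d
  proof -
    have one: "\<zeta> ^ d = 1 \<longleftrightarrow> q dvd d"
      using root_of_unity_pow_eq_iff[OF q, of d 0] by (simp add: \<zeta>_def cong_0_iff)
    have "(\<zeta> ^ d) ^ q = (\<zeta> ^ q) ^ d" by (simp only: power_mult[symmetric] mult.commute)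
    then have "(\<zeta> ^ d) ^ q = 1" unfolding \<zeta>_def root_of_unity_pow[OF q] by simp
    then have "(\<zeta> ^ d - 1) * (\<Sum>r<q. (\<zeta> ^ d) ^ r) = 0" using power_diff_1_eq[of "\<zeta> ^ d" q] by simp
    moreover have "(\<Sum>r<q. \<zeta> ^ (r * d)) = (\<Sum>r<q. (\<zeta> ^ d) ^ r)"
      by (simp add: power_mult[symmetric] mult.commute)
    ultimately show ?thesis using one by (cases "q dvd d") auto
  qed
  have res: "q dvd (q - v) + f i \<longleftrightarrow> f i mod q = v" for i
  proof -
    have "q dvd (q - v) + f i \<longleftrightarrow> [(q - v) + f i = (q - v) + v] (mod q)"
      using v by (simp add: cong_def dvd_eq_mod_eq_0)
    also have "\<dots> \<longleftrightarrow> [f i = v] (mod q)" by (rule cong_add_lcancel_nat)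
    finally show ?thesis using v by (simp add: cong_def)
  qed
  have "(\<Sum>r<q. \<zeta> ^ (r * (q - v)) * (\<Sum>i\<in>I. \<zeta> ^ (r * f i))) = (\<Sum>i\<in>I. \<Sum>r<q. \<zeta> ^ (r * ((q - v) + f i)))"
    by (simp add: sum_distrib_left distrib_left power_add) (rule sum.swap)
  also have "\<dots> = (\<Sum>i\<in>I. if f i mod q = v then of_nat q else 0)" unfolding orth res ..
  also have "\<dots> = of_nat q * of_nat (card {i \<in> I. f i mod q = v})"
    using I by (simp add: sum.If_cases Collect_conj_eq Int_commute mult.commute)
  finally show ?thesis by simp
qed

text \<open>By Fourier inversion on \<open>\<int>/q\<close>, the sums \<open>\<Sum> \<zeta>\<^sup>r\<^sup>f\<close> for all \<open>r\<close> determine how often \<open>f\<close> takes each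
  residue, hence any sum of a function of these residues.\<close>

lemma sum_cong_of_exponential_sums:
  fixes f g :: "'a \<Rightarrow> nat"
  assumes I: "finite I" and q: "0 < q"
    and eq: "\<And>r. 0 < r \<Longrightarrow> r < q \<Longrightarrow>
      (\<Sum>i\<in>I. exp (2 * of_real pi * \<i> / of_nat q) ^ (r * f i))
      = (\<Sum>i\<in>I. (exp (2 * of_real pi * \<i> / of_nat q) :: complex) ^ (r * g i))"
  shows "[(\<Sum>i\<in>I. int (f i) ^ m) = (\<Sum>i\<in>I. int (g i) ^ m)] (mod int q)"
proof -
  have eq': "(\<Sum>i\<in>I. exp (2 * of_real pi * \<i> / of_nat q) ^ (r * f i))
      = (\<Sum>i\<in>I. (exp (2 * of_real pi * \<i> / of_nat q) :: complex) ^ (r * g i))" if "r < q" for r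
    using eq[of r] that by (cases "r = 0") simp_all
  have card: "card {i \<in> I. f i mod q = v} = card {i \<in> I. g i mod q = v}" if v: "v < q" for v
  proof -
    have "of_nat q * of_nat (card {i \<in> I. f i mod q = v})
      = (of_nat q * of_nat (card {i \<in> I. g i mod q = v}) :: complex)"
      unfolding card_residue_eq_exponential_sums[OF I q v] by (intro sum.cong refl) (simp add: eq')
    then show ?thesis using q by simp
  qed
  have sum: "(\<Sum>i\<in>I. int (f i mod q) ^ m) = (\<Sum>v<q. int (card {i \<in> I. f i mod q = v}) * int v ^ m)" for f :: "'a \<Rightarrow> nat"
  proof -
    have "(\<Sum>i\<in>I. int (f i mod q) ^ m) = (\<Sum>v<q. \<Sum>i | i \<in> I \<and> f i mod q = v. int (f i mod q) ^ m)"
      by (rule sum.group[symmetric]) (use I q in auto)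
    also have "\<dots> = (\<Sum>v<q. int (card {i \<in> I. f i mod q = v}) * int v ^ m)"
      by (intro sum.cong refl) simp
    finally show ?thesis .
  qed
  have red: "[(\<Sum>i\<in>I. int (f i) ^ m) = (\<Sum>i\<in>I. int (f i mod q) ^ m)] (mod int q)" for f :: "'a \<Rightarrow> nat"
    by (intro cong_sum cong_pow) (simp add: of_nat_mod cong_sym)
  have "(\<Sum>i\<in>I. int (f i mod q) ^ m) = (\<Sum>i\<in>I. int (g i mod q) ^ m)" unfolding sum by (simp add: card)
  then show ?thesis using cong_trans[OF red[of f]] cong_sym[OF red[of g]] by simp
qed

section \<open>The group of order \<open>pq\<close> and its cocycle\<close>

lemma pow_cong_1_iff_prime_dvd:
  fixes p n q :: nat
  assumes "prime p" "\<not> [n = 1] (mod q)" "[n ^ p = 1] (mod q)"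
  shows "[n ^ j = 1] (mod q) \<longleftrightarrow> p dvd j"
proof -
  have "ord q n dvd p" using assms(3) by (simp only: ord_divides)
  moreover have "ord q n \<noteq> 1" using assms(2) ord_divides[of n 1 q] by auto
  ultimately have "ord q n = p" using assms(1) by (auto simp: prime_nat_iff)
  then show ?thesis by (simp only: ord_divides)
qed

locale pq_data =
  fixes p q n :: nat
  assumes p: "prime p" and p_odd: "odd p" and q: "prime q" and pq: "p dvd q - 1"
    and n_nontriv: "\<not> [n = 1] (mod q)" and n_order: "[n ^ p = 1] (mod q)"
begin

abbreviation G where "G \<equiv> pq_group p q n"

abbreviation \<omega> where "\<omega> \<equiv> pq_cocycle p"

abbreviation \<xi> :: complex where "\<xi> \<equiv> exp (2 * of_real pi * \<i> / of_nat p)"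

lemma p0: "0 < p" "1 < p" by (rule prime_gt_0_nat[OF p], rule prime_gt_1_nat[OF p])

lemma q0: "0 < q" "1 < q" by (rule prime_gt_0_nat[OF q], rule prime_gt_1_nat[OF q])

lemma p_less_q: "p < q"
proof -
  have "p \<le> q - 1" by (rule dvd_imp_le[OF pq]) (use q0(2) in linarith)
  then show ?thesis using q0(1) by linarith
qed

lemma G: "group G" by (rule group_pq_group[OF p0(1) q0(1) n_order])

interpretation group G by (rule G)

lemma cocycle: "normalized_3cocycle G (\<omega> u)" by (rule normalized_3cocycle_pq[OF p0(1)])

lemma carrier_iff: "x \<in> carrier G \<longleftrightarrow> fst x < q \<and> snd x < p"
  by (cases x) (auto simp: pq_group_def)

lemma mult_eq: "(i, j) \<otimes>\<^bsub>G\<^esub> (k, l) = ((i + n ^ j * k) mod q, (j + l) mod p)"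
  by (simp add: pq_group_def)

lemma snd_mult: "snd (x \<otimes>\<^bsub>G\<^esub> y) = (snd x + snd y) mod p"
  by (cases x; cases y) (simp add: mult_eq)

lemma one_eq: "\<one>\<^bsub>G\<^esub> = (0, 0)"
  by (simp add: pq_group_def)

lemma n_pow_mod: "[n ^ (j mod p) = n ^ j] (mod q)"
proof -
  have "n ^ j = (n ^ p) ^ (j div p) * n ^ (j mod p)"
    by (metis mult_div_mod_eq power_add power_mult)
  moreover have "[(n ^ p) ^ (j div p) * n ^ (j mod p) = 1 ^ (j div p) * n ^ (j mod p)] (mod q)"
    by (intro cong_mult cong_pow n_order cong_refl)
  ultimately show ?thesis by (simp add: cong_sym)
qed

lemma coprime_n_q: "coprime n q"
proof -
  have "coprime (n ^ p) q" using cong_imp_coprime[OF cong_sym[OF n_order]] by simp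
  then show ?thesis using p0 by simp
qed

lemma n_pow_eq_1: "[n ^ j = 1] (mod q) \<longleftrightarrow> p dvd j"
  by (rule pow_cong_1_iff_prime_dvd[OF p n_nontriv n_order])

lemma conj_eq:
  assumes "j < q" "i < p" "l < q" "k < p"
  shows "conj_by G (j, i) (l, k) = ((j + n ^ i * l + (q - 1) * n ^ k * j) mod q, k)"
proof -
  let ?r = "((j + n ^ i * l + (q - 1) * n ^ k * j) mod q, k)"
  have c: "(j, i) \<in> carrier G" "(l, k) \<in> carrier G" "?r \<in> carrier G"
    using assms q0 by (auto simp: carrier_iff)
  obtain r where r: "q = Suc r" using q0 by (cases q) auto
  have e: "(j + n ^ i * l + (q - 1) * n ^ k * j) + n ^ k * j = (j + n ^ i * l) + n ^ k * j * q"
    by (simp add: r algebra_simps)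
  have "?r \<otimes>\<^bsub>G\<^esub> (j, i) = (((j + n ^ i * l + (q - 1) * n ^ k * j) + n ^ k * j) mod q, (k + i) mod p)"
    by (simp only: mult_eq mod_add_left_eq)
  also have "\<dots> = (j, i) \<otimes>\<^bsub>G\<^esub> (l, k)"
    unfolding e by (simp add: mult_eq add.commute)
  finally have "?r \<otimes>\<^bsub>G\<^esub> (j, i) = (j, i) \<otimes>\<^bsub>G\<^esub> (l, k)" .
  then have "(j, i) \<otimes>\<^bsub>G\<^esub> (l, k) \<otimes>\<^bsub>G\<^esub> inv\<^bsub>G\<^esub> (j, i) = ?r"
    using c by (metis inv_solve_right m_closed)
  then show ?thesis by (simp add: conj_by_def)
qed

lemma snd_conj: "x \<in> carrier G \<Longrightarrow> y \<in> carrier G \<Longrightarrow> snd (conj_by G x y) = snd y"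
  by (cases x; cases y) (simp add: conj_eq carrier_iff)

lemma conj_a:
  assumes "j < q" "i < p" "l < q"
  shows "conj_by G (j, i) (l, 0) = ((n ^ i * l) mod q, 0)"
proof -
  obtain r where r: "q = Suc r" using q0 by (cases q) auto
  have "j + n ^ i * l + (q - 1) * n ^ 0 * j = n ^ i * l + j * q" by (simp add: r algebra_simps)
  then show ?thesis unfolding conj_eq[OF assms p0(1)] by (simp only: mod_mult_self1)
qed

lemma conj_a_any: "x \<in> carrier G \<Longrightarrow> l < q \<Longrightarrow> conj_by G x (l, 0) = ((n ^ snd x * l) mod q, 0)"
  by (cases x) (simp add: conj_a carrier_iff)

lemma cocycle_a:
  assumes "x \<in> carrier G" "y \<in> carrier G" "z \<in> carrier G" "snd x = 0 \<or> snd y = 0 \<or> snd z = 0"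
  shows "\<omega> u x y z = 1"
  using assms by (auto simp: pq_cocycle_def carrier_iff cyc_cocycle_power[OF p0(1)])

lemma \<xi>_pow_p: "\<xi> ^ p = 1"
  by (rule root_of_unity_pow[OF p0(1)])

lemma \<xi>_pow_eq_iff: "\<xi> ^ a = \<xi> ^ b \<longleftrightarrow> [a = b] (mod p)"
  by (rule root_of_unity_pow_eq_iff[OF p0(1)])

text \<open>Of the three factors of \<open>\<alpha>\<close> the first two cancel, since \<open>\<omega>\<close> is symmetric in its last two
  arguments and conjugation preserves the exponent of \<open>b\<close>.\<close>

lemma alpha_eq:
  assumes g: "g \<in> carrier G" and x: "x \<in> carrier G" and y: "y \<in> carrier G"
  shows "alpha G (\<omega> u) g x y = \<xi> ^ (u * snd g * ((snd x + snd y) div p))"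
proof -
  have s: "snd g < p" "snd x < p" "snd y < p" using assms by (simp_all add: carrier_iff)
  have xy: "x \<otimes>\<^bsub>G\<^esub> y \<in> carrier G" using x y by simp
  note c = snd_conj[OF y g] snd_conj[OF xy g]
  have "alpha G (\<omega> u) g x y = (\<xi> ^ (snd g * ((snd x + snd y) div p))) ^ u"
    using s by (simp add: alpha_def pq_cocycle_def c cyc_cocycle_power[OF p0(1)] add.commute[of "snd g"])
  also have "\<dots> = \<xi> ^ (u * snd g * ((snd x + snd y) div p))"
    by (simp only: power_mult[symmetric] mult_ac)
  finally show ?thesis .
qed

lemma alpha_a: "g \<in> carrier G \<Longrightarrow> x \<in> carrier G \<Longrightarrow> y \<in> carrier G \<Longrightarrow> snd g = 0 \<or> snd x = 0 \<or> snd y = 0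
    \<Longrightarrow> alpha G (\<omega> u) g x y = 1"
  by (auto simp: alpha_eq carrier_iff)

lemma pow_a:
  assumes "s < q"
  shows "(s, 0) [^]\<^bsub>G\<^esub> (m::nat) = ((m * s) mod q, 0)"
proof (induction m)
  case (Suc m)
  have "(s, 0) [^]\<^bsub>G\<^esub> Suc m = ((m * s) mod q, 0) \<otimes>\<^bsub>G\<^esub> (s, 0)" by (simp only: nat_pow_Suc Suc)
  also have "\<dots> = ((m * s + s) mod q, 0)" by (simp add: mult_eq mod_add_left_eq)
  finally show ?case by (simp add: add.commute)
qed (simp add: one_eq)

lemma pow_b:
  assumes "k < p"
  shows "(0, k) [^]\<^bsub>G\<^esub> (m::nat) = (0, (m * k) mod p)"
proof (induction m)
  case (Suc m)
  have "(0, k) [^]\<^bsub>G\<^esub> Suc m = (0, (m * k) mod p) \<otimes>\<^bsub>G\<^esub> (0, k)" by (simp only: nat_pow_Suc Suc)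
  also have "\<dots> = (0, (m * k + k) mod p)" by (simp add: mult_eq mod_add_left_eq)
  finally show ?case by (simp add: add.commute)
qed (simp add: one_eq)

section \<open>Simple objects for the group of order \<open>pq\<close>\<close>

lemma simple_degs_carrier: "simple_object G (\<omega> u) V \<Longrightarrow> g \<in> set (degs V) \<Longrightarrow> fst g < q \<and> snd g < p"
  using center_objectD(1)[OF simple_center_object, of G "\<omega> u" V] carrier_iff by (auto simp: in_set_conv_nth)

lemma solve_cong:
  assumes "coprime (s :: nat) r" obtains m where "[m * s = j] (mod r)"
proof -
  obtain x where "[s * x = Suc 0] (mod r)" using cong_solve_coprime_nat[OF assms] by blast
  then have "[s * x * j = Suc 0 * j] (mod r)" by (intro cong_mult cong_refl)
  then show ?thesis using that[of "x * j"] by (simp add: mult_ac)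
qed

lemma coprime_q: "0 < s \<Longrightarrow> s < q \<Longrightarrow> coprime s q"
  using prime_imp_coprime[OF q] nat_dvd_not_less coprime_commute by blast

lemma coprime_p: "0 < k \<Longrightarrow> k < p \<Longrightarrow> coprime k p"
  using prime_imp_coprime[OF p] nat_dvd_not_less coprime_commute by blast

text \<open>The residue \<open>1 - n\<^sup>k\<close>, written without subtraction.\<close>

definition one_minus_pow :: "nat \<Rightarrow> nat" where
  "one_minus_pow k = 1 + (q - 1) * n ^ k"

lemma one_minus_pow_add: "one_minus_pow k + n ^ k = 1 + q * n ^ k"
proof -
  obtain r where r: "q = Suc r" using q0 by (cases q) auto
  show ?thesis unfolding one_minus_pow_def by (simp add: r)
qed

lemma coprime_one_minus_pow:
  assumes "0 < k" "k < p"
  shows "coprime (one_minus_pow k) q"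
proof -
  have "\<not> q dvd one_minus_pow k"
  proof
    assume "q dvd one_minus_pow k"
    then have "[one_minus_pow k + n ^ k = 0 + n ^ k] (mod q)"
      by (intro cong_add cong_refl) (simp only: cong_0_iff)
    from cong_sym[OF this] have 1: "[n ^ k = one_minus_pow k + n ^ k] (mod q)" by simp
    have "[one_minus_pow k + n ^ k = 1] (mod q)"
      unfolding one_minus_pow_add cong_def by (rule mod_mult_self2)
    with 1 have "[n ^ k = 1] (mod q)" by (rule cong_trans)
    then have "p dvd k" by (simp only: n_pow_eq_1)
    then show False using nat_dvd_not_less[OF assms] by simp
  qed
  then show ?thesis using prime_imp_coprime[OF q] coprime_commute by blast
qed

lemma conj_by_a:
  assumes "j < q" "l < q" "k < p"
  shows "conj_by G (j, 0) (l, k) = ((l + one_minus_pow k * j) mod q, k)"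
proof -
  have "j + n ^ 0 * l + (q - 1) * n ^ k * j = l + one_minus_pow k * j"
    by (simp add: one_minus_pow_def algebra_simps)
  then show ?thesis unfolding conj_eq[OF assms(1) p0(1) assms(2,3)] by (simp only:)
qed

text \<open>Already the powers of \<open>a\<close> permute the coset \<open>\<langle>a\<rangle> b\<^sup>k\<close> transitively, because \<open>1 - n\<^sup>k\<close> is
  invertible.\<close>

lemma conj_transitive_b:
  assumes l: "l < q" "l' < q" and k: "0 < k" "k < p"
  shows "\<exists>x\<in>carrier G. (l', k) = conj_by G x (l, k)"
proof -
  obtain m where m: "[m * one_minus_pow k = l' + (q - 1) * l] (mod q)"
    using solve_cong[OF coprime_one_minus_pow[OF k]] .
  have "[l + one_minus_pow k * (m mod q) = l + m * one_minus_pow k] (mod q)"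
    unfolding mult.commute[of m] by (intro cong_add cong_mult cong_refl) simp
  also have "[l + m * one_minus_pow k = l + (l' + (q - 1) * l)] (mod q)"
    by (intro cong_add cong_refl m)
  also have "l + (l' + (q - 1) * l) = l' + l * q"
  proof -
    obtain r where "q = Suc r" using q0 by (cases q) auto
    then show ?thesis by simp
  qed
  finally have "(l', k) = conj_by G (m mod q, 0) (l, k)"
    using q0 l k by (simp add: conj_by_a cong_def)
  moreover have "(m mod q, 0) \<in> carrier G" using q0 p0 by (simp add: carrier_iff)
  ultimately show ?thesis by blast
qed


subsection \<open>Objects supported on the normal subgroup\<close>

lemma action_a:
  assumes V: "simple_object G (\<omega> u) V" and i: "i < cdim V" and i': "i' < cdim V"
    and s: "degs V ! i = (s, 0)" and a: "a < q" "[a = m * s] (mod q)"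
  shows "action V (a, 0) $$ (i', i) = (if i' = i then T_scalar V ^ m else 0)"
proof -
  have sc: "(s, 0) \<in> carrier G" and sq: "s < q"
    using simple_degs_carrier[OF V nth_mem[OF i]] s p0 by (auto simp: carrier_iff)
  have "(a, 0) = (s, 0) [^]\<^bsub>G\<^esub> m" using a by (simp add: pow_a[OF sq] cong_def)
  moreover have "(\<Prod>r<m. alpha G (\<omega> u) (s, 0) (s, 0) ((s, 0) [^]\<^bsub>G\<^esub> r)) = 1"
    using sc by (intro prod.neutral) (auto simp: alpha_a)
  ultimately show ?thesis
    using action_pow_entry[OF G cocycle V i i' s, of m] by (simp only: div_by_1)
qed

lemma T_order_a:
  assumes V: "simple_object G (\<omega> u) V" and s: "(s, 0) \<in> set (degs V)"
  shows "T_scalar V ^ q = 1"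
proof -
  obtain i where i: "i < cdim V" "degs V ! i = (s, 0)" using s by (auto simp: in_set_conv_nth)
  have "action V (0, 0) $$ (i, i) = T_scalar V ^ q"
    using action_a[OF V i(1,1,2), of 0 q] q0 by (simp add: cong_def)
  then show ?thesis
    using action_one_entry[OF simple_center_object[OF V] G i(1,1)] by (simp add: one_eq)
qed

lemma T_identity:
  assumes V: "simple_object G (\<omega> u) V" and s: "(0, 0) \<in> set (degs V)"
  shows "T_scalar V = 1"
proof -
  obtain i where i: "i < cdim V" "degs V ! i = (0, 0)" using s by (auto simp: in_set_conv_nth)
  have "action V (0, 0) $$ (i, i) = T_scalar V ^ 1"
    using action_a[OF V i(1,1,2), of 0 1] q0 by simp
  then show ?thesis
    using action_one_entry[OF simple_center_object[OF V] G i(1,1)] by (simp add: one_eq)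
qed

lemma n_pow_inj:
  assumes "coprime s q" "i < p" "j < p" "[n ^ i * s = n ^ j * s] (mod q)"
  shows "i = j"
proof -
  have *: "i = j" if ij: "i \<le> j" "j < p" "[n ^ i = n ^ j] (mod q)" for i j
  proof -
    have "[n ^ i * 1 = n ^ i * n ^ (j - i)] (mod q)" using ij by (simp flip: power_add)
    then have "[1 = n ^ (j - i)] (mod q)"
      using coprime_n_q cong_mult_lcancel_nat[of "n ^ i" q 1 "n ^ (j - i)"] by simp
    then have "p dvd j - i" using n_pow_eq_1 cong_sym by blast
    moreover have "j - i < p" using ij(2) by simp
    ultimately have "j - i = 0" using nat_dvd_not_less by blast
    then show ?thesis using ij(1) by simp
  qed
  have "[n ^ i = n ^ j] (mod q)" using assms(1,4) by (simp add: cong_mult_rcancel_nat)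
  then show ?thesis using *[of i j] *[of j i] assms(2,3) cong_sym[of "n ^ i" "n ^ j" q] nat_le_linear[of i j] by auto
qed

text \<open>The centralizer of \<open>a\<^sup>s \<noteq> 1\<close> is \<open>\<langle>a\<rangle>\<close>, which consists of powers of \<open>a\<^sup>s\<close>; so each degree occurs once
  and a sum over the basis is a sum over the orbit of \<open>s\<close> under multiplication by \<open>n\<close>.\<close>

lemma sum_degs_a:
  fixes f :: "nat \<times> nat \<Rightarrow> complex"
  assumes V: "simple_object G (\<omega> u) V" and s: "(s, 0) \<in> set (degs V)" "0 < s"
  shows "(\<Sum>i<cdim V. f (degs V ! i)) = (\<Sum>i<p. f ((n ^ i * s) mod q, 0))"
    and "set (degs V) = (\<lambda>i. ((n ^ i * s) mod q, 0)) ` {..<p}"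
proof -
  have sq: "s < q" and sc: "(s, 0) \<in> carrier G"
    using simple_degs_carrier[OF V s(1)] p0 by (auto simp: carrier_iff)
  have cop: "coprime s q" by (rule coprime_q[OF s(2) sq])
  have "distinct (degs V)"
  proof (rule simple_degs_distinct[OF G cocycle V s(1)])
    fix x assume x: "x \<in> carrier G" "conj_by G x (s, 0) = (s, 0)"
    then have "[n ^ snd x * s = n ^ 0 * s] (mod q)"
      using sq by (simp add: conj_a_any cong_def)
    then have "snd x = 0" using n_pow_inj[OF cop] x(1) p0 by (simp add: carrier_iff)
    moreover obtain m where "[m * s = fst x] (mod q)" using solve_cong[OF cop] .
    ultimately have "x = (s, 0) [^]\<^bsub>G\<^esub> m"
      using x(1) by (cases x) (simp add: pow_a[OF sq] cong_def carrier_iff)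
    then show "\<exists>m::nat. x = (s, 0) [^]\<^bsub>G\<^esub> m" by blast
  qed
  then have sum: "(\<Sum>i<cdim V. f (degs V ! i)) = sum f (set (degs V))"
    by (intro sum.reindex_bij_betw bij_betw_nth) auto
  show set: "set (degs V) = (\<lambda>i. ((n ^ i * s) mod q, 0)) ` {..<p}"
  proof (intro equalityI subsetI)
    fix h assume "h \<in> set (degs V)"
    then obtain x where x: "x \<in> carrier G" "h = conj_by G x (s, 0)"
      using simple_degs_conjugate[OF G V s(1)] by metis
    then show "h \<in> (\<lambda>i. ((n ^ i * s) mod q, 0)) ` {..<p}"
      using sq by (auto simp: conj_a_any carrier_iff)
  next
    fix h :: "nat \<times> nat" assume "h \<in> (\<lambda>i. ((n ^ i * s) mod q, 0)) ` {..<p}"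
    then obtain i where i: "i < p" "h = ((n ^ i * s) mod q, 0)" by auto
    then have "h = conj_by G (0, i) (s, 0)" using conj_a[OF q0(1) i(1) sq] by simp
    then show "h \<in> set (degs V)"
      using degs_conj_closed[OF G cocycle simple_center_object[OF V] s(1), of "(0, i)"] i q0
      by (simp add: carrier_iff)
  qed
  have "inj_on (\<lambda>i. ((n ^ i * s) mod q, 0::nat)) {..<p}"
    using n_pow_inj[OF cop] by (auto simp: inj_on_def cong_def)
  then show "(\<Sum>i<cdim V. f (degs V ! i)) = (\<Sum>i<p. f ((n ^ i * s) mod q, 0))"
    unfolding sum set by (simp add: sum.reindex)
qed


subsection \<open>Objects supported outside the normal subgroup\<close>

lemma degs_b:
  assumes V: "simple_object G (\<omega> u) V" and k: "(l, k) \<in> set (degs V)" "0 < k"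
  shows "set (degs V) = {..<q} \<times> {k}"
proof (intro equalityI subsetI)
  have lk: "l < q" "k < p" "(l, k) \<in> carrier G"
    using simple_degs_carrier[OF V k(1)] by (auto simp: carrier_iff)
  fix h
  {
    assume h: "h \<in> set (degs V)"
    then obtain x where "x \<in> carrier G" "h = conj_by G x (l, k)"
      using simple_degs_conjugate[OF G V k(1)] by metis
    then have "snd h = k" using snd_conj lk by simp
    then show "h \<in> {..<q} \<times> {k}" using simple_degs_carrier[OF V h] by (cases h) auto
  next
    assume "h \<in> {..<q} \<times> {k}"
    then obtain l' where h: "h = (l', k)" "l' < q" by auto
    then obtain x where "x \<in> carrier G" "h = conj_by G x (l, k)"
      using conj_transitive_b[OF lk(1) h(2) k(2) lk(2)] by blast
    then show "h \<in> set (degs V)"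
      using degs_conj_closed[OF G cocycle simple_center_object[OF V] k(1)] by simp
  }
qed

lemma cdim_b:
  assumes V: "simple_object G (\<omega> u) V" and k: "(l, k) \<in> set (degs V)" "0 < k"
  shows "cdim V = q"
proof -
  have kp: "k < p" using simple_degs_carrier[OF V k(1)] by simp
  have k0: "(0, k) \<in> set (degs V)" using degs_b[OF V k] q0 by simp
  have "distinct (degs V)"
  proof (rule simple_degs_distinct[OF G cocycle V k0])
    fix x assume x: "x \<in> carrier G" "conj_by G x (0, k) = (0, k)"
    obtain j i where ji: "x = (j, i)" "j < q" "i < p" using x(1) by (cases x) (auto simp: carrier_iff)
    have "q dvd one_minus_pow k * j"
      using x(2) conj_eq[OF ji(2,3) q0(1) kp] ji(1)
      by (simp add: one_minus_pow_def algebra_simps dvd_eq_mod_eq_0)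
    then have "q dvd j"
      using coprime_one_minus_pow[OF k(2) kp] by (simp add: coprime_commute coprime_dvd_mult_right_iff)
    then have "j = 0" using ji(2) by (metis dvd_imp_le linorder_not_le neq0_conv)
    obtain m where "[m * k = i] (mod p)" using solve_cong[OF coprime_p[OF k(2) kp]] .
    then have "x = (0, k) [^]\<^bsub>G\<^esub> m" using ji \<open>j = 0\<close> by (simp add: pow_b[OF kp] cong_def)
    then show "\<exists>m::nat. x = (0, k) [^]\<^bsub>G\<^esub> m" by blast
  qed
  then have "cdim V = card (set (degs V))" by (rule distinct_card[symmetric])
  then show ?thesis by (simp add: degs_b[OF V k] card_cartesian_product)
qed

text \<open>The carry in adding \<open>k\<close> to \<open>r k\<close> modulo \<open>p\<close> is the difference of the quotients of \<open>(r + 1) k\<close> and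
  \<open>r k\<close> by \<open>p\<close>, so the sum telescopes.\<close>

lemma sum_carries: "(\<Sum>r<m. (k + r * k mod p) div p) = (m * k) div p"
proof (induction m)
  case (Suc m)
  have "(k + m * k) div p = (k + m * k mod p + p * (m * k div p)) div p" by (simp add: add.assoc)
  also have "\<dots> = m * k div p + (k + m * k mod p) div p" using p0 by (simp only: div_mult_self2)
  finally show ?case using Suc by simp
qed simp

text \<open>Since \<open>(b\<^sup>k)\<^sup>p = 1\<close>, the \<open>p\<close>-th power of the twist is the product of the scalars \<open>\<alpha>\<close> picked up by
  multiplying the powers of \<open>b\<^sup>k\<close> successively; their exponents contain the carries for \<open>k, 2 k, \<dots>, p k\<close>.\<close>

lemma T_power_b:
  assumes V: "simple_object G (\<omega> u) V" and k: "(l, k) \<in> set (degs V)" "0 < k"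
  shows "T_scalar V ^ p = \<xi> ^ (u * k\<^sup>2)"
proof -
  have kp: "k < p" using simple_degs_carrier[OF V k(1)] by simp
  have "(0, k) \<in> set (degs V)" using degs_b[OF V k] q0 by simp
  then obtain i where i: "i < cdim V" "degs V ! i = (0, k)" by (auto simp: in_set_conv_nth)
  have c: "(0, r) \<in> carrier G" if "r < p" for r using that q0 by (simp add: carrier_iff)
  have "(\<Prod>r<p. alpha G (\<omega> u) (0, k) (0, k) ((0, k) [^]\<^bsub>G\<^esub> r))
    = (\<Prod>r<p. \<xi> ^ (u * k * ((k + r * k mod p) div p)))"
    by (intro prod.cong refl) (simp add: pow_b[OF kp] alpha_eq[OF c[OF kp] c[OF kp] c] p0)
  also have "\<dots> = \<xi> ^ (u * k * k)"
    using p0 by (simp add: power_sum[symmetric] sum_distrib_left[symmetric] sum_carries)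
  finally have prod: "(\<Prod>r<p. alpha G (\<omega> u) (0, k) (0, k) ((0, k) [^]\<^bsub>G\<^esub> r)) = \<xi> ^ (u * k\<^sup>2)"
    by (simp add: power2_eq_square mult.assoc)
  have "(0, k) [^]\<^bsub>G\<^esub> p = \<one>\<^bsub>G\<^esub>" by (simp add: pow_b[OF kp] one_eq)
  then have "1 = T_scalar V ^ p / \<xi> ^ (u * k\<^sup>2)"
    using action_pow_entry[OF G cocycle V i(1,1,2), of p]
      action_one_entry[OF simple_center_object[OF V] G i(1,1)] by (simp only: prod if_True simp_thms)
  then show ?thesis by (simp add: field_simps)
qed


subsection \<open>Recognizing the support by the twist\<close>

lemma root_of_unity_coprime:
  assumes "z ^ a = 1" "z ^ b = 1" "coprime a b"
  shows "z = (1 :: complex)"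
proof (cases "b = 0")
  case True
  then show ?thesis using assms by simp
next
  case False
  obtain x where "[a * x = Suc 0] (mod b)" using cong_solve_coprime_nat[OF assms(3)] by blast
  then obtain m k where mk: "Suc 0 + m * b = a * x + k * b" unfolding cong_iff_lin_nat by blast
  have "z * (z ^ b) ^ m = z ^ (Suc 0 + m * b)" by (simp add: power_mult[symmetric] mult.commute)
  also have "\<dots> = (z ^ a) ^ x * (z ^ b) ^ k" unfolding mk by (simp only: power_add power_mult mult.commute[of k b])
  finally show ?thesis using assms by simp
qed

lemma T_order_b:
  assumes V: "simple_object G (\<omega> u) V" and k: "(l, k) \<in> set (degs V)" "0 < k"
  shows "T_scalar V ^ (p * p) = 1"
proof -
  have "T_scalar V ^ (p * p) = \<xi> ^ (u * k\<^sup>2 * p)" unfolding power_mult T_power_b[OF assms] ..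
  also have "\<dots> = (\<xi> ^ p) ^ (u * k\<^sup>2)" by (simp only: power_mult[symmetric] mult.commute)
  finally show ?thesis by (simp only: \<xi>_pow_p power_one)
qed

lemma coprime_pp_q: "coprime (p * p) q"
  using coprime_q[OF p0(1) p_less_q] by simp

text \<open>The twist has order dividing \<open>q\<close> on objects supported on \<open>\<langle>a\<rangle>\<close> and order dividing \<open>p\<^sup>2\<close> on the
  others, so a nontrivial twist cannot occur on both sides.\<close>

lemma support_a:
  assumes V: "simple_object G (\<omega> u) V" and T: "T_scalar V \<noteq> 1" "T_scalar V ^ q = 1"
  obtains s where "0 < s" "(s, 0) \<in> set (degs V)"
proof -
  obtain s k where sk: "(s, k) \<in> set (degs V)"
    using V nth_mem[of 0 "degs V"] by (cases "degs V ! 0") (auto simp: simple_object_def)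
  have "k = 0"
    using root_of_unity_coprime[OF T_order_b[OF V sk] T(2) coprime_pp_q] T(1) by blast
  then have "s \<noteq> 0" using T_identity[OF V] sk T(1) by metis
  then show ?thesis using that[of s] sk \<open>k = 0\<close> by simp
qed

lemma support_b:
  assumes V: "simple_object G (\<omega> u) V" and T: "T_scalar V \<noteq> 1" "T_scalar V ^ (p * p) = 1"
  obtains l k where "0 < k" "(l, k) \<in> set (degs V)"
proof -
  obtain l k where lk: "(l, k) \<in> set (degs V)"
    using V nth_mem[of 0 "degs V"] by (cases "degs V ! 0") (auto simp: simple_object_def)
  have "k \<noteq> 0" using root_of_unity_coprime[OF T(2) T_order_a[OF V] coprime_pp_q] lk T(1) by metis
  then show ?thesis using that[of k l] lk by simp
qed

section \<open>The \<open>B\<close>-tensor for the group of order \<open>pq\<close>\<close>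

lemma inj_on_orbit_a:
  assumes "coprime s q"
  shows "inj_on (\<lambda>i. ((n ^ i * s) mod q, 0::nat)) {..<p}"
  using n_pow_inj[OF assms] by (auto simp: inj_on_def cong_def)

lemma snd_inv:
  assumes z: "z \<in> carrier G" "0 < snd z"
  shows "snd (inv\<^bsub>G\<^esub> z) = p - snd z"
proof -
  have l: "snd z < p" "snd (inv\<^bsub>G\<^esub> z) < p" using z inv_closed[OF z(1)] by (simp_all add: carrier_iff)
  have "(snd z + snd (inv\<^bsub>G\<^esub> z)) mod p = 0"
    using snd_mult[of z "inv\<^bsub>G\<^esub> z"] z by (simp add: one_eq)
  then have "p dvd snd z + snd (inv\<^bsub>G\<^esub> z)" by (simp only: dvd_eq_mod_eq_0)
  then obtain m where m: "snd z + snd (inv\<^bsub>G\<^esub> z) = p * m" by (elim dvdE)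
  have "p * m < p * 2" "0 < p * m" using l z(2) unfolding m[symmetric] by linarith+
  then have "m = 1" by simp
  then show ?thesis using m by simp
qed

text \<open>For degrees \<open>x = a\<^bsup>s n\<^sup>i\<^esup>\<close> and \<open>y = a\<^bsup>s n\<^sup>j\<^esup>\<close> of \<open>U\<close> and \<open>z\<close> in the coset \<open>\<langle>a\<rangle> b\<^sup>k\<close>, the commutator
  \<open>[y, z]\<close> is the power of \<open>x\<close> with exponent \<open>n\<^bsup>j-i\<^esup>(1 - n\<^sup>k)\<close> and \<open>[x, z\<inverse>]\<close> the power of \<open>y\<close> with exponent
  \<open>n\<^bsup>i-j\<^esup>(1 - n\<^bsup>-k\<^esup>)\<close>. Adding \<open>p\<close> to exponents of \<open>n\<close> avoids negative ones.\<close>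

definition borromean_exponent :: "nat \<Rightarrow> nat \<Rightarrow> nat \<Rightarrow> nat" where
  "borromean_exponent k i j
     = n ^ (j + (p - i)) * one_minus_pow k + n ^ (i + (p - j)) * one_minus_pow (p - k)"

text \<open>The factor \<open>q\<close> is the number of degrees \<open>z\<close> of \<open>W\<close>, on which the summands do not depend.\<close>

lemma B_tensor_aab:
  assumes U: "simple_object G (\<omega> u) U" and s: "(s, 0) \<in> set (degs U)" "0 < s"
    and W: "simple_object G (\<omega> u) W" and k: "(l, k) \<in> set (degs W)" "0 < k"
  shows "B_tensor (\<omega> u) U U W
    = of_nat q * (\<Sum>i<p. \<Sum>j<p. T_scalar U ^ borromean_exponent k i j)"
proof -
  note Uc = simple_center_object[OF U] and Wc = simple_center_object[OF W]
  let ?t = "T_scalar U" and ?\<chi> = "\<lambda>j x. action U x $$ (j, j)"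
  have tq: "?t ^ q = 1" by (rule T_order_a[OF U s(1)])
  have t0: "?t \<noteq> 0" using tq q0 by (auto simp: power_0_left)
  have sq: "s < q" and kp: "k < p" using simple_degs_carrier[OF U s(1)] simple_degs_carrier[OF W k(1)] by auto
  have cop: "coprime s q" by (rule coprime_q[OF s(2) sq])
  have x_form: "\<exists>i<p. x = ((n ^ i * s) mod q, 0)" if "x \<in> set (degs U)" for x
    using that unfolding sum_degs_a(2)[OF U s] by auto
  have z_form: "\<exists>l<q. z = (l, k)" if "z \<in> set (degs W)" for z
    using that unfolding degs_b[OF W k] by auto
  have xc: "x \<in> carrier G" "snd x = 0" if "x \<in> set (degs U)" for x
    using x_form[OF that] q0 p0 by (auto simp: carrier_iff)
  have zc: "z \<in> carrier G" "snd z = k" if "z \<in> set (degs W)" for z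
    using z_form[OF that] kp by (auto simp: carrier_iff)
  have yzc: "conj_by G y z \<in> carrier G" "snd (conj_by G y z) = snd z"
    if "y \<in> set (degs U)" "z \<in> set (degs W)" for y z
    using xc[OF that(1)] zc[OF that(2)] by (simp_all add: conj_by_closed[OF G] snd_conj)
  have diag: "\<exists>m. action U x $$ (i, j) = (if i = j then ?t ^ m else 0)"
    if x: "x \<in> set (degs U)" and ij: "i < cdim U" "j < cdim U" for x i j
  proof -
    obtain j0 where j0: "degs U ! j = ((n ^ j0 * s) mod q, 0)" using x_form[OF nth_mem[OF ij(2)]] by blast
    have "coprime ((n ^ j0 * s) mod q) q" using cop coprime_n_q q0 by simp
    then obtain m where "[m * ((n ^ j0 * s) mod q) = fst x] (mod q)" using solve_cong by blast
    then have "action U (fst x, 0) $$ (i, j) = (if i = j then ?t ^ m else 0)"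
      using action_a[OF U ij(2,1) j0, of "fst x" m] xc(1)[OF x] by (simp add: carrier_iff cong_sym)
    then show ?thesis using xc(2)[OF x] by (metis prod.collapse)
  qed
  \<comment> \<open>The summands are expressed in the degrees, from which \<open>idx\<close> recovers \<open>i\<close> in \<open>a\<^bsup>s n\<^sup>i\<^esup>\<close>; sums over the
    basis of \<open>U\<close> can then be rewritten as sums over exponents.\<close>
  define idx where "idx = the_inv_into {..<p} (\<lambda>i. ((n ^ i * s) mod q, 0::nat))"
  have idx: "idx ((n ^ i * s) mod q, 0) = i" if "i < p" for i
    unfolding idx_def by (rule the_inv_into_f_f[OF inj_on_orbit_a[OF cop]]) (use that in simp)
  let ?E = "\<lambda>x y. ?t ^ borromean_exponent k (idx x) (idx y)"
  have summand: "?\<chi> j (degs U ! i) / ?\<chi> j (conj_by G (inv\<^bsub>G\<^esub> z) (degs U ! i))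
      * action U (conj_by G (degs U ! j) z \<otimes>\<^bsub>G\<^esub> inv\<^bsub>G\<^esub> z) $$ (i, i)
    = ?E (degs U ! i) (degs U ! j)"
    if i: "i < cdim U" and j: "j < cdim U" and z: "z \<in> set (degs W)" for i j z
  proof -
    obtain i0 where i0: "i0 < p" "degs U ! i = ((n ^ i0 * s) mod q, 0)" using x_form[OF nth_mem[OF i]] by blast
    obtain j0 where j0: "j0 < p" "degs U ! j = ((n ^ j0 * s) mod q, 0)" using x_form[OF nth_mem[OF j]] by blast
    obtain l' where z': "z = (l', k)" "l' < q" using z_form[OF z] by blast
    let ?a = "(n ^ i0 * s) mod q" and ?b = "(n ^ j0 * s) mod q"
    let ?A = "n ^ (i0 + (p - j0))" and ?C = "n ^ (j0 + (p - i0))"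
    \<comment> \<open>\<open>n ^ (i + (p - j))\<close> is \<open>n\<^bsup>i-j\<^esup>\<close>; it relates the degrees with indices \<open>i\<close> and \<open>j\<close>.\<close>
    have shift: "[(n ^ i * s) mod q = n ^ (i + (p - j)) * ((n ^ j * s) mod q)] (mod q)"
      if "j < p" for i j
    proof -
      have "[n ^ (i + (p - j)) * ((n ^ j * s) mod q) = n ^ (i + (p - j)) * (n ^ j * s)] (mod q)"
        by (intro cong_mult cong_refl) simp
      also have "n ^ (i + (p - j)) * (n ^ j * s) = n ^ p * (n ^ i * s)"
      proof -
        have "n ^ (i + (p - j)) * n ^ j = n ^ p * n ^ i"
          using that by (simp add: add.commute flip: power_add)
        then show ?thesis by (simp add: mult.assoc[symmetric])
      qed
      also have "[n ^ p * (n ^ i * s) = 1 * (n ^ i * s)] (mod q)"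
        by (intro cong_mult n_order cong_refl)
      finally show ?thesis by (simp add: cong_sym)
    qed
    have e1: "?\<chi> j (?a, 0) = ?t ^ ?A"
      using action_a[OF U j j j0(2) _ shift[OF j0(1)]] q0 by simp
    have "conj_by G (inv\<^bsub>G\<^esub> z) (?a, 0) = ((n ^ (p - k) * ?a) mod q, 0)"
      using conj_a_any[OF inv_closed[OF zc(1)[OF z]]] snd_inv[OF zc(1)[OF z]] zc(2)[OF z] k(2) q0 by simp
    moreover have "[(n ^ (p - k) * ?a) mod q = (n ^ (p - k) * ?A) * ?b] (mod q)"
    proof -
      have "[n ^ (p - k) * ?a = n ^ (p - k) * (?A * ?b)] (mod q)"
        by (intro cong_mult cong_refl shift j0)
      then show ?thesis by (simp add: mult.assoc)
    qed
    ultimately have e2: "?\<chi> j (conj_by G (inv\<^bsub>G\<^esub> z) (?a, 0)) = ?t ^ (n ^ (p - k) * ?A)"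
      using action_a[OF U j j j0(2)] q0 by simp
    have e3: "conj_by G (?b, 0) z \<otimes>\<^bsub>G\<^esub> inv\<^bsub>G\<^esub> z = ((one_minus_pow k * ?b) mod q, 0)"
    proof -
      have "conj_by G (?b, 0) z = ((one_minus_pow k * ?b) mod q, 0) \<otimes>\<^bsub>G\<^esub> z"
        using kp q0 z'(2) by (simp add: z'(1) conj_by_a mult_eq mod_add_left_eq) (simp add: add.commute)
      moreover have "((one_minus_pow k * ?b) mod q, 0) \<in> carrier G" using q0 p0 by (simp add: carrier_iff)
      ultimately show ?thesis using zc(1)[OF z] by (simp add: m_assoc)
    qed
    have "[(one_minus_pow k * ?b) mod q = (?C * one_minus_pow k) * ?a] (mod q)"
    proof -
      have "[one_minus_pow k * ?b = one_minus_pow k * (?C * ?a)] (mod q)"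
        by (intro cong_mult cong_refl shift i0)
      then show ?thesis by (simp add: mult_ac)
    qed
    then have e4: "action U ((one_minus_pow k * ?b) mod q, 0) $$ (i, i) = ?t ^ (?C * one_minus_pow k)"
      using action_a[OF U i i i0(2)] q0 by simp
    have "?A * one_minus_pow (p - k) + n ^ (p - k) * ?A = ?A * (one_minus_pow (p - k) + n ^ (p - k))"
      by (simp only: distrib_left mult.commute)
    also have "\<dots> = ?A + q * (n ^ (p - k) * ?A)"
      unfolding one_minus_pow_add by (simp only: distrib_left mult_1_right mult_ac)
    finally have "?t ^ (?A * one_minus_pow (p - k)) * ?t ^ (n ^ (p - k) * ?A) = ?t ^ (?A + q * (n ^ (p - k) * ?A))"
      by (simp only: power_add[symmetric])
    also have "\<dots> = ?t ^ ?A" by (simp add: power_add power_mult tq)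
    finally have "?t ^ ?A / ?t ^ (n ^ (p - k) * ?A) = ?t ^ (?A * one_minus_pow (p - k))"
      using t0 by (simp add: divide_eq_eq)
    then show ?thesis
      unfolding i0(2) j0(2) e1 e2 e3 e4 idx[OF i0(1)] idx[OF j0(1)] borromean_exponent_def
      by (simp add: power_add mult.commute)
  qed
  have "B_tensor (\<omega> u) U U W = (\<Sum>i<cdim U. \<Sum>j<cdim U. \<Sum>k<cdim W.
    ?\<chi> j (degs U ! i) / ?\<chi> j (conj_by G (inv\<^bsub>G\<^esub> (degs W ! k)) (degs U ! i))
    * action U (conj_by G (degs U ! j) (degs W ! k) \<otimes>\<^bsub>G\<^esub> inv\<^bsub>G\<^esub> (degs W ! k)) $$ (i, i))"
  proof (rule B_tensor_commutators[OF G cocycle Uc Uc Wc])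
    fix x y z assume x: "x \<in> set (degs U)" and y: "y \<in> set (degs U)" and z: "z \<in> set (degs W)"
    show "\<omega> u x y z = 1 \<and> \<omega> u x z y = 1 \<and> \<omega> u y x z = 1 \<and> \<omega> u y z x = 1 \<and> \<omega> u z x y = 1 \<and> \<omega> u z y x = 1"
      using cocycle_a xc[OF x] xc[OF y] zc(1)[OF z] by simp
    show "conj_by G (conj_by G y z) x = conj_by G z x"
    proof -
      obtain a where "x = (a, 0)" "a < q" using xc[OF x] by (cases x) (auto simp: carrier_iff)
      then show ?thesis using yzc[OF y z] zc(1)[OF z] by (simp add: conj_a_any)
    qed
    show "alpha G (\<omega> u) x (conj_by G y z \<otimes>\<^bsub>G\<^esub> inv\<^bsub>G\<^esub> z) z = 1"
      using xc[OF x] zc(1)[OF z] yzc(1)[OF y z] by (simp add: alpha_a)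
  next
    fix x i j assume "x \<in> set (degs U)" "i < cdim U" "j < cdim U"
    then show "action U x $$ (i, j) = (if i = j then action U x $$ (j, j) else 0)"
      using diag by metis
  next
    fix x j assume "x \<in> set (degs U)" "j < cdim U"
    then show "action U x $$ (j, j) \<noteq> 0" using diag t0 by (metis power_not_zero)
  qed
  also have "\<dots> = (\<Sum>i<cdim U. \<Sum>j<cdim U. \<Sum>k<cdim W. ?E (degs U ! i) (degs U ! j))"
    by (intro sum.cong refl summand) auto
  also have "\<dots> = of_nat q * (\<Sum>i<cdim U. \<Sum>j<cdim U. ?E (degs U ! i) (degs U ! j))"
    by (simp add: cdim_b[OF W k] sum_distrib_left)
  also have "(\<Sum>i<cdim U. \<Sum>j<cdim U. ?E (degs U ! i) (degs U ! j))
    = (\<Sum>i<cdim U. \<Sum>j<p. ?E (degs U ! i) ((n ^ j * s) mod q, 0))"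
    by (intro sum.cong refl sum_degs_a(1)[OF U s, where f = "?E _"])
  also have "\<dots> = (\<Sum>i<p. \<Sum>j<p. ?E ((n ^ i * s) mod q, 0) ((n ^ j * s) mod q, 0))"
    by (rule sum_degs_a(1)[OF U s, where f = "\<lambda>x. \<Sum>j<p. ?E x ((n ^ j * s) mod q, 0)"])
  also have "\<dots> = (\<Sum>i<p. \<Sum>j<p. ?t ^ borromean_exponent k i j)"
    by (intro sum.cong refl) (simp add: idx)
  finally show ?thesis .
qed


section \<open>Recovering the conjugacy class from the exponents\<close>

text \<open>As \<open>p\<close> is odd, \<open>n\<^sup>2\<close> is a nontrivial \<open>p\<close>-th root of unity modulo \<open>q\<close>.\<close>

lemma sum_square_powers: "[(\<Sum>i<p. int n ^ (2 * i)) = 0] (mod int q)"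
proof -
  have dvd: "int q dvd (int n ^ 2 - 1) * (\<Sum>i<p. (int n ^ 2) ^ i)"
  proof -
    have "(int n ^ 2 - 1) * (\<Sum>i<p. (int n ^ 2) ^ i) = (int n ^ 2) ^ p - 1"
      by (rule power_diff_1_eq[symmetric])
    also have "\<dots> = (int n ^ p) ^ 2 - 1" by (simp flip: power_mult add: mult.commute)
    also have "[(int n ^ p) ^ 2 - 1 = 1 ^ 2 - 1] (mod int q)"
    proof (intro cong_diff cong_pow cong_refl)
      show "[int n ^ p = 1] (mod int q)" using n_order cong_int_iff[of "n ^ p" 1 q] by simp
    qed
    finally show ?thesis by (simp add: cong_0_iff)
  qed
  have "\<not> int q dvd int n ^ 2 - 1"
  proof
    assume "int q dvd int n ^ 2 - 1"
    then have "[int (n ^ 2) = int 1] (mod int q)" by (simp add: cong_iff_dvd_diff)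
    then have "p dvd 2" using n_pow_eq_1[of 2] cong_int_iff[of "n ^ 2" 1 q] by simp
    then show False using p p_odd primes_dvd_imp_eq two_is_prime_nat by blast
  qed
  then have "int q dvd (\<Sum>i<p. (int n ^ 2) ^ i)"
    using dvd q prime_dvd_mult_iff[of "int q"] by simp
  then show ?thesis by (simp add: cong_0_iff power_mult)
qed

text \<open>In \<open>(A (1 - n\<^sup>k) + A\<inverse> (1 - n\<^bsup>-k\<^esup>))\<^sup>2\<close> with \<open>A = n\<^bsup>j-i\<^esup>\<close> only the mixed term is independent of \<open>i\<close> and
  \<open>j\<close>; the squares sum to zero.\<close>

lemma sum_squares_exponent:
  assumes k: "0 < k" "k < p"
  shows "[(\<Sum>i<p. \<Sum>j<p. int (borromean_exponent k i j) ^ 2)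
    = 2 * int p ^ 2 * (2 - int n ^ k - int n ^ (p - k))] (mod int q)"
proof -
  let ?N = "int n" and ?r = "int q"
  let ?u = "1 - ?N ^ k" and ?v = "1 - ?N ^ (p - k)"
  have Np: "[?N ^ p = 1] (mod ?r)" using n_order cong_int_iff[of "n ^ p" 1 q] by simp
  have omp: "[int (one_minus_pow k) = 1 - ?N ^ k] (mod ?r)" for k
  proof -
    have "int (one_minus_pow k) + ?N ^ k = 1 + ?r * ?N ^ k"
      using one_minus_pow_add[of k] by (metis of_nat_add of_nat_mult of_nat_power of_nat_1)
    then have "int (one_minus_pow k) - (1 - ?N ^ k) = ?r * ?N ^ k" by simp
    then show ?thesis unfolding cong_iff_dvd_diff by simp
  qed
  have square: "[int (borromean_exponent k i j) ^ 2
    = ?N ^ (2 * j) * ?N ^ (2 * (p - i)) * ?u ^ 2 + ?N ^ (2 * i) * ?N ^ (2 * (p - j)) * ?v ^ 2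
      + 2 * (2 - ?N ^ k - ?N ^ (p - k))] (mod ?r)" if ij: "i < p" "j < p" for i j
  proof -
    let ?A = "?N ^ (j + (p - i))" and ?B = "?N ^ (i + (p - j))"
    have "[int (borromean_exponent k i j) = ?A * ?u + ?B * ?v] (mod ?r)"
      unfolding borromean_exponent_def of_nat_add of_nat_mult of_nat_power
      by (intro cong_add cong_mult cong_refl omp)
    then have "[int (borromean_exponent k i j) ^ 2 = (?A * ?u + ?B * ?v) ^ 2] (mod ?r)"
      by (rule cong_pow)
    also have "(?A * ?u + ?B * ?v) ^ 2 = ?A ^ 2 * ?u ^ 2 + ?B ^ 2 * ?v ^ 2 + 2 * (?A * ?B * (?u * ?v))"
      by (simp add: power2_eq_square algebra_simps)
    also have "[\<dots> = ?A ^ 2 * ?u ^ 2 + ?B ^ 2 * ?v ^ 2 + 2 * (1 * (2 - ?N ^ k - ?N ^ (p - k)))] (mod ?r)"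
    proof (intro cong_add cong_refl cong_mult)
      have "j + (p - i) + (i + (p - j)) = p + p" using ij by simp
      then have "?A * ?B = ?N ^ p * ?N ^ p" by (simp only: power_add[symmetric])
      then show "[?A * ?B = 1] (mod ?r)" using cong_mult[OF Np Np] by simp
      have "?u * ?v = 1 - ?N ^ k - ?N ^ (p - k) + ?N ^ p"
        using k by (simp add: algebra_simps flip: power_add)
      moreover have "[1 - ?N ^ k - ?N ^ (p - k) + ?N ^ p = 1 - ?N ^ k - ?N ^ (p - k) + 1] (mod ?r)"
        by (intro cong_add cong_refl Np)
      moreover have "1 - ?N ^ k - ?N ^ (p - k) + 1 = 2 - ?N ^ k - ?N ^ (p - k)" by simp
      ultimately show "[?u * ?v = 2 - ?N ^ k - ?N ^ (p - k)] (mod ?r)" by (simp only:)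
    qed
    also have "?A ^ 2 = ?N ^ (2 * j) * ?N ^ (2 * (p - i))"
      by (simp only: power_mult[symmetric] power_add[symmetric] distrib_right mult.commute[of 2])
    also have "?B ^ 2 = ?N ^ (2 * i) * ?N ^ (2 * (p - j))"
      by (simp only: power_mult[symmetric] power_add[symmetric] distrib_right mult.commute[of 2])
    finally show ?thesis by (simp only: mult_1)
  qed
  let ?S = "\<Sum>i<p. ?N ^ (2 * i)" and ?S' = "\<Sum>i<p. ?N ^ (2 * (p - i))"
  have "[(\<Sum>i<p. \<Sum>j<p. int (borromean_exponent k i j) ^ 2)
    = (\<Sum>i<p. \<Sum>j<p. ?N ^ (2 * j) * ?N ^ (2 * (p - i)) * ?u ^ 2 + ?N ^ (2 * i) * ?N ^ (2 * (p - j)) * ?v ^ 2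
      + 2 * (2 - ?N ^ k - ?N ^ (p - k)))] (mod ?r)"
    by (intro cong_sum square) auto
  also have "(\<Sum>i<p. \<Sum>j<p. ?N ^ (2 * j) * ?N ^ (2 * (p - i)) * ?u ^ 2 + ?N ^ (2 * i) * ?N ^ (2 * (p - j)) * ?v ^ 2
      + 2 * (2 - ?N ^ k - ?N ^ (p - k)))
    = ?S * (?S' * ?u ^ 2) + ?S * (?S' * ?v ^ 2) + int p * (int p * (2 * (2 - ?N ^ k - ?N ^ (p - k))))"
  proof -
    have "(\<Sum>i<p. \<Sum>j<p. ?N ^ (2 * j) * ?N ^ (2 * (p - i)) * ?u ^ 2) = ?S * (?S' * ?u ^ 2)"
      by (simp add: sum_distrib_left sum_distrib_right mult.assoc)
    moreover have "(\<Sum>i<p. \<Sum>j<p. ?N ^ (2 * i) * ?N ^ (2 * (p - j)) * ?v ^ 2) = ?S * (?S' * ?v ^ 2)"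
      by (simp add: sum_distrib_left sum_distrib_right mult.assoc) (rule sum.swap)
    ultimately show ?thesis by (simp add: sum.distrib)
  qed
  also have "[\<dots> = 0 * (?S' * ?u ^ 2) + 0 * (?S' * ?v ^ 2)
      + int p * (int p * (2 * (2 - ?N ^ k - ?N ^ (p - k))))] (mod ?r)"
    by (intro cong_add cong_mult cong_refl sum_square_powers)
  finally show ?thesis by (simp add: power2_eq_square mult_ac)
qed

text \<open>The sum of squares gives \<open>n\<^sup>k + n\<^bsup>-k\<^esup> = n + n\<inverse>\<close>, and \<open>X + X\<inverse>\<close> determines \<open>X\<close> up to inversion.\<close>

lemma k_eq_of_sum_squares:
  assumes k: "0 < k" "k < p"
    and eq: "[(\<Sum>i<p. \<Sum>j<p. int (borromean_exponent k i j) ^ 2)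
      = (\<Sum>i<p. \<Sum>j<p. int (borromean_exponent 1 i j) ^ 2)] (mod int q)"
  shows "k = 1 \<or> k = p - 1"
proof -
  let ?N = "int n" and ?r = "int q"
  have pr: "prime ?r" using q by simp
  have Np: "[?N ^ p = 1] (mod ?r)" using n_order cong_int_iff[of "n ^ p" 1 q] by simp
  let ?f = "\<lambda>k. 2 - ?N ^ k - ?N ^ (p - k)"
  have "[(\<Sum>i<p. \<Sum>j<p. int (borromean_exponent 1 i j) ^ 2) = 2 * int p ^ 2 * ?f 1] (mod ?r)"
    by (rule sum_squares_exponent) (use p0 in simp_all)
  with cong_trans[OF cong_sym[OF sum_squares_exponent[OF k]] eq]
  have "[2 * int p ^ 2 * ?f k = 2 * int p ^ 2 * ?f 1] (mod ?r)" by (rule cong_trans)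
  then have "?r dvd 2 * int p ^ 2 * (?f k - ?f 1)"
    unfolding cong_iff_dvd_diff right_diff_distrib[symmetric] .
  moreover have "\<not> ?r dvd 2"
  proof
    assume "?r dvd 2"
    then have "?r \<le> 2" by (rule zdvd_imp_le) simp
    moreover have "2 < p" using p0(2) p_odd by (cases "p = 2") auto
    ultimately show False using p_less_q by simp
  qed
  moreover have "\<not> ?r dvd int p ^ 2"
  proof
    assume "?r dvd int p ^ 2"
    then have "?r dvd int p" using pr prime_dvd_power by blast
    then show False using p_less_q p0 by (simp add: nat_dvd_not_less)
  qed
  ultimately have "?r dvd ?f k - ?f 1" using pr by (simp add: prime_dvd_mult_iff)
  then have dvd': "?r dvd ?f 1 - ?f k" by (subst dvd_diff_commute)
  let ?X = "?N ^ k" and ?X' = "?N ^ (p - k)" and ?Y = "?N" and ?Y' = "?N ^ (p - 1)"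
  have XX': "?X * ?X' = ?N ^ p" "?Y * ?Y' = ?N ^ p"
    using k p0 by (simp_all flip: power_add power_Suc)
  have r1: "?r dvd ?N ^ p - 1" using Np by (simp add: cong_iff_dvd_diff)
  \<comment> \<open>\<open>X + X\<inverse> - Y - Y\<inverse>\<close>, multiplied by \<open>X Y\<close>, factors.\<close>
  have "(?X - ?Y) * (?X * ?Y - 1) = ?X * ?Y * (?f 1 - ?f k) - ?Y * (?X * ?X' - 1) + ?X * (?Y * ?Y' - 1)"
    by (simp add: algebra_simps)
  also have "?r dvd \<dots>"
    unfolding XX' by (rule dvd_add[OF dvd_diff[OF dvd_mult[OF dvd'] dvd_mult[OF r1]] dvd_mult[OF r1]])
  finally consider "?r dvd ?X - ?Y" | "?r dvd ?X * ?Y - 1"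
    using pr prime_dvd_mult_iff by blast
  then show ?thesis
  proof cases
    case 1
    then have "[int (n ^ k) = int (n ^ 1)] (mod ?r)" by (simp add: cong_iff_dvd_diff)
    then have "[n ^ k = n ^ 1] (mod q)" by (simp only: cong_int_iff)
    then have "[n ^ k * 1 = n ^ 1 * 1] (mod q)" by simp
    from n_pow_inj[OF coprime_1_left k(2) p0(2) this] show ?thesis by simp
  next
    case 2
    then have "[int (n ^ (k + 1)) = int 1] (mod ?r)" by (simp add: cong_iff_dvd_diff mult.commute)
    then have "[n ^ (k + 1) = 1] (mod q)" by (simp only: cong_int_iff)
    then have "p dvd k + 1" by (simp only: n_pow_eq_1)
    then have "p \<le> k + 1" by (rule dvd_imp_le) simp
    then show ?thesis using k by arith
  qed
qed

section \<open>The objects that separate the categories\<close>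

text \<open>Induced from the character \<open>a \<mapsto> \<zeta>\<^sup>r\<close> of the centralizer of \<open>a\<close>. On the component of degree
  \<open>a\<^sup>s\<close> the element \<open>a\<^sup>j\<close> acts by \<open>\<zeta>\<^sup>r\<^sup>j\<^sup>/\<^sup>s\<close>, and \<open>q - 2\<close> is the exponent that inverts residues.\<close>

definition object_a :: "nat \<Rightarrow> (nat \<times> nat) center_obj" where
  "object_a r = monomial_object G (map (\<lambda>i. (n ^ i mod q, 0)) [0..<p])
     (\<lambda>g h. exp (2 * of_real pi * \<i> / of_nat q) ^ (r * (fst g * (n ^ snd g * fst h) ^ (q - 2))))"

lemma object_a:
  assumes r: "0 < r" "r < q"
  shows "simple_object G (\<omega> u) (object_a r)"
    and "T_scalar (object_a r) = exp (2 * of_real pi * \<i> / of_nat q) ^ r"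
proof -
  let ?z = "exp (2 * of_real pi * \<i> / of_nat q) :: complex"
  let ?D = "map (\<lambda>i. (n ^ i mod q, 0::nat)) [0..<p]"
  let ?c = "\<lambda>g h :: nat \<times> nat. ?z ^ (r * (fst g * (n ^ snd g * fst h) ^ (q - 2)))"
  have zcong: "?z ^ a = ?z ^ b" if "[a = b] (mod q)" for a b
    using root_of_unity_pow_eq_iff[OF q0(1)] that by blast
  have D: "set ?D \<subseteq> carrier G" "?D \<noteq> []" using p0 q0 by (auto simp: carrier_iff)
  have dist: "distinct ?D"
    using inj_on_orbit_a[of 1] by (simp add: distinct_map lessThan_atLeast0)
  have D_form: "h \<in> set ?D \<longleftrightarrow> (\<exists>i<p. h = (n ^ i mod q, 0))" for h by auto
  have conj: "conj_by G x (n ^ i mod q, 0) = (n ^ (snd x + i) mod q, 0)" if "x \<in> carrier G" for x i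
    using conj_a_any[OF that, of "n ^ i mod q"] q0 by (simp add: mod_mult_right_eq power_add)
  have closed: "conj_by G x h \<in> set ?D" if x: "x \<in> carrier G" and h: "h \<in> set ?D" for x h
  proof -
    obtain i where "h = (n ^ i mod q, 0)" using h D_form by blast
    moreover have "n ^ (snd x + i) mod q = n ^ ((snd x + i) mod p) mod q"
      using n_pow_mod[of "snd x + i"] by (simp add: cong_def)
    ultimately show ?thesis unfolding D_form using conj[OF x] p0 by (intro exI[of _ "(snd x + i) mod p"]) simp
  qed
  have V: "center_object G (\<omega> u) (object_a r)"
    unfolding object_a_def
  proof (rule center_object_monomial[OF G D(1) dist closed])
    show "?c \<one>\<^bsub>G\<^esub> h = 1" for h by (simp add: one_eq)
    fix g h k assume g: "g \<in> carrier G" and h: "h \<in> carrier G" and k: "k \<in> set ?D"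
    have kc: "k \<in> carrier G" "snd k = 0" using k D by auto
    let ?X = "n ^ snd h * fst k" and ?Y = "n ^ snd g"
    have hk: "conj_by G h k = (?X mod q, 0)"
      using conj_a_any[OF h, of "fst k"] kc by (cases k) (simp add: carrier_iff)
    have gh: "g \<otimes>\<^bsub>G\<^esub> h = ((fst g + ?Y * fst h) mod q, (snd g + snd h) mod p)"
      by (cases g; cases h) (simp add: mult_eq)
    have "[(fst g + ?Y * fst h) mod q * (n ^ ((snd g + snd h) mod p) * fst k) ^ (q - 2)
      = (fst g + ?Y * fst h) * (n ^ (snd g + snd h) * fst k) ^ (q - 2)] (mod q)"
      by (intro cong_mult cong_pow n_pow_mod cong_refl) simp
    also have "(fst g + ?Y * fst h) * (n ^ (snd g + snd h) * fst k) ^ (q - 2)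
      = fst g * (?Y * ?X) ^ (q - 2) + fst h * (?Y ^ (q - 1) * ?X ^ (q - 2))"
    proof -
      have "q - 1 = Suc (q - 2)" using p0 p_less_q by simp
      then show ?thesis by (simp add: power_add power_mult_distrib algebra_simps)
    qed
    also have "[fst g * (?Y * ?X) ^ (q - 2) + fst h * (?Y ^ (q - 1) * ?X ^ (q - 2))
      = fst g * (?Y * (?X mod q)) ^ (q - 2) + fst h * (1 * ?X ^ (q - 2))] (mod q)"
    proof (intro cong_add cong_mult cong_pow cong_refl)
      have "coprime ?Y q" using coprime_n_q by simp
      then have "\<not> q dvd ?Y" using coprime_common_divisor[of ?Y q q] q0 by auto
      then show "[?Y ^ (q - 1) = 1] (mod q)" using fermat_theorem[OF q] by simp
      show "[?X = ?X mod q] (mod q)" by simp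
    qed
    finally have e: "[fst (g \<otimes>\<^bsub>G\<^esub> h) * (n ^ snd (g \<otimes>\<^bsub>G\<^esub> h) * fst k) ^ (q - 2)
      = fst g * (?Y * (?X mod q)) ^ (q - 2) + fst h * ?X ^ (q - 2)] (mod q)"
      unfolding gh by simp
    have "?c g (conj_by G h k) * ?c h k = ?z ^ (r * (fst g * (?Y * (?X mod q)) ^ (q - 2) + fst h * ?X ^ (q - 2)))"
      unfolding hk by (simp add: distrib_left power_add)
    also have "\<dots> = ?c (g \<otimes>\<^bsub>G\<^esub> h) k"
      by (rule zcong[OF cong_mult[OF cong_refl cong_sym[OF e]]])
    also have "\<dots> = alpha G (\<omega> u) k g h * ?c (g \<otimes>\<^bsub>G\<^esub> h) k"
      using alpha_a[OF kc(1) g h] kc(2) by simp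
    finally show "?c g (conj_by G h k) * ?c h k = alpha G (\<omega> u) k g h * ?c (g \<otimes>\<^bsub>G\<^esub> h) k" .
  qed
  show simple: "simple_object G (\<omega> u) (object_a r)"
    unfolding object_a_def
  proof (rule simple_object_monomial[OF G D dist V[unfolded object_a_def]])
    show "?c g h \<noteq> 0" for g h by simp
    fix h k assume "h \<in> set ?D" "k \<in> set ?D"
    then obtain i j where ij: "i < p" "j < p" "h = (n ^ i mod q, 0)" "k = (n ^ j mod q, 0)"
      unfolding D_form by blast
    let ?x = "(0, (j + (p - i)) mod p)"
    have x: "?x \<in> carrier G" using p0 q0 by (simp add: carrier_iff)
    have "[(j + (p - i)) mod p + i = j] (mod p)"
    proof -
      have "[(j + (p - i)) mod p + i = (j + (p - i)) + i] (mod p)" by (intro cong_add cong_refl) simp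
      also have "(j + (p - i)) + i = j + p" using ij by simp
      finally show ?thesis by (simp add: cong_def)
    qed
    then have "n ^ ((j + (p - i)) mod p + i) mod q = n ^ j mod q"
      using n_pow_mod[of "(j + (p - i)) mod p + i"] n_pow_mod[of j] by (simp only: cong_def)
    then have "k = conj_by G ?x h" unfolding ij conj[OF x] by simp
    then show "\<exists>x\<in>carrier G. k = conj_by G x h" using x by blast
  qed
  have "(1, 0) \<in> set ?D" using p0 q0 unfolding D_form by (intro exI[of _ 0]) simp
  from T_scalar_monomial[OF G cocycle simple[unfolded object_a_def] this]
  show "T_scalar (object_a r) = ?z ^ r" by (simp add: object_a_def)
qed

text \<open>For \<open>b\<^sup>j \<mapsto> \<theta>\<^sup>j\<close>, \<open>j < p\<close>, to be a projective character of the centralizer of \<open>b\<close> for \<open>\<alpha>\<^sub>b\<close> it is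
  necessary that \<open>\<theta>\<^sup>p = \<xi>\<^sup>u\<close>. The exponent \<open>u + p\<close> instead of \<open>u\<close> makes \<open>\<theta>\<close> different from \<open>1\<close> even
  when \<open>u = 0\<close>, so that the kind of support can be recognized.\<close>

definition twist_b :: "nat \<Rightarrow> complex" where
  "twist_b u = exp (2 * of_real pi * \<i> / of_nat (p * p)) ^ (u + p)"

text \<open>The object induced from this projective character, supported on the class of \<open>b\<close>.\<close>

definition object_b :: "nat \<Rightarrow> (nat \<times> nat) center_obj" where
  "object_b u = monomial_object G (map (\<lambda>l. (l, 1)) [0..<q]) (\<lambda>g h. twist_b u ^ snd g)"

lemma twist_b_pow: "twist_b u ^ p = \<xi> ^ u" "twist_b u ^ (p * p) = 1"
proof -
  let ?e = "exp (2 * of_real pi * \<i> / of_nat (p * p)) :: complex"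
  have "?e ^ p = \<xi>"
    using p0 by (simp flip: exp_of_nat_mult)
  moreover have "twist_b u ^ p = (?e ^ p) ^ (u + p)"
    unfolding twist_b_def by (simp only: power_mult[symmetric] mult.commute)
  ultimately show 1: "twist_b u ^ p = \<xi> ^ u" by (simp add: power_add \<xi>_pow_p)
  have "(\<xi> ^ u) ^ p = (\<xi> ^ p) ^ u" by (simp only: power_mult[symmetric] mult.commute)
  then show "twist_b u ^ (p * p) = 1" unfolding power_mult 1 \<xi>_pow_p by simp
qed

lemma twist_b_neq_1:
  assumes u: "u < p"
  shows "twist_b u \<noteq> 1"
proof
  assume "twist_b u = 1"
  then have "[u + p = 0] (mod p * p)"
    using root_of_unity_pow_eq_iff[of "p * p" "u + p" 0] p0 by (simp add: twist_b_def)
  then have "p * p \<le> u + p" using p0 by (auto simp: cong_0_iff intro!: dvd_imp_le)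
  moreover have "u + p < 2 * p" using u by simp
  moreover have "2 * p \<le> p * p" using p0 by simp
  ultimately show False by linarith
qed

lemma object_b:
  shows "simple_object G (\<omega> u) (object_b u)" "T_scalar (object_b u) = twist_b u"
    "(0, 1) \<in> set (degs (object_b u))"
proof -
  let ?D = "map (\<lambda>l. (l, 1::nat)) [0..<q]"
  let ?c = "\<lambda>(g :: nat \<times> nat) (h :: nat \<times> nat). twist_b u ^ snd g"
  have D: "set ?D \<subseteq> carrier G" "?D \<noteq> []" using p0 q0 by (auto simp: carrier_iff)
  have dist: "distinct ?D" by (simp add: distinct_map inj_on_def)
  have D_form: "h \<in> set ?D \<longleftrightarrow> fst h < q \<and> snd h = 1" for h by (cases h) auto
  have Dc: "h \<in> carrier G" "snd h = 1" if "h \<in> set ?D" for h using that D(1) D_form by blast+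
  have closed: "conj_by G x h \<in> set ?D" if x: "x \<in> carrier G" and h: "h \<in> set ?D" for x h
    unfolding D_form using conj_by_closed[OF G x Dc(1)[OF h]] snd_conj[OF x Dc(1)[OF h]] Dc(2)[OF h]
    by (simp add: carrier_iff)
  have nz: "twist_b u \<noteq> 0" by (simp add: twist_b_def)
  have V: "center_object G (\<omega> u) (object_b u)"
    unfolding object_b_def
  proof (rule center_object_monomial[OF G D(1) dist closed])
    show "?c \<one>\<^bsub>G\<^esub> h = 1" for h by (simp add: one_eq)
    fix g h k assume g: "g \<in> carrier G" and h: "h \<in> carrier G" and k: "k \<in> set ?D"
    note kc = Dc[OF k]
    let ?m = "snd g + snd h"
    have "?c g (conj_by G h k) * ?c h k = twist_b u ^ (p * (?m div p) + ?m mod p)"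
      by (simp flip: power_add)
    also have "\<dots> = (twist_b u ^ p) ^ (?m div p) * twist_b u ^ (?m mod p)"
      by (simp only: power_add power_mult)
    also have "\<dots> = alpha G (\<omega> u) k g h * ?c (g \<otimes>\<^bsub>G\<^esub> h) k"
      unfolding alpha_eq[OF kc(1) g h] kc(2) snd_mult twist_b_pow by (simp add: power_mult)
    finally show "?c g (conj_by G h k) * ?c h k = alpha G (\<omega> u) k g h * ?c (g \<otimes>\<^bsub>G\<^esub> h) k" .
  qed
  show simple: "simple_object G (\<omega> u) (object_b u)"
    unfolding object_b_def
  proof (rule simple_object_monomial[OF G D dist V[unfolded object_b_def]])
    show "?c g h \<noteq> 0" for g h using nz by simp
    show "\<exists>x\<in>carrier G. k = conj_by G x h" if "h \<in> set ?D" "k \<in> set ?D" for h k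
      using conj_transitive_b[of "fst h" "fst k" 1] that p0 unfolding D_form by (cases h; cases k) simp
  qed
  have D0: "(0, 1) \<in> set ?D" using q0 unfolding D_form by simp
  then show "(0, 1) \<in> set (degs (object_b u))" by (simp add: object_b_def)
  from T_scalar_monomial[OF G cocycle simple[unfolded object_b_def] D0]
  show "T_scalar (object_b u) = twist_b u" by (simp add: object_b_def)
qed


section \<open>The invariants determine the cocycle\<close>

text \<open>The images of the chosen objects are known only through their twists. These force \<open>U r\<close> to be
  supported in \<open>\<langle>a\<rangle>\<close> and \<open>W\<close> on the class of some \<open>b\<^sup>k\<close>, and then \<open>B\<close> and \<open>T\<close> give \<open>k\<^sup>2 = 1\<close> and
  \<open>u' k\<^sup>2 = u\<close> modulo \<open>p\<close>.\<close>

lemma cocycle_determined: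
  assumes u: "u < p" "u' < p"
    and W: "simple_object G (\<omega> u') W" "T_scalar W = twist_b u"
    and U: "\<And>r. 0 < r \<Longrightarrow> r < q \<Longrightarrow> simple_object G (\<omega> u') (U r)"
      "\<And>r. 0 < r \<Longrightarrow> r < q \<Longrightarrow> T_scalar (U r) = T_scalar (object_a r)"
    and B: "\<And>r. 0 < r \<Longrightarrow> r < q \<Longrightarrow> B_tensor (\<omega> u') (U r) (U r) W
      = B_tensor (\<omega> u) (object_a r) (object_a r) (object_b u)"
  shows "u = u'"
proof -
  let ?z = "exp (2 * of_real pi * \<i> / of_nat q) :: complex"
  obtain l k where lk: "0 < k" "(l, k) \<in> set (degs W)"
    using support_b[OF W(1)] W(2) twist_b_neq_1[OF u(1)] twist_b_pow(2) by metis
  have kp: "k < p" using simple_degs_carrier[OF W(1) lk(2)] by simp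
  have sums: "(\<Sum>(i, j)\<in>{..<p} \<times> {..<p}. ?z ^ (r * borromean_exponent k i j))
    = (\<Sum>(i, j)\<in>{..<p} \<times> {..<p}. ?z ^ (r * borromean_exponent 1 i j))" if r: "0 < r" "r < q" for r
  proof -
    have T: "?z ^ r \<noteq> 1" "(?z ^ r) ^ q = 1"
    proof -
      show "?z ^ r \<noteq> 1"
        using root_of_unity_pow_eq_iff[OF q0(1), of r 0] r by (simp add: cong_0_iff nat_dvd_not_less)
      have "(?z ^ r) ^ q = (?z ^ q) ^ r" by (simp only: power_mult[symmetric] mult.commute)
      then show "(?z ^ r) ^ q = 1" by (simp only: root_of_unity_pow[OF q0(1)] power_one)
    qed
    have B_value: "B_tensor (\<omega> v) X X Y
      = of_nat q * (\<Sum>(i, j)\<in>{..<p} \<times> {..<p}. ?z ^ (r * borromean_exponent m i j))"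
      if X: "simple_object G (\<omega> v) X" "T_scalar X = ?z ^ r" and Y: "simple_object G (\<omega> v) Y"
        and m: "(l, m) \<in> set (degs Y)" "0 < m" for v X Y l m
    proof -
      obtain s where s: "0 < s" "(s, 0) \<in> set (degs X)" using support_a[OF X(1)] T X(2) by metis
      show ?thesis
        unfolding B_tensor_aab[OF X(1) s(2,1) Y m] X(2) by (simp add: sum.cartesian_product power_mult)
    qed
    show ?thesis
      using B[OF r] B_value[OF U(1)[OF r] _ W(1) lk(2,1)]
        B_value[OF object_a(1)[OF r] object_a(2)[OF r] object_b(1,3)]
        U(2)[OF r] object_a(2)[OF r] q0 by simp
  qed
  have "[(\<Sum>x\<in>{..<p} \<times> {..<p}. int (case x of (i, j) \<Rightarrow> borromean_exponent k i j) ^ 2)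
    = (\<Sum>x\<in>{..<p} \<times> {..<p}. int (case x of (i, j) \<Rightarrow> borromean_exponent 1 i j) ^ 2)] (mod int q)"
    by (rule sum_cong_of_exponential_sums[OF _ q0(1)]) (use sums in \<open>simp_all add: split_beta\<close>)
  then have "[(\<Sum>i<p. \<Sum>j<p. int (borromean_exponent k i j) ^ 2)
    = (\<Sum>i<p. \<Sum>j<p. int (borromean_exponent 1 i j) ^ 2)] (mod int q)"
    by (simp add: sum.cartesian_product split_beta)
  then have "k = 1 \<or> k = p - 1" by (rule k_eq_of_sum_squares[OF lk(1) kp])
  then have k2: "[k\<^sup>2 = 1] (mod p)"
  proof
    assume k: "k = p - 1"
    obtain m where m: "p = Suc m" using p0 by (cases p) auto
    have "k\<^sup>2 + 2 * p = 1 + p * p" unfolding k m by (simp add: power2_eq_square)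
    then have "(k\<^sup>2 + 2 * p) mod p = (1 + p * p) mod p" by simp
    then show ?thesis unfolding cong_def mod_mult_self1 mod_mult_self1 .
  qed simp
  have "\<xi> ^ (u' * k\<^sup>2) = \<xi> ^ u"
    using T_power_b[OF W(1) lk(2,1)] unfolding W(2) twist_b_pow(1) by simp
  then have "[u' * k\<^sup>2 = u] (mod p)" by (simp only: \<xi>_pow_eq_iff)
  with cong_sym[OF cong_mult[OF cong_refl k2]] have "[u' * 1 = u] (mod p)" by (rule cong_trans)
  then show ?thesis using u by (simp add: cong_def)
qed

end

lemma simple_class_mem:
  assumes V: "simple_object G \<omega> V"
  shows "simple_iso_rel G \<omega> `` {V} \<in> simple_classes G \<omega>" "V \<in> simple_iso_rel G \<omega> `` {V}"
proof -
  show "simple_iso_rel G \<omega> `` {V} \<in> simple_classes G \<omega>"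
    unfolding simple_classes_def by (rule quotientI) (use V in simp)
  show "V \<in> simple_iso_rel G \<omega> `` {V}"
    using equiv_class_self[OF equiv_simple_iso_rel, of V G \<omega>] V by simp
qed

theorem theorem6p3:
  fixes p q n u u' :: nat
    and \<kappa> :: "(nat \<times> nat) center_obj set \<Rightarrow> (nat \<times> nat) center_obj set"
  assumes "prime p" and "odd p" and "prime q" and "odd q" and "p dvd q - 1"
    and "\<not> [n = 1] (mod q)" and "[n ^ p = 1] (mod q)"
    and "u < p" and "u' < p"
    and "\<kappa> \<in> simple_classes (pq_group p q n) (pq_cocycle p u)
             \<rightarrow> simple_classes (pq_group p q n) (pq_cocycle p u')"
    and "\<And>X. X \<in> simple_classes (pq_group p q n) (pq_cocycle p u) \<Longrightarrow> T_class (\<kappa> X) = T_class X"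
    and "\<And>X Y Z. X \<in> simple_classes (pq_group p q n) (pq_cocycle p u) \<Longrightarrow>
           Y \<in> simple_classes (pq_group p q n) (pq_cocycle p u) \<Longrightarrow>
           Z \<in> simple_classes (pq_group p q n) (pq_cocycle p u) \<Longrightarrow>
           B_class (pq_cocycle p u') (\<kappa> X) (\<kappa> Y) (\<kappa> Z) = B_class (pq_cocycle p u) X Y Z"
  shows "u = u'"
proof -
  interpret pq_data p q n
    by (unfold_locales) (rule assms(1,2,3,5,6,7))+
  define cls where "cls V = simple_iso_rel G (\<omega> u) `` {V}" for V
  have cls: "cls V \<in> simple_classes G (\<omega> u)" "V \<in> cls V" "\<kappa> (cls V) \<in> simple_classes G (\<omega> u')"
    if "simple_object G (\<omega> u) V" for V
    using simple_class_mem[OF that] assms(10) unfolding cls_def by auto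
  define rep where "rep V = (SOME V'. V' \<in> \<kappa> (cls V))" for V
  have rep: "rep V \<in> \<kappa> (cls V)" "simple_object G (\<omega> u') (rep V)" "T_scalar (rep V) = T_scalar V"
    if V: "simple_object G (\<omega> u) V" for V
  proof -
    show mem: "rep V \<in> \<kappa> (cls V)"
      unfolding rep_def using simple_classes_D(1)[OF cls(3)[OF V]] by (rule someI_ex)
    show "simple_object G (\<omega> u') (rep V)" by (rule simple_classes_D(2)[OF cls(3)[OF V] mem])
    show "T_scalar (rep V) = T_scalar V"
      using assms(11)[OF cls(1)[OF V]] T_class_eq[OF cls(3)[OF V] mem] T_class_eq[OF cls(1)[OF V] cls(2)[OF V]]
      by simp
  qed
  have B: "B_tensor (\<omega> u') (rep X) (rep X) (rep Y) = B_tensor (\<omega> u) X X Y"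
    if X: "simple_object G (\<omega> u) X" and Y: "simple_object G (\<omega> u) Y" for X Y
    using assms(12)[OF cls(1)[OF X] cls(1)[OF X] cls(1)[OF Y]]
      B_class_eq[OF G cocycle cls(3)[OF X] cls(3)[OF X] cls(3)[OF Y] rep(1)[OF X] rep(1)[OF X] rep(1)[OF Y]]
      B_class_eq[OF G cocycle cls(1)[OF X] cls(1)[OF X] cls(1)[OF Y] cls(2)[OF X] cls(2)[OF X] cls(2)[OF Y]]
    by simp
  show ?thesis
  proof (rule cocycle_determined[OF assms(8,9), of "rep (object_b u)" "\<lambda>r. rep (object_a r)"])
    show "simple_object G (\<omega> u') (rep (object_b u))" by (rule rep(2)[OF object_b(1)])
    show "T_scalar (rep (object_b u)) = twist_b u" using rep(3)[OF object_b(1)] object_b(2) by simp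
    show "simple_object G (\<omega> u') (rep (object_a r))" "T_scalar (rep (object_a r)) = T_scalar (object_a r)"
      "B_tensor (\<omega> u') (rep (object_a r)) (rep (object_a r)) (rep (object_b u))
        = B_tensor (\<omega> u) (object_a r) (object_a r) (object_b u)" if "0 < r" "r < q" for r
      using rep(2,3)[OF object_a(1)[OF that]] B[OF object_a(1)[OF that] object_b(1)] by blast+
  qed
qed

end
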